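(* Let $Q\in\mathbb R^{n\times n}$ be symmetric positive semi-definite and $R\in\mathbb R^{d\times d}$ symmetric positive definite. Assume that for each $i\in\mathcal M$ there is a matrix $\overline P_i$ satisfying $$A_i'\overline P_i+\overline P_iA_i-\overline P_iB_iR^{-1}B_i'\overline P_i+\sum_{j=1}^m\pi_{ij}\overline P_j+Q\le0$$ and that the matrices $$Q-\tfrac12\,[P_iB_i-P_jB_j]\,R^{-1}\,[P_iB_i-P_jB_j]'$$ are positive definite for all $(i,j)\in\mathcal M^2$, where the $P_i$, $i\in\mathcal M$, are the (symmetric positive definite) solutions of the system of Riccati equations $$A_i'P_i+P_iA_i-P_iB_iR^{-1}B_i'P_i+\sum_{j=1}^m\pi_{ij}P_j+Q=0,\qquad i\in\mathcal M .$$ Then the feedback control law $$U(t)=-R^{-1}\sum_{i=1}^m\widehat\Phi_i(t)B_i'P_iX(t)$$ stabilizes the system $$d\begin{pmatrix}X(t)\\ \widehat\Phi(t)\end{pmatrix}=\begin{pmatrix}C(X(t))\widehat\Phi(t)\\ \Pi'\widehat\Phi(t)\end{pmatrix}dt+\begin{pmatrix}I_n\\ D(\widehat\Phi(t))C(X(t))'\end{pmatrix}dV(t)$$ almost surely, i.e. the resulting trajectories satisfy $$\limsup_{t\to\infty}\frac1t\log|X(t)|\le0\quad\text{almost surely.}$$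
   Context: A prime denotes transpose; $|v|$ is the Euclidean norm; for symmetric matrices $M\le0$ means $M$ is negative semi-definite. On a probability space $(\Omega,\mathcal A,\mathbb P)$, $\alpha(t)$ is a continuous-time Markov chain with finite state space $\mathcal M=\{1,\dots,m\}$ and transition rate matrix $\Pi=(\pi_{ij})\in\mathbb R^{m\times m}$, and $W(t)$ is a standard $\mathbb R^n$-valued Brownian motion. For $i\in\mathcal M$, $A_i\in\mathbb R^{n\times n}$ and $B_i\in\mathbb R^{n\times d}$. The state $X(t)\in\mathbb R^n$ and control $U(t)\in\mathbb R^d$ satisfy $$dX(t)=[A_{\alpha(t)}X(t)+B_{\alpha(t)}U(t)]\,dt+dW(t),$$ with square integrable initial condition $X(0)=x$; the initial condition, $\alpha(\cdot)$ and $W(\cdot)$ are mutually independent. $X$ is observed, $\alpha$ is not. Let $\mathcal F^X_t=\sigma\{X(s):s\le t\}$. The Wonham filter is $\widehat\Phi(t)=(\widehat\Phi_1(t),\dots,\widehat\Phi_m(t))'$ with $\widehat\Phi_i(t)=\mathbb E[1_{\{\alpha(t)=i\}}\mid\mathcal F^X_t]$, so $\widehat\Phi_i(t)\ge0$ and $\sum_i\widehat\Phi_i(t)=1$. With a feedback control $U(t)=U(X(t),\widehat\Phi(t))$, set $$C(X(t))=(A_1X(t)+B_1U(t),\dots,A_mX(t)+B_mU(t))\in\mathbb R^{n\times m},$$ $D(\varphi)=\mathrm{diag}(\varphi_1,\dots,\varphi_m)-\varphi\varphi'$ for $\varphi\in\mathbb R^m$; $I_n$ is the identity matrix. The innovation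 process $V$ (driving Brownian motion) is defined by $dV(t)=dX(t)-C(X(t))\widehat\Phi(t)\,dt$, and with this notation $(X,\widehat\Phi)$ satisfies the system displayed in the claim. *)

theory Defs
  imports "HOL-Probability.Probability"
begin

section \<open>Matrices\<close>

definition symmetric_mat :: "real ^ 'n ^ 'n \<Rightarrow> bool" where
  "symmetric_mat S \<longleftrightarrow> transpose S = S"

definition pos_semidef :: "real ^ 'n ^ 'n \<Rightarrow> bool" where
  "pos_semidef S \<longleftrightarrow> symmetric_mat S \<and> (\<forall>v. 0 \<le> v \<bullet> (S *v v))"

definition neg_semidef :: "real ^ 'n ^ 'n \<Rightarrow> bool" where
  "neg_semidef S \<longleftrightarrow> symmetric_mat S \<and> (\<forall>v. v \<bullet> (S *v v) \<le> 0)"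

definition pos_def :: "real ^ 'n ^ 'n \<Rightarrow> bool" where
  "pos_def S \<longleftrightarrow> symmetric_mat S \<and> (\<forall>v. v \<noteq> 0 \<longrightarrow> 0 < v \<bullet> (S *v v))"

(* On matrix types the operation * is componentwise, so the library's exp does not apply;
   the powers here are taken with respect to **. *)
definition mat_exp :: "real ^ 'n ^ 'n \<Rightarrow> real ^ 'n ^ 'n" where
  "mat_exp S = (\<Sum>k. (1 / fact k) *\<^sub>R (((**) S) ^^ k) (mat 1))"

section \<open>Filtrations generated by processes\<close>

(* Processes are functions real => 'w => 'a; only times t >= 0 are ever relevant. *)

definition generated_by ::
  "'w measure \<Rightarrow> 'a measure \<Rightarrow> real set \<Rightarrow> (real \<Rightarrow> 'w \<Rightarrow> 'a) \<Rightarrow> 'w measure" where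
  "generated_by M N T Y = sigma (space M) {Y t -` E \<inter> space M | t E. t \<in> T \<and> E \<in> sets N}"

definition natural_filtration ::
  "'w measure \<Rightarrow> (real \<Rightarrow> 'w \<Rightarrow> 'a::topological_space) \<Rightarrow> real \<Rightarrow> 'w measure" where
  "natural_filtration M Y t = generated_by M borel {0..t} Y"

definition augment :: "'w measure \<Rightarrow> 'w measure \<Rightarrow> 'w measure" where
  "augment M F = sigma (space M) (sets F \<union> null_sets M)"

definition adapted_to ::
  "(real \<Rightarrow> 'w measure) \<Rightarrow> (real \<Rightarrow> 'w \<Rightarrow> 'a::topological_space) \<Rightarrow> bool" where
  "adapted_to F Y \<longleftrightarrow> (\<forall>t\<ge>0. Y t \<in> borel_measurable (F t))"

definition continuous_paths ::
  "'w measure \<Rightarrow> (real \<Rightarrow> 'w \<Rightarrow> 'a::topological_space) \<Rightarrow> bool" where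
  "continuous_paths M Y \<longleftrightarrow> (AE \<omega> in M. continuous_on {0..} (\<lambda>t. Y t \<omega>))"

section \<open>Brownian motion and Markov chains\<close>

definition brownian_motion ::
  "'w measure \<Rightarrow> (real \<Rightarrow> 'w measure) \<Rightarrow> (real \<Rightarrow> 'w \<Rightarrow> real ^ 'n) \<Rightarrow> bool" where
  "brownian_motion M F W \<longleftrightarrow>
     (\<forall>t\<ge>0. W t \<in> borel_measurable M) \<and>
     adapted_to F W \<and>
     (AE \<omega> in M. W 0 \<omega> = 0) \<and>
     continuous_paths M W \<and>
     (\<forall>s t. 0 \<le> s \<and> s < t \<longrightarrow>
        distributed M lborel (\<lambda>\<omega>. W t \<omega> - W s \<omega>)
          (\<lambda>x. ennreal (\<Prod>k\<in>UNIV. normal_density 0 (sqrt (t - s)) (x $ k))) \<and>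
        prob_space.indep_set M (sets (F s))
          {(\<lambda>\<omega>. W t \<omega> - W s \<omega>) -` E \<inter> space M | E. E \<in> sets borel})"

definition rate_matrix :: "real ^ 'm ^ 'm \<Rightarrow> bool" where
  "rate_matrix G \<longleftrightarrow> (\<forall>i j. i \<noteq> j \<longrightarrow> 0 \<le> G $ i $ j) \<and> (\<forall>i. (\<Sum>j\<in>UNIV. G $ i $ j) = 0)"

definition markov_chain ::
  "'w measure \<Rightarrow> real ^ 'm ^ 'm \<Rightarrow> (real \<Rightarrow> 'w \<Rightarrow> 'm::finite) \<Rightarrow> bool" where
  "markov_chain M G \<alpha> \<longleftrightarrow>
     rate_matrix G \<and>
     (\<forall>t\<ge>0. \<alpha> t \<in> measurable M (count_space UNIV)) \<and>
     (AE \<omega> in M. \<forall>t\<ge>0. \<exists>e>0. \<forall>s\<in>{t..<t + e}. \<alpha> s \<omega> = \<alpha> t \<omega>) \<and>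
     (\<forall>(K::nat) (t::nat \<Rightarrow> real) i. 0 \<le> t 0 \<and> (\<forall>k<K. t k \<le> t (Suc k)) \<longrightarrow>
        measure M {\<omega> \<in> space M. \<forall>k\<le>K. \<alpha> (t k) \<omega> = i k} =
        measure M {\<omega> \<in> space M. \<alpha> (t 0) \<omega> = i 0} *
          (\<Prod>k<K. mat_exp ((t (Suc k) - t k) *\<^sub>R G) $ i k $ i (Suc k)))"

section \<open>Ito integrals\<close>

(* A simple integrand is given by grid points tau 0 <= ... <= tau N and coefficients
   xi 0, ..., xi (N - 1); its value on the interval (tau k, tau (k + 1)] is xi k. *)

definition simple_integrand ::
  "'w measure \<Rightarrow> (real \<Rightarrow> 'w measure) \<Rightarrow> nat \<Rightarrow> (nat \<Rightarrow> real) \<Rightarrow>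
     (nat \<Rightarrow> 'w \<Rightarrow> real ^ 'n ^ 'l) \<Rightarrow> bool" where
  "simple_integrand M F N \<tau> \<xi> \<longleftrightarrow>
     0 \<le> \<tau> 0 \<and> (\<forall>k<N. \<tau> k \<le> \<tau> (Suc k)) \<and>
     (\<forall>k<N. \<xi> k \<in> borel_measurable (F (\<tau> k)) \<and> bounded (\<xi> k ` space M))"

definition simple_value ::
  "nat \<Rightarrow> (nat \<Rightarrow> real) \<Rightarrow> (nat \<Rightarrow> 'w \<Rightarrow> real ^ 'n ^ 'l) \<Rightarrow> real \<Rightarrow> 'w \<Rightarrow> real ^ 'n ^ 'l" where
  "simple_value N \<tau> \<xi> s \<omega> = (\<Sum>k<N. indicator {\<tau> k<..\<tau> (Suc k)} s *\<^sub>R \<xi> k \<omega>)"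

definition simple_integral ::
  "(real \<Rightarrow> 'w \<Rightarrow> real ^ 'n) \<Rightarrow> nat \<Rightarrow> (nat \<Rightarrow> real) \<Rightarrow>
     (nat \<Rightarrow> 'w \<Rightarrow> real ^ 'n ^ 'l) \<Rightarrow> real \<Rightarrow> 'w \<Rightarrow> real ^ 'l" where
  "simple_integral V N \<tau> \<xi> t \<omega> =
     (\<Sum>k<N. \<xi> k \<omega> *v (V (min (\<tau> (Suc k)) t) \<omega> - V (min (\<tau> k) t) \<omega>))"

(* ito_integral M F V H I: I is (a version of) the integral of H with respect to the
   F-Brownian motion V, where H is a matrix-valued integrand with locally square integrable
   paths.  The two convergences are usually required in probability; passing to a
   subsequence, almost sure convergence may be required instead, and this avoids any
   question of measurability of the quantities that converge. *)
definition ito_integral ::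
  "'w measure \<Rightarrow> (real \<Rightarrow> 'w measure) \<Rightarrow> (real \<Rightarrow> 'w \<Rightarrow> real ^ 'n) \<Rightarrow>
     (real \<Rightarrow> 'w \<Rightarrow> real ^ 'n ^ 'l) \<Rightarrow> (real \<Rightarrow> 'w \<Rightarrow> real ^ 'l) \<Rightarrow> bool" where
  "ito_integral M F V H I \<longleftrightarrow>
     adapted_to F H \<and> adapted_to F I \<and> continuous_paths M I \<and>
     (AE \<omega> in M. set_borel_measurable lborel {0..} (\<lambda>s. H s \<omega>)) \<and>
     (\<exists>N \<tau> \<xi>. (\<forall>j. simple_integrand M F (N j) (\<tau> j) (\<xi> j)) \<and>
        (AE \<omega> in M. \<forall>T\<ge>0.
           ((\<lambda>j::nat. \<integral>\<^sup>+ s\<in>{0..T}.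
               ennreal ((norm (H s \<omega> - simple_value (N j) (\<tau> j) (\<xi> j) s \<omega>))\<^sup>2) \<partial>lborel)
             \<longlonglongrightarrow> 0) \<and>
           uniform_limit {0..T} (\<lambda>j t. simple_integral V (N j) (\<tau> j) (\<xi> j) t \<omega>)
             (\<lambda>t. I t \<omega>) sequentially))"

(* dZ(t) = b(t) dt + H(t) dV(t), in integrated form *)
definition ito_differential ::
  "'w measure \<Rightarrow> (real \<Rightarrow> 'w measure) \<Rightarrow> (real \<Rightarrow> 'w \<Rightarrow> real ^ 'n) \<Rightarrow>
     (real \<Rightarrow> 'w \<Rightarrow> real ^ 'l) \<Rightarrow> (real \<Rightarrow> 'w \<Rightarrow> real ^ 'l) \<Rightarrow>
     (real \<Rightarrow> 'w \<Rightarrow> real ^ 'n ^ 'l) \<Rightarrow> bool" where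
  "ito_differential M F V Z b H \<longleftrightarrow>
     adapted_to F Z \<and> continuous_paths M Z \<and> adapted_to F b \<and>
     (\<exists>I. ito_integral M F V H I \<and>
        (AE \<omega> in M. \<forall>t\<ge>0.
           ((\<lambda>s. b s \<omega>) has_integral (Z t \<omega> - Z 0 \<omega> - I t \<omega>)) {0..t}))"

section \<open>The switching system with hidden chain\<close>

(* dX = [A_alpha X + B_alpha U] dt + dW with U = u(X, Phi).  As usual for stochastic
   differential equations, the solution is non-anticipating: X(t) is a function of X(0) and of
   alpha and W up to time t, up to null sets. *)
definition switching_system ::
  "'w measure \<Rightarrow> ('m \<Rightarrow> real ^ 'n ^ 'n) \<Rightarrow> ('m \<Rightarrow> real ^ 'd ^ 'n) \<Rightarrow>
     (real ^ 'n \<Rightarrow> real ^ 'm \<Rightarrow> real ^ 'd) \<Rightarrow> (real \<Rightarrow> 'w \<Rightarrow> 'm::finite) \<Rightarrow>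
     (real \<Rightarrow> 'w \<Rightarrow> real ^ 'n) \<Rightarrow> (real \<Rightarrow> 'w \<Rightarrow> real ^ 'n) \<Rightarrow> (real \<Rightarrow> 'w \<Rightarrow> real ^ 'm) \<Rightarrow> bool" where
  "switching_system M A B u \<alpha> W X \<Phi> \<longleftrightarrow>
     X 0 \<in> borel_measurable M \<and>
     integrable M (\<lambda>\<omega>. (norm (X 0 \<omega>))\<^sup>2) \<and>
     prob_space.indep_sets M
       ((!) [sets (generated_by M borel {0} X),
             sets (generated_by M (count_space UNIV) {0..} \<alpha>),
             sets (generated_by M borel {0..} W)]) {..<3} \<and>
     continuous_paths M X \<and>
     adapted_to (\<lambda>t. augment M (sigma (space M)
        (sets (generated_by M borel {0} X) \<union>
         sets (generated_by M (count_space UNIV) {0..t} \<alpha>) \<union>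
         sets (generated_by M borel {0..t} W)))) X \<and>
     (AE \<omega> in M. \<forall>t\<ge>0.
        ((\<lambda>s. A (\<alpha> s \<omega>) *v X s \<omega> + B (\<alpha> s \<omega>) *v u (X s \<omega>) (\<Phi> s \<omega>))
           has_integral (X t \<omega> - X 0 \<omega> - W t \<omega>)) {0..t})"

(* The filter is the continuous version of the process of conditional probabilities. *)
definition wonham_filter ::
  "'w measure \<Rightarrow> (real \<Rightarrow> 'w \<Rightarrow> 'm::finite) \<Rightarrow> (real \<Rightarrow> 'w \<Rightarrow> real ^ 'n) \<Rightarrow>
     (real \<Rightarrow> 'w \<Rightarrow> real ^ 'm) \<Rightarrow> bool" where
  "wonham_filter M \<alpha> X \<Phi> \<longleftrightarrow>
     (\<forall>t\<ge>0. \<Phi> t \<in> borel_measurable M) \<and>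
     continuous_paths M \<Phi> \<and>
     (\<forall>t\<ge>0. \<forall>i. AE \<omega> in M.
        \<Phi> t \<omega> $ i =
        real_cond_exp M (natural_filtration M X t) (indicator {\<omega> \<in> space M. \<alpha> t \<omega> = i}) \<omega>)"

(* The matrix with columns A_i x + B_i v; its type real ^ 'm ^ 'n is that of n x m matrices. *)
definition C_mat ::
  "('m \<Rightarrow> real ^ 'n ^ 'n) \<Rightarrow> ('m \<Rightarrow> real ^ 'd ^ 'n) \<Rightarrow> real ^ 'n \<Rightarrow> real ^ 'd \<Rightarrow> real ^ 'm ^ 'n" where
  "C_mat A B x v = (\<chi> k i. (A i *v x + B i *v v) $ k)"

definition D_mat :: "real ^ 'm \<Rightarrow> real ^ 'm ^ 'm" where
  "D_mat \<phi> = (\<chi> i j. (if i = j then \<phi> $ i else 0) - \<phi> $ i * \<phi> $ j)"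

(* V is determined by the first equation, which says dV = dX - C Phi dt. *)
definition filter_system ::
  "'w measure \<Rightarrow> (real \<Rightarrow> 'w measure) \<Rightarrow> real ^ 'm ^ 'm \<Rightarrow>
     ('m \<Rightarrow> real ^ 'n ^ 'n) \<Rightarrow> ('m \<Rightarrow> real ^ 'd ^ 'n) \<Rightarrow>
     (real ^ 'n \<Rightarrow> real ^ 'm \<Rightarrow> real ^ 'd) \<Rightarrow> (real \<Rightarrow> 'w \<Rightarrow> real ^ 'n) \<Rightarrow>
     (real \<Rightarrow> 'w \<Rightarrow> real ^ 'n) \<Rightarrow> (real \<Rightarrow> 'w \<Rightarrow> real ^ 'm) \<Rightarrow> bool" where
  "filter_system M F G A B u V X \<Phi> \<longleftrightarrow>
     brownian_motion M F V \<and>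
     ito_differential M F V X
       (\<lambda>t \<omega>. C_mat A B (X t \<omega>) (u (X t \<omega>) (\<Phi> t \<omega>)) *v \<Phi> t \<omega>)
       (\<lambda>t \<omega>. mat 1) \<and>
     ito_differential M F V \<Phi>
       (\<lambda>t \<omega>. transpose G *v \<Phi> t \<omega>)
       (\<lambda>t \<omega>. D_mat (\<Phi> t \<omega>) ** transpose (C_mat A B (X t \<omega>) (u (X t \<omega>) (\<Phi> t \<omega>))))"

definition feedback_law ::
  "real ^ 'd ^ 'd \<Rightarrow> ('m::finite \<Rightarrow> real ^ 'd ^ 'n) \<Rightarrow> ('m \<Rightarrow> real ^ 'n ^ 'n) \<Rightarrow>
     real ^ 'n \<Rightarrow> real ^ 'm \<Rightarrow> real ^ 'd" where
  "feedback_law R B P x \<phi> =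
     - (matrix_inv R *v (\<Sum>i\<in>UNIV. \<phi> $ i *\<^sub>R (transpose (B i) *v (P i *v x))))"

definition riccati ::
  "real ^ 'm ^ 'm \<Rightarrow> ('m::finite \<Rightarrow> real ^ 'n ^ 'n) \<Rightarrow> ('m \<Rightarrow> real ^ 'd ^ 'n) \<Rightarrow>
     real ^ 'n ^ 'n \<Rightarrow> real ^ 'd ^ 'd \<Rightarrow> ('m \<Rightarrow> real ^ 'n ^ 'n) \<Rightarrow> 'm \<Rightarrow> real ^ 'n ^ 'n" where
  "riccati G A B Q R P i =
     transpose (A i) ** P i + P i ** A i
     - P i ** B i ** matrix_inv R ** transpose (B i) ** P i
     + (\<Sum>j\<in>UNIV. G $ i $ j *\<^sub>R P j) + Q"

(* limsup (1/t) log |x(t)| as t tends to infinity, with log 0 = -infinity. *)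
definition growth_rate :: "(real \<Rightarrow> real ^ 'n) \<Rightarrow> ereal" where
  "growth_rate x =
     Limsup at_top (\<lambda>t. if x t = 0 then - \<infinity> else ereal (1 / t * ln (norm (x t))))"

end

theory Submission
  imports Defs
begin

text \<open>
  With \<open>P = (P\<^sub>i)\<close> let \<open>E(t)\<close> be the expectation of \<open>X(t)'P\<^bsub>\<alpha>(t)\<^esub>X(t)\<close>. Since \<open>X\<close> is non-anticipating and \<open>X(0)\<close>,
  \<open>\<alpha>\<close>, \<open>W\<close> are independent, an elementary Dynkin formula holds for \<open>(X, \<alpha>)\<close>. In its drift the indicator
  of the hidden state may be replaced by the filter, because \<open>X(t)\<close> and the control are functions of the
  observations; by the Riccati equations the averaged drift equals minus a convex combination of the
  quadratic forms \<open>Q - (1/2)(P\<^sub>iB\<^sub>i - P\<^sub>jB\<^sub>j)R\<^sup>-\<^sup>1(P\<^sub>iB\<^sub>i - P\<^sub>jB\<^sub>j)'\<close>, up to a further nonpositive term. Only the trace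
  term of the noise remains, so \<open>E(t)\<close>, and with it the second moment of \<open>X(t)\<close>, grows at most linearly.

  Joint measurability in time and chance is never needed: the drift is compared with Riemann sums
  at right endpoints, where \<open>\<alpha>\<close> is right-continuous.

  On intervals of fixed short length \<open>X\<close> is controlled by its initial value and the oscillation of \<open>W\<close>, whose
  square has a uniformly bounded mean by dyadic chaining. Hence the suprema of \<open>|X|\<^sup>2\<close> over these
  intervals have linearly growing means, and multiplied by any geometric weight they are almost
  surely bounded.
\<close>

section \<open>Pathwise estimates\<close>

text \<open>The energy is also the mean of the sum over i of \<Phi>_i X'P_iX, a function of the
  observed pair, but it is expanded along \<alpha> and not along the filter. This takes only exact
  algebra of quadratic forms, the explicit transition probabilities of the chain, and the
  independence of the increments of W from X(0) and from the whole path of \<alpha>. In one time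
  step the chain moves first, with X frozen, and X moves afterwards in the final mode. The price is
  that the jump part of the generator appears at the left end of the step and the drift part at the
  right end; the dissipation inequality couples both at one time, and the mismatch telescopes over
  the grid. The matrices indexed by pairs arise because the control averages the vectors B_i'P_iX
  against the filter. The loss caused by averaging is governed by their variance in the form R^-1,
  and a variance is half a weighted sum of squared differences over pairs. The limsup sees only
  exponential rates, so linear growth of the mean square already forces the bound 0.\<close>

lemma dyadic_chaining:
  fixes f :: "real \<Rightarrow> 'a::real_normed_vector"
  assumes cont: "continuous_on {a..a+1} f" and "0 \<le> q" and r: "0 \<le> r" "r < 1"
    and inc: "\<And>n j. j < 2^n \<Longrightarrow>
      norm (f (a + real (Suc j) / 2^n) - f (a + real j / 2^n)) \<le> q * r^n"
    and s: "s \<in> {a..a+1}"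
  shows "norm (f s - f a) \<le> q / (1 - r)"
proof -
  \<comment> \<open>An odd point of level N + 1 is one increment away from its left neighbour, which
    already belongs to level N. So every level costs at most one increment, and the total is a
    geometric sum.\<close>
  have grid: "norm (f (a + real i / 2^N) - f a) \<le> q * (\<Sum>n\<le>N. r^n)" if "i \<le> 2^N" for N i
    using that
  proof (induction N arbitrary: i)
    case 0
    then have "i = 0 \<or> i = 1" by auto
    with inc[of 0 0] \<open>0 \<le> q\<close> show ?case by auto
  next
    case (Suc N)
    have half: "a + real (2 * l) / 2 ^ Suc N = a + real l / 2 ^ N" for l by simp
    have mono: "q * (\<Sum>n\<le>N. r^n) + q * r^Suc N = q * (\<Sum>n\<le>Suc N. r^n)"
      by (simp add: algebra_simps)
    show ?case
    proof (cases "even i")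
      case True
      then obtain l where "i = 2 * l" by auto
      moreover have "l \<le> 2 ^ N" using Suc.prems \<open>i = 2 * l\<close> by simp
      ultimately have "norm (f (a + real i / 2 ^ Suc N) - f a) \<le> q * (\<Sum>n\<le>N. r^n)"
        using Suc.IH[of l] half[of l] by simp
      moreover have "0 \<le> q * r ^ Suc N" using \<open>0 \<le> q\<close> r by simp
      ultimately show ?thesis using mono by linarith
    next
      case False
      then obtain l where i: "i = Suc (2 * l)" by (metis oddE Suc_eq_plus1)
      have lt: "2 * l < 2 ^ Suc N" using Suc.prems i by simp
      then have "norm (f (a + real (2 * l) / 2 ^ Suc N) - f a) \<le> q * (\<Sum>n\<le>N. r^n)"
        using Suc.IH[of l] half[of l] by simp
      moreover have "norm (f (a + real i / 2 ^ Suc N) - f a)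
          \<le> norm (f (a + real i / 2 ^ Suc N) - f (a + real (2 * l) / 2 ^ Suc N))
            + norm (f (a + real (2 * l) / 2 ^ Suc N) - f a)"
        using norm_triangle_ineq[of "f (a + real i / 2 ^ Suc N) - f (a + real (2 * l) / 2 ^ Suc N)"
            "f (a + real (2 * l) / 2 ^ Suc N) - f a"] by simp
      ultimately show ?thesis using inc[OF lt] mono unfolding i by linarith
    qed
  qed
  have geo: "(\<Sum>n\<le>N. r^n) \<le> 1 / (1 - r)" for N
  proof -
    have "(\<Sum>n\<le>N. r^n) \<le> (\<Sum>n. r^n)"
      using r by (intro sum_le_suminf summable_geometric) auto
    then show ?thesis using r suminf_geometric[of r] by simp
  qed
  \<comment> \<open>The last point of level N not beyond s. Continuity carries the bound from the
    dyadic points to s.\<close>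
  define x where "x N = a + real (nat \<lfloor>2^N * (s - a)\<rfloor>) / 2^N" for N :: nat
  have nn: "0 \<le> 2^N * (s - a)" for N using s by simp
  have le: "nat \<lfloor>2^N * (s - a)\<rfloor> \<le> 2^N" for N
  proof -
    have "2^N * (s - a) \<le> 2^N" using s by simp
    moreover have "real (nat \<lfloor>2^N * (s - a)\<rfloor>) \<le> 2^N * (s - a)" using nn[of N] by simp
    ultimately have "real (nat \<lfloor>2^N * (s - a)\<rfloor>) \<le> 2^N" by (rule order_trans[rotated])
    then have "real (nat \<lfloor>2^N * (s - a)\<rfloor>) \<le> real (2^N)" by (simp only: of_nat_power of_nat_numeral)
    then show ?thesis by (simp only: of_nat_le_iff)
  qed
  have bd: "norm (f (x N) - f a) \<le> q / (1 - r)" for N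
    using grid[OF le[of N]] mult_left_mono[OF geo \<open>0 \<le> q\<close>, of N] unfolding x_def by simp
  have xin: "x N \<in> {a..a+1}" for N
  proof -
    have "real (nat \<lfloor>2^N * (s - a)\<rfloor>) \<le> real (2^N)" using le[of N] by (rule of_nat_mono)
    then have "real (nat \<lfloor>2^N * (s - a)\<rfloor>) / 2^N \<le> 1" unfolding of_nat_power of_nat_numeral
      by (subst divide_le_eq_1_pos) auto
    moreover have "0 \<le> real (nat \<lfloor>2^N * (s - a)\<rfloor>) / 2^N" by (intro divide_nonneg_nonneg) auto
    ultimately show ?thesis unfolding x_def atLeastAtMost_iff by linarith
  qed
  have dist: "\<bar>x N - s\<bar> \<le> (1/2)^N" for N
  proof -
    define k where "k = real (nat \<lfloor>2^N * (s - a)\<rfloor>)"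
    have "k = of_int \<lfloor>2^N * (s - a)\<rfloor>" using nn[of N] by (simp add: k_def)
    then have "2^N * (s - a) - 1 \<le> k" and "k \<le> 2^N * (s - a)" by linarith+
    then have "\<bar>k - 2^N * (s - a)\<bar> / 2^N \<le> 1 / 2^N" by (intro divide_right_mono) auto
    moreover have "\<bar>k - 2^N * (s - a)\<bar> / 2^N = \<bar>k / 2^N - (s - a)\<bar>"
    proof -
      have "k / 2^N - (s - a) = (k - 2^N * (s - a)) / 2^N" by (simp add: diff_divide_distrib)
      then show ?thesis by simp
    qed
    ultimately have "\<bar>k / 2^N - (s - a)\<bar> \<le> 1 / 2^N" by simp
    then show ?thesis unfolding x_def k_def[symmetric] by (simp add: power_one_over algebra_simps)
  qed
  have "(\<lambda>N. x N - s) \<longlonglongrightarrow> 0"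
    by (rule tendsto_rabs_zero_cancel,
        rule tendsto_sandwich[OF _ _ tendsto_const LIMSEQ_realpow_zero[of "1/2"]])
       (use dist in auto)
  then have "x \<longlonglongrightarrow> s" by (simp add: LIM_zero_iff)
  then have "(\<lambda>N. f (x N)) \<longlonglongrightarrow> f s"
    by (rule continuous_on_tendsto_compose[OF cont _ s]) (rule always_eventually, rule allI, rule xin)
  then have "(\<lambda>N. norm (f (x N) - f a)) \<longlonglongrightarrow> norm (f s - f a)" by (intro tendsto_intros)
  then show ?thesis by (rule LIMSEQ_le_const2) (use bd in auto)
qed

text \<open>At a maximum point of |x| the drift contributes at most L * h <= 1/2 times that maximum,
  which is absorbed into the left-hand side. A short interval thus replaces the exponential of
  Gronwall's inequality by the factor 2.\<close>

lemma gronwall_short_interval: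
  fixes x w \<beta> :: "real \<Rightarrow> 'a::euclidean_space"
  assumes cont: "continuous_on {a..a+h} x" and h: "0 \<le> h" "L * h \<le> 1/2" and "0 \<le> L"
    and eq: "\<And>t. t \<in> {a..a+h} \<Longrightarrow> (\<beta> has_integral (x t - x a - (w t - w a))) {a..t}"
    and \<beta>: "\<And>s. s \<in> {a..a+h} \<Longrightarrow> norm (\<beta> s) \<le> L * norm (x s)"
    and w: "\<And>s. s \<in> {a..a+h} \<Longrightarrow> norm (w s - w a) \<le> S"
    and t: "t \<in> {a..a+h}"
  shows "norm (x t) \<le> 2 * (norm (x a) + S)"
proof -
  have "\<exists>t0\<in>{a..a+h}. \<forall>s\<in>{a..a+h}. norm (x s) \<le> norm (x t0)"
    by (rule continuous_attains_sup[OF compact_Icc _ continuous_on_norm[OF cont]]) (use h in auto)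
  then obtain t0 where t0: "t0 \<in> {a..a+h}"
    and max: "\<And>s. s \<in> {a..a+h} \<Longrightarrow> norm (x s) \<le> norm (x t0)" by blast
  have b: "norm (\<beta> s) \<le> L * norm (x t0)" if "s \<in> {a..t0}" for s
  proof -
    have "s \<in> {a..a+h}" using that t0 by auto
    then show ?thesis using \<beta> mult_left_mono[OF max \<open>0 \<le> L\<close>] order_trans by blast
  qed
  have "norm (x t0 - x a - (w t0 - w a)) \<le> L * norm (x t0) * (t0 - a)"
    using has_integral_bound_real[OF _ finite.emptyI eq[OF t0], of "L * norm (x t0)"] b t0 \<open>0 \<le> L\<close> by auto
  also have "\<dots> \<le> norm (x t0) * (L * h)"
    using mult_left_mono[of "t0 - a" h "L * norm (x t0)"] t0 \<open>0 \<le> L\<close> by (simp add: ac_simps)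
  also have "\<dots> \<le> norm (x t0) * (1/2)" using h by (intro mult_left_mono) auto
  finally have 1: "norm (x t0 - x a - (w t0 - w a)) \<le> norm (x t0) / 2" by simp
  have "x t0 = x a + (w t0 - w a) + (x t0 - x a - (w t0 - w a))" by simp
  then have "norm (x t0) \<le> norm (x a) + norm (w t0 - w a) + norm (x t0 - x a - (w t0 - w a))"
    using norm_triangle_ineq[of "x a + (w t0 - w a)" "x t0 - x a - (w t0 - w a)"] norm_triangle_ineq[of "x a" "w t0 - w a"]
    by simp
  then have "norm (x t0) \<le> norm (x a) + S + norm (x t0) / 2" using 1 w[OF t0] by linarith
  then have "norm (x t0) \<le> 2 * (norm (x a) + S)" by simp
  with max[OF t] show ?thesis by (rule order_trans)
qed

section \<open>Riemann sums at right endpoints\<close>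

lemma tendsto_matrix_vector_mult:
  fixes p :: "'b \<Rightarrow> real^'n^'m"
  assumes "(p \<longlongrightarrow> p0) F" "(y \<longlongrightarrow> y0) F"
  shows "((\<lambda>s. p s *v y s) \<longlongrightarrow> p0 *v y0) F"
  unfolding matrix_vector_mult_def
  by (intro vec_tendstoI) (auto intro!: tendsto_intros assms)

text \<open>Each sum is the integral of the function \<open>H N\<close> below, which tends to 0
  pointwise and boundedly. The grid points at which p and \<beta> are sampled approach s from the
  right, so right-continuity suffices for these two, which jump with the mode, while f is also
  sampled at left ends. Dominated convergence for the gauge integral asks of \<beta> only the
  integrability that the dynamics provide.\<close>

lemma tendsto_sum_right_endpoint:
  fixes f \<beta> :: "real \<Rightarrow> real^'n" and p :: "real \<Rightarrow> real^'n^'n"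
  assumes T: "0 < T" and f: "continuous_on {0..T} f"
    and p: "\<And>s. s \<in> {0..T} \<Longrightarrow> continuous (at s within {s..}) p"
    and \<beta>: "\<And>s. s \<in> {0..T} \<Longrightarrow> continuous (at s within {s..}) \<beta>"
    and int: "\<beta> integrable_on {0..T}"
    and fb: "\<And>s. s \<in> {0..T} \<Longrightarrow> norm (f s) \<le> z"
    and pb: "\<And>s y. s \<in> {0..T} \<Longrightarrow> norm (p s *v y) \<le> c * norm y" and c: "0 \<le> c"
    and \<beta>b: "\<And>s. s \<in> {0..T} \<Longrightarrow> norm (\<beta> s) \<le> l"
  shows "(\<lambda>N. \<Sum>k<N. f (T / real N * real k) \<bullet>
              (p (T / real N * (real k + 1)) *v integral {T / real N * real k..T / real N * (real k + 1)} \<beta>)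
            - T / real N * (f (T / real N * (real k + 1)) \<bullet>
              (p (T / real N * (real k + 1)) *v \<beta> (T / real N * (real k + 1))))) \<longlonglongrightarrow> 0"
    (is "?J \<longlonglongrightarrow> 0")
proof -
  \<comment> \<open>The right end of the cell, open on the left, that contains s. Mesh T / (N + 1)
    instead of T / N keeps the division meaningful for every N; the index is shifted back at the
    end.\<close>
  define u where "u N s = T / real (Suc N) * of_int \<lceil>s * real (Suc N) / T\<rceil>" for N s
  \<comment> \<open>At s = 0 the ceiling gives \<open>u N 0 = 0\<close>, whose left neighbour lies
    outside [0, T], where f is not controlled. The value 0 put there does not affect the
    integral.\<close>
  define H where "H N s = (if s \<le> 0 then 0 else
     f (u N s - T / real (Suc N)) \<bullet> (p (u N s) *v \<beta> s) - f (u N s) \<bullet> (p (u N s) *v \<beta> (u N s)))" for N s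
  have z: "0 \<le> z" using order_trans[OF norm_ge_zero fb[of 0]] T by simp
  have l: "0 \<le> l" using order_trans[OF norm_ge_zero \<beta>b[of 0]] T by simp
  have u1: "s \<le> u N s" "u N s \<le> s + T / real (Suc N)" for N s
  proof -
    have "s * real (Suc N) / T \<le> of_int \<lceil>s * real (Suc N) / T\<rceil>"
      "of_int \<lceil>s * real (Suc N) / T\<rceil> \<le> s * real (Suc N) / T + 1"
      by linarith+
    then have "T / real (Suc N) * (s * real (Suc N) / T) \<le> u N s"
      "u N s \<le> T / real (Suc N) * (s * real (Suc N) / T + 1)"
      unfolding u_def using T by (intro mult_left_mono; simp)+
    moreover have "T / real (Suc N) * (s * real (Suc N) / T) = s"
      using T by (simp add: field_simps del: of_nat_Suc)
    moreover have "T / real (Suc N) * (s * real (Suc N) / T + 1) = s + T / real (Suc N)" using T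
      by (simp add: field_simps del: of_nat_Suc)
    ultimately show "s \<le> u N s" "u N s \<le> s + T / real (Suc N)" by auto
  qed
  have ueq: "u N s = T / real (Suc N) * (real k + 1)"
    if "T / real (Suc N) * real k < s" "s \<le> T / real (Suc N) * (real k + 1)" for N s k
  proof -
    have "real k < s * real (Suc N) / T" "s * real (Suc N) / T \<le> real k + 1"
      using that T by (simp_all add: field_simps del: of_nat_Suc)
    then have "\<lceil>s * real (Suc N) / T\<rceil> = int k + 1" by (intro ceiling_unique) auto
    then show ?thesis unfolding u_def by simp
  qed
  have ex: "\<exists>k<Suc N. T / real (Suc N) * real k < s \<and> s \<le> T / real (Suc N) * (real k + 1)"
    if "0 < s" "s \<le> T" for N s
  proof -
    define k where "k = nat (\<lceil>s * real (Suc N) / T\<rceil> - 1)"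
    have pos: "0 < s * real (Suc N) / T" using that T by simp
    then have "1 \<le> \<lceil>s * real (Suc N) / T\<rceil>" by linarith
    then have k: "real k = of_int \<lceil>s * real (Suc N) / T\<rceil> - 1" unfolding k_def by simp
    have "s * real (Suc N) \<le> T * real (Suc N)" using that by (intro mult_right_mono) auto
    then have "s * real (Suc N) / T \<le> real (Suc N)" using T by (simp add: field_simps del: of_nat_Suc)
    then have "\<lceil>s * real (Suc N) / T\<rceil> \<le> int (Suc N)" by linarith
    then have "k < Suc N" unfolding k_def by linarith
    moreover have "real k < s * real (Suc N) / T" "s * real (Suc N) / T \<le> real k + 1"
      using k by linarith+
    then have "T / real (Suc N) * real k < s" "s \<le> T / real (Suc N) * (real k + 1)"
      using T by (simp_all add: field_simps del: of_nat_Suc)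
    ultimately show ?thesis by auto
  qed
  have uin: "u N s \<in> {0..T}" "u N s - T / real (Suc N) \<in> {0..T}" if s: "0 < s" "s \<le> T" for N s
  proof -
    obtain k where k: "k < Suc N" "T / real (Suc N) * real k < s" "s \<le> T / real (Suc N) * (real k + 1)"
      using ex[OF s] by blast
    have eq: "u N s = T / real (Suc N) * (real k + 1)" using ueq k by blast
    have "T / real (Suc N) * (real k + 1) \<le> T / real (Suc N) * real (Suc N)"
      using k(1) T by (intro mult_left_mono) auto
    then have "u N s \<le> T" using eq by simp
    moreover have "u N s - T / real (Suc N) = T / real (Suc N) * real k" unfolding eq by (simp add: algebra_simps add_divide_distrib)
    moreover have "0 \<le> T / real (Suc N) * real k" "0 \<le> T / real (Suc N)" using T by auto
    ultimately show "u N s \<in> {0..T}" "u N s - T / real (Suc N) \<in> {0..T}" by auto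
  qed
  have tm: "\<bar>f s1 \<bullet> (p s2 *v \<beta> s3)\<bar> \<le> z * (c * l)" if "s1 \<in> {0..T}" "s2 \<in> {0..T}" "s3 \<in> {0..T}" for s1 s2 s3
  proof -
    have "\<bar>f s1 \<bullet> (p s2 *v \<beta> s3)\<bar> \<le> norm (f s1) * norm (p s2 *v \<beta> s3)" by (rule Cauchy_Schwarz_ineq2)
    also have "\<dots> \<le> z * (c * l)"
      using fb that z pb[of s2 "\<beta> s3"] mult_left_mono[OF \<beta>b[of s3] c]
      by (intro mult_mono) auto
    finally show ?thesis .
  qed
  have piece: "(H N has_integral
       (f (T / real (Suc N) * real k) \<bullet> (p (T / real (Suc N) * (real k + 1)) *v integral {T / real (Suc N) * real k..T / real (Suc N) * (real k + 1)} \<beta>)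
            - T / real (Suc N) * (f (T / real (Suc N) * (real k + 1)) \<bullet> (p (T / real (Suc N) * (real k + 1)) *v \<beta> (T / real (Suc N) * (real k + 1))))))
       {T / real (Suc N) * real k..T / real (Suc N) * (real k + 1)}" if k: "k < Suc N" for N k :: nat
  proof -
    let ?a = "T / real (Suc N) * real k" and ?b = "T / real (Suc N) * (real k + 1)"
    have ab: "0 \<le> ?a" using T by simp
    have ab': "?a \<le> ?b" using T by (intro mult_left_mono) auto
    note ab = ab ab'
    have "?b \<le> T / real (Suc N) * real (Suc N)" using k T by (intro mult_left_mono) auto
    then have bT: "?b \<le> T" by simp
    have "\<beta> integrable_on {?a..?b}" by (rule integrable_on_subinterval[OF int]) (use ab bT in auto)
    then have "(\<beta> has_integral integral {?a..?b} \<beta>) {?a..?b}" by (rule integrable_integral)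
    moreover have "bounded_linear (\<lambda>y. f ?a \<bullet> (p ?b *v y))"
      using bounded_linear_compose[OF bounded_linear_inner_right matrix_vector_mul_bounded_linear] by simp
    ultimately have 1: "((\<lambda>s. f ?a \<bullet> (p ?b *v \<beta> s)) has_integral (f ?a \<bullet> (p ?b *v integral {?a..?b} \<beta>))) {?a..?b}"
      by (rule has_integral_linear[unfolded o_def])
    have "((\<lambda>s. f ?b \<bullet> (p ?b *v \<beta> ?b)) has_integral ((?b - ?a) * (f ?b \<bullet> (p ?b *v \<beta> ?b)))) {?a..?b}"
      using has_integral_const_real[of "f ?b \<bullet> (p ?b *v \<beta> ?b)" ?a ?b] ab by simp
    moreover have "?b - ?a = T / real (Suc N)" by (simp add: distrib_left add_divide_distrib)
    ultimately have "((\<lambda>s. f ?b \<bullet> (p ?b *v \<beta> ?b)) has_integral (T / real (Suc N) * (f ?b \<bullet> (p ?b *v \<beta> ?b)))) {?a..?b}"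
      by simp
    from has_integral_diff[OF 1 this]
    show ?thesis
    \<comment> \<open>The left end of the cell is exempted because \<open>u N\<close> does not move
      it to the right end of this cell.\<close>
    proof (rule has_integral_spike_finite[of "{?a}", rotated 2])
      fix s assume s: "s \<in> {?a..?b} - {?a}"
      then have s2: "?a < s" "s \<le> ?b" by auto
      then have "u N s = ?b" using ueq[of N k s] by (simp add: add.commute)
      moreover have "?b - T / real (Suc N) = ?a" by (simp add: distrib_left add_divide_distrib)
      ultimately show "H N s = f ?a \<bullet> (p ?b *v \<beta> s) - f ?b \<bullet> (p ?b *v \<beta> ?b)"
        using s2 ab unfolding H_def by simp
    qed auto
  qed
  have sum_piece: "(H N has_integral (\<Sum>k<m. f (T / real (Suc N) * real k) \<bullet> (p (T / real (Suc N) * (real k + 1)) *v integral {T / real (Suc N) * real k..T / real (Suc N) * (real k + 1)} \<beta>)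
            - T / real (Suc N) * (f (T / real (Suc N) * (real k + 1)) \<bullet> (p (T / real (Suc N) * (real k + 1)) *v \<beta> (T / real (Suc N) * (real k + 1))))))
       {0..T / real (Suc N) * real m}" if "m \<le> Suc N" for N m :: nat
    using that
  proof (induction m)
    case 0
    show ?case using has_integral_refl(2) by simp
  next
    case (Suc m)
    have le: "0 \<le> T / real (Suc N) * m" using T by simp
    have le': "T / real (Suc N) * m \<le> T / real (Suc N) * (real m + 1)" using T by (intro mult_left_mono) auto
    show ?case
      using has_integral_combine[OF le le' Suc.IH piece[of m]] Suc.prems by (simp add: add.commute)
  qed
  have hasJ: "(H N has_integral ?J (Suc N)) {0..T}" for N
  proof -
    have "T / real (Suc N) * real (Suc N) = T" by simp
    with sum_piece[of "Suc N" N] show ?thesis by simp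
  qed
  have lim: "(\<lambda>N. H N s) \<longlonglongrightarrow> 0" if s: "s \<in> {0..T}" for s
  proof (cases "s = 0")
    case False
    then have s0: "0 < s" "s \<le> T" using s by auto
    have d0: "(\<lambda>N. T / real (Suc N)) \<longlonglongrightarrow> 0"
      by (intro LIMSEQ_Suc[OF lim_const_over_n])
    have us: "(\<lambda>N. u N s) \<longlonglongrightarrow> s"
      by (rule tendsto_sandwich[OF _ _ tendsto_const, of _ _ _ "\<lambda>N. s + T / real (Suc N)"])
         (use u1 tendsto_add[OF tendsto_const[of s] d0] in auto)
    have ls: "(\<lambda>N. u N s - T / real (Suc N)) \<longlonglongrightarrow> s" using tendsto_diff[OF us d0] by simp
    have f1: "(\<lambda>N. f (u N s)) \<longlonglongrightarrow> f s" "(\<lambda>N. f (u N s - T / real (Suc N))) \<longlonglongrightarrow> f s"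
      using continuous_on_tendsto_compose[OF f us s] continuous_on_tendsto_compose[OF f ls s] uin[OF s0] by auto
    have p1: "(\<lambda>N. p (u N s)) \<longlonglongrightarrow> p s"
      by (rule continuous_within_tendsto_compose'[OF p[OF s] _ us]) (use u1 in auto)
    have b1: "(\<lambda>N. \<beta> (u N s)) \<longlonglongrightarrow> \<beta> s"
      by (rule continuous_within_tendsto_compose'[OF \<beta>[OF s] _ us]) (use u1 in auto)
    have "(\<lambda>N. H N s) \<longlonglongrightarrow> f s \<bullet> (p s *v \<beta> s) - f s \<bullet> (p s *v \<beta> s)"
      using s0 unfolding H_def
      by (simp only: not_le[symmetric] if_False)
         (intro tendsto_intros f1 tendsto_matrix_vector_mult p1 b1)
    then show ?thesis by simp
  qed (simp add: H_def)
  have "(\<lambda>N. integral {0..T} (H N)) \<longlonglongrightarrow> integral {0..T} (\<lambda>_. 0)"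
  proof (rule dominated_convergence(2)[where h = "\<lambda>_. 2 * (z * (c * l))"])
    show "H N integrable_on {0..T}" for N using hasJ by (rule has_integral_integrable)
    show "(\<lambda>_. 2 * (z * (c * l))) integrable_on {0..T}" by (rule integrable_const_ivl)
    show "norm (H N s) \<le> 2 * (z * (c * l))" if s: "s \<in> {0..T}" for N s
    proof (cases "s = 0")
      case False
      then have s0: "0 < s" "s \<le> T" using s by auto
      show ?thesis
        using tm[OF uin(2)[OF s0] uin(1)[OF s0] s, of N N] tm[OF uin(1)[OF s0] uin(1)[OF s0] uin(1)[OF s0], of N N N] s0
        unfolding H_def by simp
    qed (use z c l in \<open>simp add: H_def\<close>)
  qed (use lim in auto)
  then have "(\<lambda>N. ?J (Suc N)) \<longlonglongrightarrow> 0" unfolding integral_unique[OF hasJ] integral_0 .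
  then show ?thesis by (rule LIMSEQ_imp_Suc)
qed

section \<open>Matrices and the Riccati equations\<close>

text \<open>The sum C of the absolute values of all entries dominates every absolute row sum, so
  multiplication by S on the left enlarges the largest entry by at most the factor C.\<close>

lemma mat_power_entry_bound:
  fixes S :: "real^'m^'m"
  shows "\<exists>C\<ge>0. \<forall>k i j. \<bar>(((**) S) ^^ k) (mat 1) $ i $ j\<bar> \<le> C^k"
proof -
  define C where "C = (\<Sum>i\<in>UNIV. \<Sum>j\<in>UNIV. \<bar>S $ i $ j\<bar>)"
  have row: "(\<Sum>l\<in>UNIV. \<bar>S $ i $ l\<bar>) \<le> C" for i
    unfolding C_def by (rule member_le_sum) (auto intro: sum_nonneg)
  have C: "0 \<le> C" unfolding C_def by (intro sum_nonneg) auto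
  have "\<bar>(((**) S) ^^ k) (mat 1) $ i $ j\<bar> \<le> C^k" for k i j
  proof (induction k arbitrary: i)
    case 0
    show ?case by (simp add: mat_def)
  next
    case (Suc k)
    have "\<bar>(((**) S) ^^ Suc k) (mat 1) $ i $ j\<bar> = \<bar>\<Sum>l\<in>UNIV. S $ i $ l * (((**) S) ^^ k) (mat 1) $ l $ j\<bar>"
      by (simp add: matrix_matrix_mult_def)
    also have "\<dots> \<le> (\<Sum>l\<in>UNIV. \<bar>S $ i $ l\<bar> * C^k)"
      by (rule order_trans[OF sum_abs]) (auto simp: abs_mult intro!: sum_mono mult_left_mono Suc.IH)
    also have "\<dots> \<le> C * C^k"
      unfolding sum_distrib_right[symmetric] using C by (intro mult_right_mono row) auto
    finally show ?case by simp
  qed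
  with C show ?thesis by blast
qed

lemma mat_power_scaleR:
  fixes S :: "real^'m^'m"
  shows "(((**) (d *\<^sub>R S)) ^^ k) (mat 1) = d^k *\<^sub>R (((**) S) ^^ k) (mat 1)"
proof (induction k)
  case (Suc k)
  show ?case using Suc
    by (simp add: matrix_matrix_mult_def vec_eq_iff sum_distrib_left ac_simps)
qed simp

text \<open>Domination by the scalar series of exp(C) shows that the infinite sum in
  \<open>mat_exp\<close> converges, so that its value is the limit and not the default of a
  divergent series.\<close>

lemma mat_exp_entry_sums:
  fixes S :: "real^'m^'m"
  shows "(\<lambda>k. (((**) S) ^^ k) (mat 1) $ i $ j / fact k) sums (mat_exp S $ i $ j)"
proof -
  obtain C where C: "C \<ge> 0" "\<And>k i j. \<bar>(((**) S) ^^ k) (mat 1) $ i $ j\<bar> \<le> C^k"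
    using mat_power_entry_bound by blast
  let ?t = "\<lambda>k i j. (((**) S) ^^ k) (mat 1) $ i $ j / fact k"
  have sm: "summable (\<lambda>k. ?t k i j)" for i j
  proof (rule summable_comparison_test')
    show "summable (\<lambda>k. C^k / fact k)" using summable_exp[of C] by (simp add: field_simps)
    show "norm (?t k i j) \<le> C^k / fact k" for k
      using C(2) by (simp add: divide_right_mono)
  qed
  have "(\<lambda>n. \<Sum>k<n. (1 / fact k) *\<^sub>R (((**) S) ^^ k) (mat 1)) \<longlonglongrightarrow> (\<chi> i j. \<Sum>k. ?t k i j)"
    using summable_LIMSEQ[OF sm] by (intro vec_tendstoI) (simp add: sum_component)
  then have "mat_exp S = (\<chi> i j. \<Sum>k. ?t k i j)"
    unfolding mat_exp_def by (intro sums_unique[symmetric]) (simp add: sums_def)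
  with summable_sums[OF sm] show ?thesis by simp
qed

text \<open>Entrywise, the tail after the linear term is dominated by exp(d * C) - 1 - d * C. An
  error quadratic in d is what allows T / d steps to be added up with a total error of order
  d.\<close>

lemma mat_exp_first_order:
  fixes S :: "real^'m^'m"
  shows "\<exists>C\<ge>0. \<forall>d i j. 0 \<le> d \<longrightarrow> d * C \<le> 1 \<longrightarrow>
    \<bar>mat_exp (d *\<^sub>R S) $ i $ j - mat 1 $ i $ j - d * S $ i $ j\<bar> \<le> (d * C)^2"
proof -
  obtain C where C: "C \<ge> 0" "\<And>k i j. \<bar>(((**) S) ^^ k) (mat 1) $ i $ j\<bar> \<le> C^k"
    using mat_power_entry_bound by blast
  have "\<bar>mat_exp (d *\<^sub>R S) $ i $ j - mat 1 $ i $ j - d * S $ i $ j\<bar> \<le> (d * C)^2"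
    if d: "0 \<le> d" "d * C \<le> 1" for d i j
  proof -
    let ?t = "\<lambda>k. (((**) (d *\<^sub>R S)) ^^ k) (mat 1) $ i $ j / fact k"
    have "(\<lambda>k. ?t (k + 2)) sums (mat_exp (d *\<^sub>R S) $ i $ j - (\<Sum>k<2. ?t k))"
      using mat_exp_entry_sums by (subst sums_iff_shift) simp
    moreover have "(\<Sum>k<2. ?t k) = mat 1 $ i $ j + d * S $ i $ j"
      by (simp add: numeral_2_eq_2)
    ultimately have s1: "(\<lambda>k. ?t (k + 2)) sums (mat_exp (d *\<^sub>R S) $ i $ j - mat 1 $ i $ j - d * S $ i $ j)"
      by (simp add: algebra_simps)
    have "(\<lambda>k. (d * C)^k / fact k) sums exp (d * C)"
      using exp_converges[of "d * C"] by (simp add: field_simps)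
    then have "(\<lambda>k. (d * C)^(k + 2) / fact (k + 2)) sums (exp (d * C) - (\<Sum>k<2. (d * C)^k / fact k))"
      by (subst sums_iff_shift) simp
    then have s2: "(\<lambda>k. (d * C)^(k + 2) / fact (k + 2)) sums (exp (d * C) - 1 - d * C)"
      by (simp add: numeral_2_eq_2 algebra_simps)
    have "\<bar>?t (k + 2)\<bar> \<le> (d * C)^(k + 2) / fact (k + 2)" for k
      using C(2)[of "k + 2" i j] d
      by (simp only: mat_power_scaleR vector_scaleR_component abs_divide abs_mult power_mult_distrib real_scaleR_def)
        (auto intro!: divide_right_mono mult_left_mono)
    then have "\<bar>mat_exp (d *\<^sub>R S) $ i $ j - mat 1 $ i $ j - d * S $ i $ j\<bar> \<le> exp (d * C) - 1 - d * C"
      using norm_suminf_le[of "\<lambda>k. ?t (k + 2)" "\<lambda>k. (d * C)^(k + 2) / fact (k + 2)"] s1 s2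
      by (simp add: sums_iff)
    also have "\<dots> \<le> (d * C)^2" using exp_bound[of "d * C"] d C(1) by simp
    finally show ?thesis .
  qed
  with C(1) show ?thesis by blast
qed

section \<open>Coercivity, bounds and inverses of matrices\<close>

lemma pos_def_bounded_below:
  fixes S :: "real^'n^'n"
  assumes "pos_def S"
  shows "\<exists>c>0. \<forall>x. c * (norm x)^2 \<le> x \<bullet> (S *v x)"
proof -
  have cont: "continuous_on (sphere 0 1) (\<lambda>x::real^'n. x \<bullet> (S *v x))"
    by (intro continuous_intros linear_continuous_on matrix_vector_mul_bounded_linear)
  have ne: "sphere (0::real^'n) 1 \<noteq> {}" by simp
  obtain y where y: "y \<in> sphere 0 1" and min: "\<And>x. x \<in> sphere 0 1 \<Longrightarrow> y \<bullet> (S *v y) \<le> x \<bullet> (S *v x)"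
    using continuous_attains_inf[OF compact_sphere ne cont] by blast
  have "y \<noteq> 0" using y by auto
  then have "0 < y \<bullet> (S *v y)" using assms by (simp add: pos_def_def)
  moreover have "y \<bullet> (S *v y) * (norm x)^2 \<le> x \<bullet> (S *v x)" for x
  proof (cases "x = 0")
    case False
    then have "y \<bullet> (S *v y) \<le> ((1 / norm x) *\<^sub>R x) \<bullet> (S *v ((1 / norm x) *\<^sub>R x))" by (intro min) simp
    also have "\<dots> = (x \<bullet> (S *v x)) / (norm x)^2"
      by (simp add: matrix_vector_mult_scaleR power2_eq_square)
    finally show ?thesis using False by (simp add: field_simps)
  qed simp
  ultimately show ?thesis by blast
qed

lemma pos_def_uniformly_bounded_below:
  fixes P :: "'m::finite \<Rightarrow> real^'n^'n"
  assumes "\<And>i. pos_def (P i)"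
  shows "\<exists>c>0. \<forall>i x. c * (norm x)^2 \<le> x \<bullet> (P i *v x)"
proof -
  obtain c where c: "\<And>i. c i > 0" "\<And>i x. c i * (norm x)^2 \<le> x \<bullet> (P i *v x)"
    using pos_def_bounded_below[OF assms] by metis
  have "Min (range c) > 0" using c(1) by (subst Min_gr_iff) auto
  moreover have "Min (range c) * (norm x)^2 \<le> x \<bullet> (P i *v x)" for i x
    by (rule order_trans[OF mult_right_mono c(2)]) auto
  ultimately show ?thesis by blast
qed

lemma matrix_family_bounded:
  fixes P :: "'m::finite \<Rightarrow> real^'n^'k"
  shows "\<exists>c>0. \<forall>i x. norm (P i *v x) \<le> c * norm x"
proof -
  have "\<forall>i. \<exists>c>0. \<forall>x. norm (P i *v x) \<le> norm x * c"
    using bounded_linear.pos_bounded[OF matrix_vector_mul_bounded_linear] by blast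
  then obtain c where c: "\<And>i. c i > 0" "\<And>i x. norm (P i *v x) \<le> norm x * c i" by metis
  have "c i \<le> Max (range c)" for i by simp
  then have "norm (P i *v x) \<le> Max (range c) * norm x" for i x
    using c(2)[of i x] mult_right_mono[of "c i" "Max (range c)" "norm x"] by (simp add: mult.commute)
  moreover have "0 < Max (range c)" using c(1) by (subst Max_gr_iff) auto
  ultimately show ?thesis by blast
qed

lemma pos_def_invertible:
  fixes R :: "real^'d^'d"
  assumes "pos_def R"
  shows "invertible R"
proof -
  have "x = 0" if "R *v x = 0" for x
    using assms that by (auto simp: pos_def_def)
  then show ?thesis
    using matrix_left_invertible_ker[of R] invertible_left_inverse by blast
qed

text \<open>Writing x as R applied to \<open>matrix_inv R *v x\<close> carries positivity and
  symmetry over from R to its inverse.\<close>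

lemma pos_def_matrix_inv:
  fixes R :: "real^'d^'d"
  assumes R: "pos_def R"
  shows "0 \<le> x \<bullet> (matrix_inv R *v x)" and "x \<bullet> (matrix_inv R *v y) = y \<bullet> (matrix_inv R *v x)"
proof -
  have inv: "R *v (matrix_inv R *v x) = x" for x
    using someI_ex[OF pos_def_invertible[OF R, unfolded invertible_def]]
    by (simp add: matrix_inv_def matrix_vector_mul_assoc)
  have pos: "0 \<le> v \<bullet> (R *v v)" for v
    using R by (cases "v = 0") (auto simp: pos_def_def intro: less_imp_le)
  have sym: "v \<bullet> (R *v w) = w \<bullet> (R *v v)" for v w
    using R dot_lmul_matrix[of v R w] unfolding pos_def_def symmetric_mat_def
    by (metis inner_commute transpose_matrix_vector)
  show "0 \<le> x \<bullet> (matrix_inv R *v x)"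
    using pos[of "matrix_inv R *v x"] by (simp add: inv inner_commute)
  show "x \<bullet> (matrix_inv R *v y) = y \<bullet> (matrix_inv R *v x)"
    using sym[of "matrix_inv R *v x" "matrix_inv R *v y"] by (simp add: inv inner_commute)
qed

text \<open>With w read as a probability vector this is E f(Y - Y', Y - Y') = 2 Var Y, where Y and
  Y' are independent copies taking the value \<open>y i\<close> with weight \<open>w i\<close> and
  the variance is meant in the form f. It turns an average over modes into an average over pairs of
  modes.\<close>

lemma weighted_square_variance:
  fixes w :: "'m::finite \<Rightarrow> real" and f :: "'a::real_vector \<Rightarrow> 'a \<Rightarrow> real" and y :: "'m \<Rightarrow> 'a"
  assumes f: "\<And>x y z. f (x + y) z = f x z + f y z" "\<And>c x z. f (c *\<^sub>R x) z = c * f x z"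
    and sym: "\<And>x z. f x z = f z x" and w: "(\<Sum>i\<in>UNIV. w i) = 1"
  shows "(\<Sum>i\<in>UNIV. \<Sum>j\<in>UNIV. w i * w j * f (y i - y j) (y i - y j)) =
    2 * ((\<Sum>i\<in>UNIV. w i * f (y i) (y i)) - f (\<Sum>i\<in>UNIV. w i *\<^sub>R y i) (\<Sum>i\<in>UNIV. w i *\<^sub>R y i))"
proof -
  have zero: "f 0 z = 0" for z using f(2)[of 0 0 z] by simp
  have sum: "f (\<Sum>i\<in>I. g i) z = (\<Sum>i\<in>I. f (g i) z)" for g :: "'m \<Rightarrow> 'a" and I z
    by (induction I rule: infinite_finite_induct) (auto simp: zero f)
  have fr: "f z (x + y) = f z x + f z y" "f z (c *\<^sub>R x) = c * f z x" for x y z c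
    by (subst (1 2 3) sym, rule f) (subst (1 2) sym, rule f)
  have sumr: "f z (\<Sum>i\<in>I. g i) = (\<Sum>i\<in>I. f z (g i))" for g :: "'m \<Rightarrow> 'a" and I z
    by (subst (1 2) sym) (rule sum)
  have minus: "f (x - y) z = f x z - f y z" "f z (x - y) = f z x - f z y" for x y z
    using f(1)[of x "(-1) *\<^sub>R y" z] f(2)[of "-1" y z] fr(1)[of z x "(-1) *\<^sub>R y"] fr(2)[of z "-1" y] by simp_all
  have e: "w i * w j * f (y i - y j) (y i - y j)
      = w j * (w i * f (y i) (y i)) + w i * (w j * f (y j) (y j)) - 2 * (w i * (w j * f (y i) (y j)))" for i j
    using sym[of "y j" "y i"] by (simp add: minus algebra_simps)
  have a: "(\<Sum>i\<in>UNIV. \<Sum>j\<in>UNIV. w i * (w j * f (y j) (y j))) = (\<Sum>i\<in>UNIV. w i * f (y i) (y i))"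
    unfolding sum_distrib_left[symmetric] sum_distrib_right[symmetric] w by simp
  have b: "(\<Sum>i\<in>UNIV. \<Sum>j\<in>UNIV. w j * (w i * f (y i) (y i))) = (\<Sum>i\<in>UNIV. w i * f (y i) (y i))"
    unfolding sum_distrib_right[symmetric] w by simp
  have c: "f (\<Sum>i\<in>UNIV. w i *\<^sub>R y i) (\<Sum>i\<in>UNIV. w i *\<^sub>R y i) = (\<Sum>i\<in>UNIV. \<Sum>j\<in>UNIV. w i * (w j * f (y i) (y j)))"
    by (simp add: sum f) (simp add: sumr fr sum_distrib_left)
  show ?thesis
    unfolding e sum.distrib sum_subtractf a b c by (simp add: sum_distrib_left)
qed

text \<open>Let y_i = B_i'P_ix, let m be the \<phi>-mean of these vectors and f the form of R^-1.
  The Riccati equation turns the bracket into f(y_i, y_i) - x'Qx - 2 f(y_i, m). In its \<phi>-mean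
  f(m, m) appears twice with a minus sign: one copy completes the variance of y, the other stays as
  a nonpositive remainder.\<close>

lemma riccati_feedback_dissipative:
  fixes A P :: "'m::finite \<Rightarrow> real^'n^'n" and B :: "'m \<Rightarrow> real^'d^'n"
    and Q :: "real^'n^'n" and R :: "real^'d^'d" and G :: "real^'m^'m"
  assumes R: "pos_def R" and P: "\<And>i. symmetric_mat (P i)"
    and ric: "\<And>i. riccati G A B Q R P i = 0"
    and Q: "\<And>i j. pos_semidef (Q - (1 / 2) *\<^sub>R ((P i ** B i - P j ** B j) ** matrix_inv R
                              ** transpose (P i ** B i - P j ** B j)))"
    and \<phi>: "\<And>i. 0 \<le> \<phi> $ i" "(\<Sum>i\<in>UNIV. \<phi> $ i) = 1"
  shows "(\<Sum>i\<in>UNIV. \<phi> $ i * (2 * (x \<bullet> (P i *v (A i *v x + B i *v feedback_law R B P x \<phi>)))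
            + (\<Sum>j\<in>UNIV. G $ i $ j * (x \<bullet> (P j *v x))))) \<le> 0"
proof -
  define f where "f y z = y \<bullet> (matrix_inv R *v z)" for y z :: "real^'d"
  define y where "y i = transpose (B i) *v (P i *v x)" for i
  define m where "m = (\<Sum>i\<in>UNIV. \<phi> $ i *\<^sub>R y i)"
  have f_add: "f (u + v) z = f u z + f v z" "f (c *\<^sub>R u) z = c * f u z" "f u z = f z u" for u v z c
    unfolding f_def by (simp_all add: inner_add_left pos_def_matrix_inv(2)[OF R, of u z])
  have tr: "u \<bullet> (transpose S *v v) = (S *v u) \<bullet> v" for S :: "real^'k^'l" and u v
    by (simp add: dot_lmul_matrix[symmetric] transpose_matrix_vector vector_transpose_matrix inner_commute)
  have tr': "u \<bullet> (S *v v) = (transpose S *v u) \<bullet> v" for S :: "real^'k^'l" and u v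
    using tr[of u "transpose S" v] by simp
  have Psym: "u \<bullet> (P i *v v) = (P i *v u) \<bullet> v" for u v i
    using tr'[of u "P i" v] unfolding P[of i, unfolded symmetric_mat_def] .
  have fb: "feedback_law R B P x \<phi> = - (matrix_inv R *v m)"
    unfolding feedback_law_def m_def y_def ..
  have PB: "x \<bullet> (P i *v (B i *v w)) = y i \<bullet> w" for i w
    unfolding y_def Psym by (rule tr')
  have rx: "x \<bullet> (riccati G A B Q R P i *v x) = 2 * (x \<bullet> (P i *v (A i *v x))) - f (y i) (y i)
     + (\<Sum>j\<in>UNIV. G $ i $ j * (x \<bullet> (P j *v x))) + x \<bullet> (Q *v x)" for i
  proof -
    have "(\<Sum>j\<in>UNIV. G $ i $ j *\<^sub>R P j) *v x = (\<Sum>j\<in>UNIV. G $ i $ j *\<^sub>R (P j *v x))"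
      by (induction rule: infinite_finite_induct[of _ UNIV])
        (auto simp: matrix_vector_mult_add_rdistrib scaleR_matrix_vector_assoc)
    moreover have "x \<bullet> (transpose (A i) *v (P i *v x)) = x \<bullet> (P i *v (A i *v x))"
      unfolding tr using Psym[of x i "A i *v x"] by (simp add: inner_commute)
    moreover have "x \<bullet> (P i *v (B i *v (matrix_inv R *v (transpose (B i) *v (P i *v x))))) = f (y i) (y i)"
      unfolding PB by (simp add: f_def y_def)
    ultimately show ?thesis
      unfolding riccati_def
      by (simp add: matrix_vector_mult_add_rdistrib matrix_vector_mult_diff_rdistrib
          matrix_vector_mul_assoc[symmetric] inner_add_right inner_diff_right inner_sum_right)
  qed
  then have ric': "2 * (x \<bullet> (P i *v (A i *v x))) + (\<Sum>j\<in>UNIV. G $ i $ j * (x \<bullet> (P j *v x)))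
      = f (y i) (y i) - x \<bullet> (Q *v x)" for i
    using rx[of i] ric[of i] by simp
  have Bm: "x \<bullet> (P i *v (B i *v (matrix_inv R *v m))) = f (y i) m" for i
    unfolding PB f_def ..
  have neg: "S *v (- v) = - (S *v v)" for S :: "real^'k^'l" and v
    using matrix_vector_mult_diff_distrib[of S 0 v] by simp
  have tm: "2 * (x \<bullet> (P i *v (A i *v x + B i *v feedback_law R B P x \<phi>)))
            + (\<Sum>j\<in>UNIV. G $ i $ j * (x \<bullet> (P j *v x))) = f (y i) (y i) - x \<bullet> (Q *v x) - 2 * f (y i) m" for i
    unfolding fb using ric'[of i] Bm[of i]
    by (simp add: matrix_vector_right_distrib matrix_vector_mult_diff_distrib inner_diff_right
        inner_add_right neg)
  have "f (\<Sum>i\<in>I. \<phi> $ i *\<^sub>R y i) m = (\<Sum>i\<in>I. \<phi> $ i * f (y i) m)" for I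
    by (induction I rule: infinite_finite_induct) (auto simp: f_add(1,2) f_def[of 0])
  then have fm: "(\<Sum>i\<in>UNIV. \<phi> $ i * f (y i) m) = f m m" unfolding m_def by metis
  have "0 \<le> f m m" unfolding f_def by (rule pos_def_matrix_inv(1)[OF R])
  have "(\<Sum>i\<in>UNIV. \<phi> $ i * (f (y i) (y i) - x \<bullet> (Q *v x) - 2 * f (y i) m))
     = (\<Sum>i\<in>UNIV. \<phi> $ i * f (y i) (y i)) - x \<bullet> (Q *v x) - 2 * f m m"
    using \<phi>(2) unfolding fm[symmetric]
    by (simp add: right_diff_distrib sum_subtractf sum_distrib_left sum_distrib_right[symmetric] ac_simps)
  also have "\<dots> = (1/2) * (\<Sum>i\<in>UNIV. \<Sum>j\<in>UNIV. \<phi> $ i * \<phi> $ j * f (y i - y j) (y i - y j))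
      - x \<bullet> (Q *v x) - f m m"
    using weighted_square_variance[of f "\<lambda>i. \<phi> $ i" y, OF f_add \<phi>(2)] unfolding m_def by (simp add: field_simps)
  \<comment> \<open>The products \<phi>_i \<phi>_j sum to 1, so x'Qx can be spread over all pairs
    and meets the variance pair by pair.\<close>
  also have "\<dots> = - (\<Sum>i\<in>UNIV. \<Sum>j\<in>UNIV. \<phi> $ i * \<phi> $ j * (x \<bullet> (Q *v x) - (1/2) * f (y i - y j) (y i - y j))) - f m m"
  proof -
    have "(\<Sum>i\<in>UNIV. \<Sum>j\<in>UNIV. \<phi> $ i * \<phi> $ j * q) = q" for q
      unfolding sum_distrib_right[symmetric] sum_product[symmetric] \<phi>(2) by simp
    moreover have "\<phi> $ i * \<phi> $ j * ((1/2) * z) = (1/2) * (\<phi> $ i * \<phi> $ j * z)" for i j z by simp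
    ultimately show ?thesis by (simp only: right_diff_distrib sum_subtractf sum_distrib_left[symmetric])
  qed
  also have "\<dots> \<le> 0"
  proof -
    have "0 \<le> x \<bullet> (Q *v x) - (1/2) * f (y i - y j) (y i - y j)" for i j
    proof -
      let ?D = "P i ** B i - P j ** B j"
      have "transpose ?D = transpose (P i ** B i) - transpose (P j ** B j)"
        by (simp add: transpose_def vec_eq_iff)
      then have "transpose ?D = transpose (B i) ** P i - transpose (B j) ** P j"
        using P by (simp add: matrix_transpose_mul symmetric_mat_def)
      then have d: "transpose ?D *v x = y i - y j"
        by (simp only: y_def matrix_vector_mult_diff_rdistrib matrix_vector_mul_assoc)
      have DD: "x \<bullet> (?D *v (matrix_inv R *v (transpose ?D *v x))) = f (y i - y j) (y i - y j)"
        unfolding f_def tr'[of x ?D] d ..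
      have "0 \<le> x \<bullet> ((Q - (1 / 2) *\<^sub>R (?D ** matrix_inv R ** transpose ?D)) *v x)"
        using Q[of i j] unfolding pos_semidef_def by blast
      also have "\<dots> = x \<bullet> (Q *v x) - (1/2) * f (y i - y j) (y i - y j)"
        unfolding DD[symmetric]
        by (simp only: matrix_vector_mult_diff_rdistrib inner_diff_right scaleR_matrix_vector_assoc[symmetric]
              matrix_vector_mul_assoc[symmetric] inner_scaleR_right)
      finally show ?thesis .
    qed
    then have "0 \<le> (\<Sum>i\<in>UNIV. \<Sum>j\<in>UNIV. \<phi> $ i * \<phi> $ j * (x \<bullet> (Q *v x) - (1/2) * f (y i - y j) (y i - y j)))"
      using \<phi>(1) by (intro sum_nonneg mult_nonneg_nonneg) auto
    with \<open>0 \<le> f m m\<close> show ?thesis by linarith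
  qed
  finally show ?thesis unfolding tm .
qed

section \<open>Orthogonality and Gaussian moments\<close>

text \<open>The three families will be the events of X(0), of the chain and of the noise, which
  together describe the past.\<close>

lemma Int_stable_Int3:
  assumes "Int_stable A" "Int_stable B" "Int_stable C"
  shows "Int_stable {a \<inter> b \<inter> c | a b c. a \<in> A \<and> b \<in> B \<and> c \<in> C}"
proof (rule Int_stableI_image[where I = UNIV and A = "\<lambda>x. x", THEN Int_stableD] Int_stableI)+
  fix x y assume "x \<in> {a \<inter> b \<inter> c | a b c. a \<in> A \<and> b \<in> B \<and> c \<in> C}"
    "y \<in> {a \<inter> b \<inter> c | a b c. a \<in> A \<and> b \<in> B \<and> c \<in> C}"
  then obtain a b c a' b' c' where "x = a \<inter> b \<inter> c" "y = a' \<inter> b' \<inter> c'"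
    "a \<in> A" "b \<in> B" "c \<in> C" "a' \<in> A" "b' \<in> B" "c' \<in> C" by blast
  moreover have "x \<inter> y = (a \<inter> a') \<inter> (b \<inter> b') \<inter> (c \<inter> c')" using calculation(1,2) by blast
  moreover have "a \<inter> a' \<in> A" "b \<inter> b' \<in> B" "c \<inter> c' \<in> C"
    using calculation assms by (auto simp: Int_stable_def)
  ultimately show "x \<inter> y \<in> {a \<inter> b \<inter> c | a b c. a \<in> A \<and> b \<in> B \<and> c \<in> C}" by blast
qed

text \<open>The augmentation is there because X is adapted only up to null sets. Null sets can join
  the generator without spoiling its stability under intersection, so the Dynkin argument still
  applies. The passage from sets to functions goes through the conditional expectation of g, which
  vanishes; hence integrability is asked of the product Z * g and of g, but not of Z.\<close>

lemma (in prob_space) integral_mult_eq_0_augment: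
  fixes g Z :: "'a \<Rightarrow> real"
  assumes stable: "Int_stable S" and S: "S \<subseteq> events" and F: "sets F \<subseteq> sigma_sets (space M) S"
    and g: "integrable M g" "(\<integral>\<omega>. g \<omega> \<partial>M) = 0"
    and zero: "\<And>A. A \<in> S \<Longrightarrow> (\<integral>\<omega>. indicator A \<omega> * g \<omega> \<partial>M) = 0"
    and Z: "Z \<in> borel_measurable (augment M F)" and int: "integrable M (\<lambda>\<omega>. Z \<omega> * g \<omega>)"
  shows "(\<integral>\<omega>. Z \<omega> * g \<omega> \<partial>M) = 0"
proof -
  define S' where "S' = S \<union> null_sets M"
  have S'M: "S' \<subseteq> events" unfolding S'_def using S by auto
  then have S'P: "S' \<subseteq> Pow (space M)" using sets.space_closed by blast
  have "a \<inter> b \<in> S'" if "a \<in> S'" "b \<in> S'" for a b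
  proof (cases "a \<in> null_sets M \<or> b \<in> null_sets M")
    case True
    then have "a \<inter> b \<in> null_sets M" using that S'M
      by (metis Int_commute null_set_Int1 null_set_Int2 subsetD)
    then show ?thesis by (simp add: S'_def)
  next
    case False
    then show ?thesis using that stable by (auto simp: S'_def Int_stable_def)
  qed
  then have stable': "Int_stable S'" by (auto simp: Int_stable_def)
  have sub: "sigma_sets (space M) S' \<subseteq> events" using S'M by (rule sets.sigma_sets_subset)
  have zero': "(\<integral>\<omega>. indicator A \<omega> * g \<omega> \<partial>M) = 0" if "A \<in> sigma_sets (space M) S'" for A
    using stable' S'P that
  proof (induction rule: sigma_sets_induct_disjoint)
    case (basic A)
    show ?case
    proof (cases "A \<in> S")
      case False
      then have A: "A \<in> null_sets M" using basic by (simp add: S'_def)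
      have "(\<integral>\<omega>. indicator A \<omega> * g \<omega> \<partial>M) = (\<integral>\<omega>. 0 \<partial>M)"
        using AE_not_in[OF A] null_setsD2[OF A] g(1)
        by (intro integral_cong_AE) (auto simp: indicator_def)
      then show ?thesis by simp
    qed (rule zero)
  next
    case empty
    show ?case by simp
  next
    case (compl A)
    then have A: "A \<in> events" using sub by blast
    have "(\<integral>\<omega>. indicator (space M - A) \<omega> * g \<omega> \<partial>M) = (\<integral>\<omega>. g \<omega> - indicator A \<omega> * g \<omega> \<partial>M)"
      by (intro Bochner_Integration.integral_cong) (auto simp: indicator_def)
    also have "\<dots> = 0"
      using compl g integrable_mult_indicator[OF A g(1)] by simp
    finally show ?case .
  next
    case (union A)
    then have A: "A i \<in> events" for i using sub by blast
    have "(\<integral>\<omega>\<in>(\<Union>i. A i). g \<omega> \<partial>M) = (\<Sum>i. (\<integral>\<omega>\<in>A i. g \<omega> \<partial>M))"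
    proof (rule lebesgue_integral_countable_add)
      show "A i \<inter> A j = {}" if "i \<noteq> j" for i j
        using union(1) that by (simp add: disjoint_family_on_def)
      show "set_integrable M (\<Union>i. A i) g"
        unfolding set_integrable_def using A by (intro integrable_mult_indicator g(1)) auto
    qed (rule A)
    then show ?case using union by (simp add: set_lebesgue_integral_def)
  qed
  define F' where "F' = sigma (space M) S'"
  have F'sets: "sets F' = sigma_sets (space M) S'" "space F' = space M"
    unfolding F'_def using S'P by auto
  interpret F': finite_measure_subalgebra M F'
    by unfold_locales (use sub F'sets in \<open>auto simp: subalgebra_def\<close>)
  have "sets F \<union> null_sets M \<subseteq> sigma_sets (space M) S'"
  proof -
    have "sigma_sets (space M) S \<subseteq> sigma_sets (space M) S'"
      by (rule sigma_sets_mono') (simp add: S'_def)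
    then show ?thesis using F by (auto simp: S'_def)
  qed
  moreover have "sets F \<union> null_sets M \<subseteq> Pow (space M)"
    using calculation sub sets.space_closed by blast
  ultimately have "subalgebra F' (augment M F)"
    unfolding subalgebra_def augment_def F'sets
    by (simp add: sigma_sets_mono)
  then have Z': "Z \<in> borel_measurable F'" using Z by (rule measurable_from_subalg)
  have "AE \<omega> in M. real_cond_exp M F' g \<omega> = 0"
    by (rule F'.real_cond_exp_charact) (use zero' g F'sets in \<open>auto simp: set_lebesgue_integral_def\<close>)
  then have "(\<integral>\<omega>. Z \<omega> * real_cond_exp M F' g \<omega> \<partial>M) = (\<integral>\<omega>. 0 \<partial>M)"
    using measurable_from_subalg[OF F'.subalg Z'] by (intro integral_cong_AE) auto
  then show ?thesis using F'.real_cond_exp_intg(2)[OF int Z'] g(1) by simp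
qed

lemma (in prob_space) integral_indicator_mult_indep:
  fixes g :: "'a \<Rightarrow> real"
  assumes A: "A \<in> events" and g: "integrable M g"
    and ind: "\<And>E. E \<in> sets borel \<Longrightarrow> prob (A \<inter> (g -` E \<inter> space M)) = prob A * prob (g -` E \<inter> space M)"
  shows "(\<integral>\<omega>. indicator A \<omega> * g \<omega> \<partial>M) = prob A * (\<integral>\<omega>. g \<omega> \<partial>M)"
proof -
  let ?I = "indicator A :: 'a \<Rightarrow> real"
  have [measurable]: "A \<in> events" "g \<in> borel_measurable M" using A g by auto
  have stable: "Int_stable {{}, A}" by (auto simp: Int_stable_def)
  have "Int_stable {g -` E \<inter> space M | E. E \<in> sets borel}"
  proof (rule Int_stableI)
    fix a b assume "a \<in> {g -` E \<inter> space M | E. E \<in> sets borel}" "b \<in> {g -` E \<inter> space M | E. E \<in> sets borel}"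
    then obtain E E' where "a = g -` E \<inter> space M" "b = g -` E' \<inter> space M" "E \<in> sets borel" "E' \<in> sets borel" by blast
    then show "a \<inter> b \<in> {g -` E \<inter> space M | E. E \<in> sets borel}"
      by (intro CollectI exI[of _ "E \<inter> E'"]) auto
  qed
  moreover have "indep_set {{}, A} {g -` E \<inter> space M | E. E \<in> sets borel}"
    by (rule indep_setI) (auto simp: ind)
  ultimately have ind_sig: "indep_set (sigma_sets (space M) {{}, A}) (sigma_sets (space M) {g -` E \<inter> space M | E. E \<in> sets borel})"
    using stable by (intro indep_set_sigma_sets)
  have sa: "sigma_sets (space M) {{}, A} \<supseteq> sigma_sets (space M) {?I -` E \<inter> space M | E. E \<in> sets borel}"
  proof (rule sigma_sets_mono, safe)
    fix E :: "real set"
    have "A \<subseteq> space M" using A sets.sets_into_space by blast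
    then have "?I -` E \<inter> space M = (if 1 \<in> E then if 0 \<in> E then space M else A else if 0 \<in> E then space M - A else {})"
      by (auto simp: indicator_def of_bool_def split: if_splits)
    then show "?I -` E \<inter> space M \<in> sigma_sets (space M) {{}, A}"
      by (auto intro: sigma_sets_top sigma_sets.Compl sigma_sets.Basic sigma_sets.Empty)
  qed
  have "indep_var borel ?I borel g"
    unfolding indep_var_eq
    using indep_sets_mono_sets[OF ind_sig[unfolded indep_set_def], of
        "case_bool (sigma_sets (space M) {?I -` E \<inter> space M | E. E \<in> sets borel})
           (sigma_sets (space M) {g -` E \<inter> space M | E. E \<in> sets borel})"] sa
    by (auto simp: indep_set_def split: bool.split)
  then have "(\<integral>\<omega>. ?I \<omega> * g \<omega> \<partial>M) = (\<integral>\<omega>. ?I \<omega> \<partial>M) * (\<integral>\<omega>. g \<omega> \<partial>M)"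
    using g by (intro indep_var_lebesgue_integral integrable_const_bound[of ?I 1]) auto
  then show ?thesis using A by simp
qed

section \<open>Moments of Gaussian vectors\<close>

lemma borel_measurable_vec_nth [measurable]: "(\<lambda>x::real^'n. x $ i) \<in> borel_measurable borel"
  by (intro borel_measurable_continuous_onI continuous_intros)

text \<open>The density is a product over coordinates. The indicator of E enters the l-th factor
  alone, and all other factors integrate to 1.\<close>

lemma (in prob_space) distributed_normal_component:
  fixes D :: "'a \<Rightarrow> real^'n"
  assumes \<sigma>: "0 < \<sigma>"
    and D: "distributed M lborel D (\<lambda>x. ennreal (\<Prod>k\<in>UNIV. normal_density 0 \<sigma> (x $ k)))"
  shows "distributed M lborel (\<lambda>\<omega>. D \<omega> $ l) (normal_density 0 \<sigma>)"
  unfolding distributed_def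
proof (intro conjI)
  have Dm[measurable]: "D \<in> borel_measurable M" using distributed_measurable[OF D] by simp
  show m: "(\<lambda>\<omega>. D \<omega> $ l) \<in> measurable M lborel" by simp
  show "(\<lambda>x. ennreal (normal_density 0 \<sigma> x)) \<in> borel_measurable lborel" by simp
  have basis: "(\<Prod>b\<in>Basis. h b) = (\<Prod>k\<in>UNIV. h (axis k 1))" for h :: "real^'n \<Rightarrow> ennreal"
  proof -
    have "Basis = range (\<lambda>k. axis k (1::real) :: real^'n)" by (auto simp: Basis_vec_def)
    moreover have "inj (\<lambda>k. axis k (1::real) :: real^'n)" by (auto simp: inj_on_def axis_eq_axis)
    ultimately show ?thesis using prod.reindex[of "\<lambda>k. axis k (1::real) :: real^'n" UNIV h] by (simp only: o_def)
  qed
  have one: "(\<integral>\<^sup>+y. ennreal (normal_density 0 \<sigma> y) \<partial>lborel) = 1"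
    using prob_space.emeasure_space_1[OF prob_space_normal_density[OF \<sigma>, of 0]]
    by (simp add: emeasure_density)
  show "distr M lborel (\<lambda>\<omega>. D \<omega> $ l) = density lborel (\<lambda>x. ennreal (normal_density 0 \<sigma> x))"
  proof (rule measure_eqI)
    fix E assume "E \<in> sets (distr M lborel (\<lambda>\<omega>. D \<omega> $ l))"
    then have [measurable]: "E \<in> sets borel" by simp
    define f where "f b = (if b = axis l (1::real) then (\<lambda>y. ennreal (normal_density 0 \<sigma> y) * indicator E y)
        else (\<lambda>y. ennreal (normal_density 0 \<sigma> y)))" for b :: "real^'n"
    have [measurable]: "f b \<in> borel_measurable borel" for b unfolding f_def by auto
    have "emeasure (distr M lborel (\<lambda>\<omega>. D \<omega> $ l)) E = (\<integral>\<^sup>+y. indicator E y \<partial>distr M lborel (\<lambda>\<omega>. D \<omega> $ l))"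
      by simp
    also have "\<dots> = (\<integral>\<^sup>+\<omega>. indicator E (D \<omega> $ l) \<partial>M)"
      by (rule nn_integral_distr[OF m]) simp
    also have "\<dots> = (\<integral>\<^sup>+x. ennreal (\<Prod>k\<in>UNIV. normal_density 0 \<sigma> (x $ k)) * indicator E (x $ l) \<partial>lborel)"
      by (rule distributed_nn_integral[OF D, symmetric]) simp
    also have "\<dots> = (\<integral>\<^sup>+x. (\<Prod>b\<in>Basis. f b (x \<bullet> b)) \<partial>lborel)"
    proof (rule nn_integral_cong)
      fix x :: "real^'n"
      have "(\<Prod>b\<in>Basis. f b (x \<bullet> b)) = f (axis l 1) (x $ l) * (\<Prod>k\<in>UNIV - {l}. f (axis k 1) (x $ k))"
        unfolding basis by (subst prod.remove[of _ l]) (auto simp: inner_axis)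
      also have "(\<Prod>k\<in>UNIV - {l}. f (axis k 1) (x $ k)) = (\<Prod>k\<in>UNIV - {l}. ennreal (normal_density 0 \<sigma> (x $ k)))"
        by (intro prod.cong) (auto simp: f_def axis_eq_axis)
      also have "f (axis l 1) (x $ l) * \<dots> = (\<Prod>k\<in>UNIV. ennreal (normal_density 0 \<sigma> (x $ k))) * indicator E (x $ l)"
        by (subst prod.remove[of UNIV l]) (auto simp: f_def ac_simps)
      finally show "ennreal (\<Prod>k\<in>UNIV. normal_density 0 \<sigma> (x $ k)) * indicator E (x $ l) = (\<Prod>b\<in>Basis. f b (x \<bullet> b))"
        by (simp add: prod_ennreal)
    qed
    also have "\<dots> = (\<Prod>b\<in>Basis. \<integral>\<^sup>+y. f b y \<partial>lborel)" by (rule nn_integral_lborel_prod) auto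
    also have "\<dots> = (\<integral>\<^sup>+y. f (axis l 1) y \<partial>lborel) * (\<Prod>k\<in>UNIV - {l}. \<integral>\<^sup>+y. f (axis k 1) y \<partial>lborel)"
      unfolding basis by (rule prod.remove) auto
    also have "(\<Prod>k\<in>UNIV - {l}. \<integral>\<^sup>+y. f (axis k 1) y \<partial>lborel) = (\<Prod>k\<in>UNIV - {l}. 1)"
      by (intro prod.cong) (auto simp: f_def axis_eq_axis one)
    finally show "emeasure (distr M lborel (\<lambda>\<omega>. D \<omega> $ l)) E = emeasure (density lborel (\<lambda>x. ennreal (normal_density 0 \<sigma> x))) E"
      by (simp add: f_def emeasure_density)
  qed simp
qed

lemma (in prob_space) normal_distributed_moments:
  assumes \<sigma>: "0 < \<sigma>" and D: "distributed M lborel D (normal_density 0 \<sigma>)"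
  shows "integrable M D" "expectation D = 0"
    and "integrable M (\<lambda>\<omega>. (D \<omega>)^2)" "expectation (\<lambda>\<omega>. (D \<omega>)^2) = \<sigma>^2"
    and "integrable M (\<lambda>\<omega>. (D \<omega>)^4)" "expectation (\<lambda>\<omega>. (D \<omega>)^4) = 3 * \<sigma>^4"
proof -
  have i: "integrable M (\<lambda>\<omega>. (D \<omega>)^k)" for k
    using distributed_integrable[OF D, of "\<lambda>x. x^k"] integrable_normal_moment[OF \<sigma>, of 0 k] by simp
  have e: "expectation (\<lambda>\<omega>. (D \<omega>)^k) = (\<integral>x. normal_density 0 \<sigma> x * (x - 0)^k \<partial>lborel)" for k
    using distributed_integral[OF D, of "\<lambda>x. x^k"] by simp
  show "integrable M D" using i[of 1] by simp
  show "expectation D = 0" by (rule normal_distributed_expectation[OF \<sigma> D])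
  show "integrable M (\<lambda>\<omega>. (D \<omega>)^2)" "integrable M (\<lambda>\<omega>. (D \<omega>)^4)" by (rule i)+
  show "expectation (\<lambda>\<omega>. (D \<omega>)^2) = \<sigma>^2"
    using e[of 2] integral_normal_moment_even[OF \<sigma>, of 0 1] by (simp add: fact_numeral)
  show "expectation (\<lambda>\<omega>. (D \<omega>)^4) = 3 * \<sigma>^4"
    using e[of 4] integral_normal_moment_even[OF \<sigma>, of 0 2]
    by (simp add: fact_numeral power_divide field_simps)
qed

section \<open>Brownian motion\<close>

lemma norm_power2_vec: "(norm (x::real^'n))^2 = (\<Sum>l\<in>UNIV. (x $ l)^2)"
  by (simp add: norm_vec_def L2_set_def sum_nonneg)

lemma norm_power4_vec_le: "(norm (x::real^'n))^4 \<le> CARD('n) * (\<Sum>l\<in>UNIV. (x $ l)^4)"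
proof -
  have "(norm x)^4 = (\<Sum>l\<in>UNIV. (x $ l)^2)^2" unfolding norm_power2_vec[symmetric] by simp
  also have "\<dots> \<le> (\<Sum>l\<in>UNIV. ((x $ l)^2)^2) * CARD('n)" by (rule sum_squared_le_sum_of_squares)
  finally show ?thesis by (simp add: mult.commute)
qed

context prob_space
begin

lemma brownian_increment:
  fixes W :: "real \<Rightarrow> 'a \<Rightarrow> real^'n" and s t :: real
  assumes W: "brownian_motion M F W" and st: "0 \<le> s" "s \<le> t"
  shows "integrable M (\<lambda>\<omega>. (W t \<omega> - W s \<omega>) $ l)" "expectation (\<lambda>\<omega>. (W t \<omega> - W s \<omega>) $ l) = 0"
    and "integrable M (\<lambda>\<omega>. (norm (W t \<omega> - W s \<omega>))^2)"
    "expectation (\<lambda>\<omega>. (norm (W t \<omega> - W s \<omega>))^2) = CARD('n) * (t - s)"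
    and "integrable M (\<lambda>\<omega>. (norm (W t \<omega> - W s \<omega>))^4)"
    "expectation (\<lambda>\<omega>. (norm (W t \<omega> - W s \<omega>))^4) \<le> 3 * CARD('n)^2 * (t - s)^2"
proof -
  let ?D = "\<lambda>l \<omega>. (W t \<omega> - W s \<omega>) $ l"
  have Wm[measurable]: "W t \<in> borel_measurable M" "W s \<in> borel_measurable M"
    using W st by (auto simp: brownian_motion_def)
  have m: "integrable M (?D l) \<and> expectation (?D l) = 0 \<and> integrable M (\<lambda>\<omega>. (?D l \<omega>)^2) \<and>
     expectation (\<lambda>\<omega>. (?D l \<omega>)^2) = t - s \<and> integrable M (\<lambda>\<omega>. (?D l \<omega>)^4) \<and>
     expectation (\<lambda>\<omega>. (?D l \<omega>)^4) = 3 * (t - s)^2" for l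
  \<comment> \<open>The definition of Brownian motion provides a density for s < t only. For s = t
    the increment is identically 0, and all claims are immediate.\<close>
  proof (cases "s = t")
    case False
    then have \<sigma>: "0 < sqrt (t - s)" using st by simp
    have "distributed M lborel (\<lambda>\<omega>. W t \<omega> - W s \<omega>)
          (\<lambda>x. ennreal (\<Prod>k\<in>UNIV. normal_density 0 (sqrt (t - s)) (x $ k)))"
      using W st False by (simp add: brownian_motion_def)
    from normal_distributed_moments[OF \<sigma> distributed_normal_component[OF \<sigma> this, of l]]
    have "integrable M (?D l)" "expectation (?D l) = 0" "integrable M (\<lambda>\<omega>. (?D l \<omega>)^2)"
     "expectation (\<lambda>\<omega>. (?D l \<omega>)^2) = (sqrt (t - s))^2" "integrable M (\<lambda>\<omega>. (?D l \<omega>)^4)"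
     "expectation (\<lambda>\<omega>. (?D l \<omega>)^4) = 3 * (sqrt (t - s))^4" by auto
    moreover have "(sqrt (t - s))^2 = t - s" using st by simp
    moreover have "(sqrt (t - s))^4 = ((sqrt (t - s))^2)^2" by (simp only: power_mult[symmetric]) simp
    ultimately show ?thesis by simp
  qed auto
  show "integrable M (?D l)" "expectation (?D l) = 0" using m by auto
  show "integrable M (\<lambda>\<omega>. (norm (W t \<omega> - W s \<omega>))^2)"
    "expectation (\<lambda>\<omega>. (norm (W t \<omega> - W s \<omega>))^2) = CARD('n) * (t - s)"
    unfolding norm_power2_vec using m by simp_all
  have i4: "integrable M (\<lambda>\<omega>. CARD('n) * (\<Sum>l\<in>UNIV. (?D l \<omega>)^4))" using m by simp
  show i: "integrable M (\<lambda>\<omega>. (norm (W t \<omega> - W s \<omega>))^4)"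
    by (rule Bochner_Integration.integrable_bound[OF i4])
       (use norm_power4_vec_le in \<open>auto intro!: AE_I2 order_trans[OF norm_power4_vec_le] abs_ge_self\<close>)
  have "expectation (\<lambda>\<omega>. (norm (W t \<omega> - W s \<omega>))^4) \<le> expectation (\<lambda>\<omega>. CARD('n) * (\<Sum>l\<in>UNIV. (?D l \<omega>)^4))"
    by (rule integral_mono[OF i i4 norm_power4_vec_le])
  also have "\<dots> = 3 * CARD('n)^2 * (t - s)^2"
    using m by (simp add: power2_eq_square)
  finally show "expectation (\<lambda>\<omega>. (norm (W t \<omega> - W s \<omega>))^4) \<le> 3 * CARD('n)^2 * (t - s)^2" .
qed

text \<open>The 2^n increments of level n have fourth moments of at most c / 4^n each, hence c / 2^n
  together; second moments would add up to a constant on each level and leave no decay. A weighted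
  sum Y of all the fourth powers has finite mean and bounds every increment of level n by q
  (9/10)^n, where q is the fourth root of Y. The explicit S stands in for the supremum, whose
  measurability is thereby never at issue, and C does not depend on the starting time.\<close>

lemma brownian_unit_interval_bound:
  fixes W :: "real \<Rightarrow> 'a \<Rightarrow> real^'n"
  assumes W: "brownian_motion M F W"
  shows "\<exists>C\<ge>0. \<forall>a\<ge>0. \<exists>S. S \<in> borel_measurable M \<and> (\<forall>\<omega>. 0 \<le> S \<omega>) \<and>
     integrable M (\<lambda>\<omega>. (S \<omega>)^2) \<and> expectation (\<lambda>\<omega>. (S \<omega>)^2) \<le> C \<and>
     (AE \<omega> in M. \<forall>s\<in>{a..a+1}. norm (W s \<omega> - W a \<omega>) \<le> S \<omega>)"
proof -
  define c where "c = 3 * (real CARD('n))^2"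
  \<comment> \<open>The weights are powers of 1 / r^4, where r is the chaining ratio. They must stay
    below 2 for the sum of (\<rho> / 2)^n to converge, that is r^4 > 1/2. With r = 9/10 the constant
    1 / (1 - r) is 10, whence the factor 10 in \<open>S\<close> and 100 in its square.\<close>
  define \<rho> where "\<rho> = 1 / (9/10::real)^4"
  define C where "C = c / (1 - \<rho> / 2)"
  have \<rho>: "0 < \<rho>" "\<rho> < 2" unfolding \<rho>_def by (simp_all add: power_divide)
  have c: "0 \<le> c" unfolding c_def by simp
  have C: "0 \<le> C" unfolding C_def using c \<rho> by simp
  have Wm[measurable]: "W t \<in> borel_measurable M" if "0 \<le> t" for t
    using W that by (auto simp: brownian_motion_def)
  have "\<exists>S. S \<in> borel_measurable M \<and> (\<forall>\<omega>. 0 \<le> S \<omega>) \<and>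
     integrable M (\<lambda>\<omega>. (S \<omega>)^2) \<and> expectation (\<lambda>\<omega>. (S \<omega>)^2) \<le> 100 * (1 + C) \<and>
     (AE \<omega> in M. \<forall>s\<in>{a..a+1}. norm (W s \<omega> - W a \<omega>) \<le> S \<omega>)" if a: "0 \<le> a" for a
  proof -
    define D where "D n j \<omega> = norm (W (a + real (Suc j) / 2^n) \<omega> - W (a + real j / 2^n) \<omega>)" for n j \<omega>
    define Q where "Q n \<omega> = (\<Sum>j<2^n. (D n j \<omega>)^4)" for n :: nat and \<omega>
    define Y where "Y \<omega> = (\<Sum>n. ennreal (\<rho>^n * Q n \<omega>))" for \<omega>
    \<comment> \<open>On the null set where \<open>Y\<close> is infinite, \<open>enn2real\<close>
      returns 0. Elsewhere \<open>y\<close> and \<open>Y\<close> agree.\<close>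
    define y where "y \<omega> = enn2real (Y \<omega>)" for \<omega>
    define S where "S \<omega> = 10 * sqrt (sqrt (y \<omega>))" for \<omega>
    have ge: "0 \<le> a + real j / 2^n" for j n using a by simp
    have Dm[measurable]: "D n j \<in> borel_measurable M" for n j
      unfolding D_def using ge[of j n] ge[of "Suc j" n] by measurable
    have D4: "integrable M (\<lambda>\<omega>. (D n j \<omega>)^4)" "expectation (\<lambda>\<omega>. (D n j \<omega>)^4) \<le> c / 4^n" for n j
    proof -
      have le: "a + real j / 2^n \<le> a + real (Suc j) / 2^n" by (simp add: divide_right_mono)
      have d: "(a + real (Suc j) / 2^n) - (a + real j / 2^n) = 1 / 2^n" by (simp add: add_divide_distrib)
      show "integrable M (\<lambda>\<omega>. (D n j \<omega>)^4)"
        unfolding D_def by (rule brownian_increment(5)[OF W ge le])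
      have "expectation (\<lambda>\<omega>. (D n j \<omega>)^4) \<le> c * (1 / 2^n)^2"
        using brownian_increment(6)[OF W ge le] unfolding D_def c_def d by simp
      also have "(1 / 2^n)^2 = (1::real) / 4^n"
        by (simp add: power_divide power2_eq_square power_mult_distrib[symmetric])
      finally show "expectation (\<lambda>\<omega>. (D n j \<omega>)^4) \<le> c / 4^n" by simp
    qed
    have Q0: "0 \<le> Q n \<omega>" for n \<omega> unfolding Q_def by (intro sum_nonneg) simp
    have Qi: "integrable M (Q n)" for n unfolding Q_def using D4(1) by simp
    have Qe: "expectation (Q n) \<le> c / 2^n" for n
    proof -
      have "expectation (Q n) = (\<Sum>j<2^n. expectation (\<lambda>\<omega>. (D n j \<omega>)^4))"
        unfolding Q_def using D4(1) by simp
      also have "\<dots> \<le> (\<Sum>j<(2::nat)^n. c / 4^n)" by (intro sum_mono D4(2))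
      also have "\<dots> = c / 2^n"
        by (simp add: field_simps power_mult_distrib[symmetric])
      finally show ?thesis .
    qed
    have [measurable]: "Q n \<in> borel_measurable M" for n using Qi by auto
    have Ym[measurable]: "Y \<in> borel_measurable M" unfolding Y_def by measurable
    have ym[measurable]: "y \<in> borel_measurable M" unfolding y_def by measurable
    have Sm: "S \<in> borel_measurable M" unfolding S_def by measurable
    have "(\<integral>\<^sup>+\<omega>. Y \<omega> \<partial>M) = (\<Sum>n. \<integral>\<^sup>+\<omega>. ennreal (\<rho>^n * Q n \<omega>) \<partial>M)"
      unfolding Y_def by (rule nn_integral_suminf) simp
    also have "\<dots> \<le> (\<Sum>n. ennreal (c * (\<rho>/2)^n))"
    proof (rule suminf_le)
      fix n
      have "(\<integral>\<^sup>+\<omega>. ennreal (\<rho>^n * Q n \<omega>) \<partial>M) = ennreal (expectation (\<lambda>\<omega>. \<rho>^n * Q n \<omega>))"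
        using Qi Q0 \<rho> by (intro nn_integral_eq_integral) auto
      also have "\<dots> \<le> ennreal (c * (\<rho>/2)^n)"
        using mult_left_mono[OF Qe[of n], of "\<rho>^n"] \<rho> by (intro ennreal_leI) (simp add: power_divide ac_simps)
      finally show "(\<integral>\<^sup>+\<omega>. ennreal (\<rho>^n * Q n \<omega>) \<partial>M) \<le> ennreal (c * (\<rho>/2)^n)" .
    qed auto
    also have "\<dots> = ennreal (\<Sum>n. c * (\<rho>/2)^n)"
      using c \<rho> by (intro suminf_ennreal2 summable_mult summable_geometric) auto
    also have "(\<Sum>n. c * (\<rho>/2)^n) = C"
      using \<rho> unfolding C_def by (subst suminf_mult) (auto intro: summable_geometric simp: suminf_geometric)
    finally have EY: "(\<integral>\<^sup>+\<omega>. Y \<omega> \<partial>M) \<le> ennreal C" .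
    then have "(\<integral>\<^sup>+\<omega>. Y \<omega> \<partial>M) \<noteq> \<infinity>" by (auto simp: top_unique)
    then have fin: "AE \<omega> in M. Y \<omega> \<noteq> \<infinity>" by (intro nn_integral_PInf_AE) auto
    have y0: "0 \<le> y \<omega>" for \<omega> by (simp add: y_def)
    have "(\<integral>\<^sup>+\<omega>. ennreal (y \<omega>) \<partial>M) \<le> (\<integral>\<^sup>+\<omega>. Y \<omega> \<partial>M)"
      unfolding y_def by (intro nn_integral_mono) (metis ennreal_enn2real_if order_refl zero_le)
    with EY have Ey: "(\<integral>\<^sup>+\<omega>. ennreal (y \<omega>) \<partial>M) \<le> ennreal C" by (rule order_trans[rotated])
    have iy: "integrable M y"
      using Ey y0 by (intro integrableI_nonneg) (auto simp: less_top[symmetric] top_unique)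
    have ey: "expectation y \<le> C"
      using Ey C y0 nn_integral_eq_integral[OF iy] by (simp add: y0)
    \<comment> \<open>The square of \<open>S\<close> contains the square root of \<open>y\<close>.
      Bounding the root by 1 + y leaves only the mean of \<open>y\<close> to be controlled.\<close>
    have S2: "(S \<omega>)^2 \<le> 100 * (1 + y \<omega>)" for \<omega>
    proof -
      have "sqrt (y \<omega>) \<le> 1 + y \<omega>"
        using y0[of \<omega>] by (intro real_le_lsqrt) (auto simp: power2_eq_square algebra_simps)
      then show ?thesis unfolding S_def using y0[of \<omega>] by (simp add: power_mult_distrib)
    qed
    have i1: "integrable M (\<lambda>\<omega>. 100 * (1 + y \<omega>))" using iy by simp
    have iS: "integrable M (\<lambda>\<omega>. (S \<omega>)^2)"
      by (rule Bochner_Integration.integrable_bound[OF i1]) (use S2 Sm y0 in auto)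
    have "expectation (\<lambda>\<omega>. (S \<omega>)^2) \<le> expectation (\<lambda>\<omega>. 100 * (1 + y \<omega>))"
      by (rule integral_mono[OF iS i1 S2])
    also have "\<dots> \<le> 100 * (1 + C)" using iy ey by (simp add: prob_space)
    finally have eS: "expectation (\<lambda>\<omega>. (S \<omega>)^2) \<le> 100 * (1 + C)" .
    have cont: "AE \<omega> in M. continuous_on {0..} (\<lambda>t. W t \<omega>)"
      using W by (simp add: brownian_motion_def continuous_paths_def)
    have "AE \<omega> in M. \<forall>s\<in>{a..a+1}. norm (W s \<omega> - W a \<omega>) \<le> S \<omega>"
      using cont fin
    proof eventually_elim
      case (elim \<omega>)
      show ?case
      proof
        fix s assume s: "s \<in> {a..a+1}"
        define q where "q = sqrt (sqrt (y \<omega>))"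
        have q0: "0 \<le> q" unfolding q_def by (simp add: y0)
        have q4: "q^4 = y \<omega>"
        proof -
          have "q^4 = (q^2)^2" by simp
          then show ?thesis unfolding q_def by (simp add: y0)
        qed
        have "norm (W s \<omega> - W a \<omega>) \<le> q / (1 - 9/10)"
        proof (rule dyadic_chaining[OF _ q0 _ _ _ s, where r = "9/10"])
          show "continuous_on {a..a+1} (\<lambda>s. W s \<omega>)"
            by (rule continuous_on_subset[OF elim(1)]) (use a in auto)
          fix n j :: nat assume j: "j < 2^n"
          have "ennreal (\<rho>^n * Q n \<omega>) \<le> Y \<omega>"
            unfolding Y_def using sum_le_suminf[of "\<lambda>n. ennreal (\<rho>^n * Q n \<omega>)" "{n}"] by simp
          then have "ennreal (\<rho>^n * Q n \<omega>) \<le> ennreal (y \<omega>)"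
            using elim(2) unfolding y_def by (simp add: ennreal_enn2real_if)
          then have "\<rho>^n * Q n \<omega> \<le> y \<omega>" using y0 by (simp add: ennreal_le_iff)
          moreover have "(D n j \<omega>)^4 \<le> Q n \<omega>"
            unfolding Q_def using j by (intro member_le_sum) auto
          then have "\<rho>^n * (D n j \<omega>)^4 \<le> \<rho>^n * Q n \<omega>" using \<rho> by (intro mult_left_mono) auto
          ultimately have "\<rho>^n * (D n j \<omega>)^4 \<le> q^4" unfolding q4 by linarith
          moreover have "\<rho>^n = 1 / ((9/10)^n)^4"
          proof -
            have "((9/10::real)^4)^n = ((9/10)^n)^4" by (simp only: power_mult[symmetric] mult.commute)
            then show ?thesis unfolding \<rho>_def power_one_over by simp
          qed
          ultimately have "(D n j \<omega>)^4 \<le> (q * (9/10)^n)^4"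
            by (simp add: power_mult_distrib divide_le_eq)
          then show "norm (W (a + real (Suc j) / 2^n) \<omega> - W (a + real j / 2^n) \<omega>) \<le> q * (9/10)^n"
            unfolding D_def using q0 by (subst (asm) power_mono_iff) auto
        qed (auto)
        then show "norm (W s \<omega> - W a \<omega>) \<le> S \<omega>" by (simp add: S_def q_def)
      qed
    qed
    with Sm iS eS y0 show ?thesis by (intro exI[of _ S]) (auto simp: S_def)
  qed
  then show ?thesis using C by (intro exI[of _ "100 * (1 + C)"]) auto
qed

end

section \<open>The hidden Markov chain\<close>

context prob_space
begin

lemma sets_generated_by:
  "sets (generated_by M N T Y) = sigma_sets (space M) {Y t -` E \<inter> space M | t E. t \<in> T \<and> E \<in> sets N}"
  unfolding generated_by_def by (rule sets_measure_of) auto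

lemma space_generated_by: "space (generated_by M N T Y) = space M"
  unfolding generated_by_def by (rule space_measure_of) auto

lemma measurable_generated_by:
  assumes "t \<in> T" "space N = UNIV"
  shows "Y t \<in> measurable (generated_by M N T Y) N"
  by (rule measurableI) (use assms in \<open>auto simp: sets_generated_by space_generated_by\<close>)

lemma generated_by_events:
  assumes "\<And>t. t \<in> T \<Longrightarrow> Y t \<in> measurable M N"
  shows "sets (generated_by M N T Y) \<subseteq> events"
  unfolding sets_generated_by by (rule sets.sigma_sets_subset) (use assms measurable_sets in blast)

lemma generated_by_mono:
  "T \<subseteq> T' \<Longrightarrow> sets (generated_by M N T Y) \<subseteq> sets (generated_by M N T' Y)"
  unfolding sets_generated_by by (rule sigma_sets_mono') auto

lemma sets_augment:
  assumes "sets F \<subseteq> events"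
  shows "sets (augment M F) = sigma_sets (space M) (sets F \<union> null_sets M)"
  unfolding augment_def using assms sets.space_closed[of M] by (intro sets_measure_of) auto

lemma space_augment:
  assumes "sets F \<subseteq> events"
  shows "space (augment M F) = space M"
  unfolding augment_def using assms sets.space_closed[of M] by (intro space_measure_of) auto

lemma subalgebra_augment:
  assumes "sets F \<subseteq> events"
  shows "subalgebra M (augment M F)"
  unfolding subalgebra_def sets_augment[OF assms] space_augment[OF assms]
  using assms by (auto intro!: sets.sigma_sets_subset)

lemma subalgebra_augment_mono:
  assumes "sets F \<subseteq> sets F'" "sets F' \<subseteq> events"
  shows "subalgebra (augment M F') (augment M F)"
proof -
  have "sets F \<subseteq> events" using assms by blast
  then show ?thesis
    unfolding subalgebra_def using assms
    by (simp add: sets_augment space_augment) (rule sigma_sets_mono', blast)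
qed

end

text \<open>The closed-loop dynamics are abstracted to a drift b that is continuous and grows at
  most linearly in x, uniformly for filter values in the unit cube. The Riccati matrices play no
  part until the energy is introduced.\<close>

locale hidden_switching = prob_space M
  for M :: "'w measure" +
  fixes G :: "real^'m^'m" and b :: "'m::finite \<Rightarrow> real^'n \<Rightarrow> real^'m \<Rightarrow> real^'n"
    and L :: real and \<alpha> :: "real \<Rightarrow> 'w \<Rightarrow> 'm" and W X :: "real \<Rightarrow> 'w \<Rightarrow> real^'n"
    and \<Phi> :: "real \<Rightarrow> 'w \<Rightarrow> real^'m"
  assumes markov: "markov_chain M G \<alpha>"
    and brownian: "brownian_motion M (natural_filtration M W) W"
    and X0: "X 0 \<in> borel_measurable M" "integrable M (\<lambda>\<omega>. (norm (X 0 \<omega>))\<^sup>2)"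
    and independent: "indep_sets
       ((!) [sets (generated_by M borel {0} X),
             sets (generated_by M (count_space UNIV) {0..} \<alpha>),
             sets (generated_by M borel {0..} W)]) {..<3}"
    and X_continuous: "continuous_paths M X"
    and X_adapted: "adapted_to (\<lambda>t. augment M (sigma (space M)
        (sets (generated_by M borel {0} X) \<union>
         sets (generated_by M (count_space UNIV) {0..t} \<alpha>) \<union>
         sets (generated_by M borel {0..t} W)))) X"
    and dynamics: "AE \<omega> in M. \<forall>t\<ge>0.
        ((\<lambda>s. b (\<alpha> s \<omega>) (X s \<omega>) (\<Phi> s \<omega>)) has_integral (X t \<omega> - X 0 \<omega> - W t \<omega>)) {0..t}"
    and filter: "wonham_filter M \<alpha> X \<Phi>"
    and b_continuous: "continuous_on UNIV (\<lambda>(x, \<phi>). b i x \<phi>)"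
    and L_nonneg: "0 \<le> L"
    and b_growth: "\<lbrakk>\<And>j. 0 \<le> \<phi> $ j; \<And>j. \<phi> $ j \<le> 1\<rbrakk> \<Longrightarrow> norm (b i x \<phi>) \<le> L * norm x"
begin

abbreviation \<open>\<X> \<equiv> sets (generated_by M borel {0} X)\<close>
abbreviation \<open>\<A> T \<equiv> sets (generated_by M (count_space UNIV) T \<alpha>)\<close>
abbreviation \<open>\<W> T \<equiv> sets (generated_by M borel T W)\<close>

lemma alpha_measurable: "0 \<le> t \<Longrightarrow> \<alpha> t \<in> measurable M (count_space UNIV)"
  using markov by (simp add: markov_chain_def)

lemma W_measurable: "0 \<le> t \<Longrightarrow> W t \<in> borel_measurable M"
  using brownian by (simp add: brownian_motion_def)

lemma alpha_event: "0 \<le> t \<Longrightarrow> {\<omega> \<in> space M. \<alpha> t \<omega> = i} \<in> events"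
  using measurable_sets[OF alpha_measurable, of t "{i}"] by (simp add: vimage_def Int_def conj_commute)

lemma alpha_event_generated: "t \<in> T \<Longrightarrow> {\<omega> \<in> space M. \<alpha> t \<omega> = i} \<in> \<A> T"
  using measurable_sets[OF measurable_generated_by[of t T "count_space UNIV" \<alpha>], of "{i}"]
  by (simp add: space_generated_by vimage_def Int_def conj_commute)

lemma generated_events: "\<X> \<subseteq> events" "T \<subseteq> {0..} \<Longrightarrow> \<A> T \<subseteq> events" "T \<subseteq> {0..} \<Longrightarrow> \<W> T \<subseteq> events"
  using X0(1) alpha_measurable W_measurable by (auto intro!: generated_by_events)

lemma past_events:
  assumes "S \<subseteq> {0..}" "T \<subseteq> {0..}"
  shows "sets (sigma (space M) (\<X> \<union> \<A> S \<union> \<W> T)) = sigma_sets (space M) (\<X> \<union> \<A> S \<union> \<W> T)"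
    and "sets (sigma (space M) (\<X> \<union> \<A> S \<union> \<W> T)) \<subseteq> events"
proof -
  have ev: "\<X> \<union> \<A> S \<union> \<W> T \<subseteq> events" using generated_events assms by auto
  then have "\<X> \<union> \<A> S \<union> \<W> T \<subseteq> Pow (space M)" using sets.space_closed by blast
  then show 1: "sets (sigma (space M) (\<X> \<union> \<A> S \<union> \<W> T)) = sigma_sets (space M) (\<X> \<union> \<A> S \<union> \<W> T)"
    by (rule sets_measure_of)
  show "sets (sigma (space M) (\<X> \<union> \<A> S \<union> \<W> T)) \<subseteq> events"
    unfolding 1 using ev by (rule sets.sigma_sets_subset)
qed

text \<open>The chain may be known on a time set S beyond [0, t]. Taking \<open>S = {0..}\<close>
  puts the whole path of \<alpha> into the past, as the noise term requires, whose coefficient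
  depends on a later mode.\<close>

lemma X_past_measurable:
  assumes "0 \<le> t" "{0..t} \<subseteq> S" "S \<subseteq> {0..}"
  shows "X t \<in> borel_measurable (augment M (sigma (space M) (\<X> \<union> \<A> S \<union> \<W> {0..t})))"
proof -
  have "X t \<in> borel_measurable (augment M (sigma (space M) (\<X> \<union> \<A> {0..t} \<union> \<W> {0..t})))"
    using X_adapted assms(1) by (simp add: adapted_to_def)
  moreover have "sets (sigma (space M) (\<X> \<union> \<A> {0..t} \<union> \<W> {0..t})) \<subseteq> sets (sigma (space M) (\<X> \<union> \<A> S \<union> \<W> {0..t}))"
  proof -
    have a: "{0..t} \<subseteq> {0..}" by auto
    show ?thesis unfolding past_events(1)[OF a a] past_events(1)[OF assms(3) a]
      using generated_by_mono[OF assms(2), of "count_space UNIV" \<alpha>] by (intro sigma_sets_mono') blast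
  qed
  moreover have "sets (sigma (space M) (\<X> \<union> \<A> S \<union> \<W> {0..t})) \<subseteq> events"
    by (rule past_events(2)[OF assms(3)]) simp
  ultimately show ?thesis
    by (blast intro: measurable_from_subalg subalgebra_augment_mono)
qed

lemma X_measurable:
  assumes "0 \<le> t"
  shows "X t \<in> borel_measurable M"
proof (rule measurable_from_subalg[OF subalgebra_augment X_past_measurable])
  show "sets (sigma (space M) (\<X> \<union> \<A> {0..} \<union> \<W> {0..t})) \<subseteq> events"
    by (rule past_events(2)) auto
qed (use assms in auto)

lemma prob_Int_independent:
  assumes "a \<in> \<X>" "e \<in> \<A> {0..}" "c \<in> \<W> {0..}"
  shows "prob (a \<inter> e \<inter> c) = prob a * prob e * prob c"
proof -
  have I: "{..<3} = {0, Suc 0, Suc (Suc 0)}" by auto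
  have "prob (\<Inter>j\<in>{..<3}. [a, e, c] ! j) = (\<Prod>j\<in>{..<3}. prob ([a, e, c] ! j))"
    using independent
  proof (rule indep_setsD)
    show "\<forall>j\<in>{..<3}. [a, e, c] ! j \<in> [\<X>, \<A> {0..}, \<W> {0..}] ! j"
      unfolding I using assms by simp
  qed (simp_all add: lessThan_empty_iff)
  then show ?thesis unfolding I by (simp add: Int_assoc mult.assoc)
qed

text \<open>Intersections of an initial event, a chain event from \<B> and a noise event are stable
  under intersection and generate the past, so g need only be tested on them. The generator \<B> is
  left open: for the noise it consists of all chain events, for the Markov property of
  cylinders.\<close>

lemma expectation_mult_eq_0:
  fixes Z g :: "'w \<Rightarrow> real"
  assumes t: "0 \<le> t" and S: "S \<subseteq> {0..}"
    and \<B>: "Int_stable \<B>" "space M \<in> \<B>" "\<B> \<subseteq> \<A> {0..}" "\<A> S \<subseteq> sigma_sets (space M) \<B>"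
    and g: "integrable M g" and zero: "\<And>a e c. \<lbrakk>a \<in> \<X>; e \<in> \<B>; c \<in> \<W> {0..t}\<rbrakk> \<Longrightarrow>
       expectation (\<lambda>\<omega>. indicator (a \<inter> e \<inter> c) \<omega> * g \<omega>) = 0"
    and Z: "Z \<in> borel_measurable (augment M (sigma (space M) (\<X> \<union> \<A> S \<union> \<W> {0..t})))"
    and int: "integrable M (\<lambda>\<omega>. Z \<omega> * g \<omega>)"
  shows "expectation (\<lambda>\<omega>. Z \<omega> * g \<omega>) = 0"
proof -
  define \<D> where "\<D> = {a \<inter> e \<inter> c | a e c. a \<in> \<X> \<and> e \<in> \<B> \<and> c \<in> \<W> {0..t}}"
  have sp: "space M \<in> \<X>" "space M \<in> \<W> {0..t}"
    using sets.top[of "generated_by M borel {0} X"] sets.top[of "generated_by M borel {0..t} W"]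
    by (simp_all add: space_generated_by)
  have ev: "\<X> \<subseteq> events" "\<B> \<subseteq> events" "\<W> {0..t} \<subseteq> events"
    using generated_events(1) generated_events(2)[of "{0..}"] generated_events(3)[of "{0..t}"] \<B>(3) by auto
  then have Ps: "\<X> \<subseteq> Pow (space M)" "\<B> \<subseteq> Pow (space M)" "\<W> {0..t} \<subseteq> Pow (space M)"
    using sets.space_closed by blast+
  have mem: "a \<inter> e \<inter> c \<in> \<D>" if "a \<in> \<X>" "e \<in> \<B>" "c \<in> \<W> {0..t}" for a e c
    unfolding \<D>_def using that by blast
  have D\<X>: "\<X> \<subseteq> \<D>"
  proof
    fix a assume a: "a \<in> \<X>"
    then have "a \<subseteq> space M" using Ps(1) by blast
    then show "a \<in> \<D>" using mem[OF a \<B>(2) sp(2)] by (simp only: Int_absorb2)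
  qed
  have D\<B>: "\<B> \<subseteq> \<D>"
  proof
    fix e assume e: "e \<in> \<B>"
    then have "e \<subseteq> space M" using Ps(2) by blast
    then show "e \<in> \<D>" using mem[OF sp(1) e sp(2)] by (simp only: Int_absorb1 Int_absorb2)
  qed
  have D\<W>: "\<W> {0..t} \<subseteq> \<D>"
  proof
    fix c assume c: "c \<in> \<W> {0..t}"
    then have "c \<subseteq> space M" using Ps(3) by blast
    then show "c \<in> \<D>" using mem[OF sp(1) \<B>(2) c] by (simp only: Int_absorb Int_absorb1)
  qed
  show ?thesis
  proof (rule integral_mult_eq_0_augment[OF _ _ _ g _ _ Z int, of \<D>])
    show "Int_stable \<D>" unfolding \<D>_def
      by (rule Int_stable_Int3[OF sets.Int_stable \<B>(1) sets.Int_stable])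
    show "\<D> \<subseteq> events" unfolding \<D>_def using ev by auto
    show "sets (sigma (space M) (\<X> \<union> \<A> S \<union> \<W> {0..t})) \<subseteq> sigma_sets (space M) \<D>"
    proof -
      have "sigma_sets (space M) \<B> \<subseteq> sigma_sets (space M) \<D>" by (rule sigma_sets_mono'[OF D\<B>])
      with \<B>(4) have "\<A> S \<subseteq> sigma_sets (space M) \<D>" by blast
      then have "\<X> \<union> \<A> S \<union> \<W> {0..t} \<subseteq> sigma_sets (space M) \<D>"
        using D\<X> D\<W> by auto
      then have "sigma_sets (space M) (\<X> \<union> \<A> S \<union> \<W> {0..t}) \<subseteq> sigma_sets (space M) \<D>"
        by (rule sigma_sets_mono)
      moreover have "{0..t} \<subseteq> {0..}" by auto
      ultimately show ?thesis using past_events(1)[OF S, of "{0..t}"] by (simp only:)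
    qed
    show z: "expectation (\<lambda>\<omega>. indicator A \<omega> * g \<omega>) = 0" if "A \<in> \<D>" for A
      using that zero unfolding \<D>_def by blast
    have "expectation g = expectation (\<lambda>\<omega>. indicator (space M) \<omega> * g \<omega>)"
      by (intro Bochner_Integration.integral_cong) auto
    then show "expectation g = 0" using z[of "space M"] sp D\<X> by auto
  qed
qed

text \<open>Brownian motion gives independence of the increment from the past of W, and the joint
  independence of the three sources gives it from X(0) and the whole of \<alpha>. On an intersection
  a, e, c of events the two combine: the noise event c is first merged with an event of the
  increment and then split off again.\<close>

lemma expectation_mult_increment:
  assumes st: "0 \<le> s" "s < t"
    and Z: "Z \<in> borel_measurable (augment M (sigma (space M) (\<X> \<union> \<A> {0..} \<union> \<W> {0..s})))"
    and int: "integrable M (\<lambda>\<omega>. Z \<omega> * (W t \<omega> - W s \<omega>) $ l)"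
    and g: "integrable M (\<lambda>\<omega>. (W t \<omega> - W s \<omega>) $ l)" "expectation (\<lambda>\<omega>. (W t \<omega> - W s \<omega>) $ l) = 0"
  shows "expectation (\<lambda>\<omega>. Z \<omega> * (W t \<omega> - W s \<omega>) $ l) = 0"
proof (rule expectation_mult_eq_0[OF st(1) order_refl, where \<B> = "\<A> {0..}"])
  show "space M \<in> \<A> {0..}"
    using sets.top[of "generated_by M (count_space UNIV) {0..} \<alpha>"] by (simp add: space_generated_by)
  fix a e c assume ac: "a \<in> \<X>" "e \<in> \<A> {0..}" "c \<in> \<W> {0..s}"
  have sub: "\<W> {0..s} \<subseteq> \<W> {0..}" by (rule generated_by_mono) auto
  have ev: "a \<in> events" "e \<in> events" "c \<in> events"
    using ac generated_events(1) generated_events(2)[of "{0..}"] generated_events(3)[of "{0..}"] sub by auto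
  have ind: "indep_set (\<W> {0..s}) {(\<lambda>\<omega>. W t \<omega> - W s \<omega>) -` E \<inter> space M | E. E \<in> sets borel}"
    using brownian st by (auto simp: brownian_motion_def natural_filtration_def)
  have Wm: "(\<lambda>\<omega>. W t \<omega> - W s \<omega>) \<in> borel_measurable (generated_by M borel {0..} W)"
    using st by (intro borel_measurable_diff measurable_generated_by) auto
  have "expectation (\<lambda>\<omega>. indicator (a \<inter> e \<inter> c) \<omega> * (W t \<omega> - W s \<omega>) $ l) = prob (a \<inter> e \<inter> c) * expectation (\<lambda>\<omega>. (W t \<omega> - W s \<omega>) $ l)"
  proof (rule integral_indicator_mult_indep[OF _ g(1)])
    show "a \<inter> e \<inter> c \<in> events" using ev by auto
    fix E :: "real set" assume E: "E \<in> sets borel"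
    let ?E = "(\<lambda>x::real^'n. x $ l) -` E"
    let ?d = "(\<lambda>\<omega>. W t \<omega> - W s \<omega>) -` ?E \<inter> space M"
    have E': "?E \<in> sets borel" using measurable_sets[OF borel_measurable_vec_nth E] by simp
    have d: "?d \<in> \<W> {0..}" using measurable_sets[OF Wm E'] by (simp add: space_generated_by)
    have "prob (a \<inter> e \<inter> (c \<inter> ?d)) = prob a * prob e * prob (c \<inter> ?d)"
      using ac d sub by (intro prob_Int_independent) auto
    also have "prob (c \<inter> ?d) = prob c * prob ?d"
      using ac E' by (intro indep_setD[OF ind]) auto
    also have "prob a * prob e * (prob c * prob ?d) = prob (a \<inter> e \<inter> c) * prob ?d"
      using prob_Int_independent[of a e c] ac sub by (auto simp: mult.assoc)
    finally show "prob (a \<inter> e \<inter> c \<inter> ((\<lambda>\<omega>. (W t \<omega> - W s \<omega>) $ l) -` E \<inter> space M))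
        = prob (a \<inter> e \<inter> c) * prob ((\<lambda>\<omega>. (W t \<omega> - W s \<omega>) $ l) -` E \<inter> space M)"
      by (simp add: Int_assoc vimage_def)
  qed
  then show "expectation (\<lambda>\<omega>. indicator (a \<inter> e \<inter> c) \<omega> * (W t \<omega> - W s \<omega>) $ l) = 0" using g(2) by simp
qed (use Z int g in \<open>auto intro: sets.Int_stable\<close>)

text \<open>The times form a set and not a list, so that two cylinders with compatible prescriptions
  intersect in the cylinder over the union of their times.\<close>

definition cylinder :: "real set \<Rightarrow> (real \<Rightarrow> 'm) \<Rightarrow> 'w set" where
  "cylinder J i = {\<omega> \<in> space M. \<forall>s\<in>J. \<alpha> s \<omega> = i s}"

text \<open>The finite-dimensional law is a product along the increasing enumeration of J. As t is
  the largest time of J, appending t + h contributes exactly one more factor. The law for the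
  shorter list is substituted into that for the longer one, so null cylinders need no separate
  treatment.\<close>

lemma prob_cylinder_step:
  assumes J: "finite J" "J \<subseteq> {0..t}" "t \<in> J" and h: "0 \<le> h"
  shows "prob (cylinder J i \<inter> {\<omega> \<in> space M. \<alpha> (t + h) \<omega> = j})
     = prob (cylinder J i) * mat_exp (h *\<^sub>R G) $ i t $ j"
proof -
  define xs where "xs = sorted_list_of_set J"
  define K where "K = length xs - 1"
  have xs: "sorted xs" "set xs = J" "xs \<noteq> []" unfolding xs_def using J by auto
  then have len: "length xs = Suc K" by (simp add: K_def)
  have last: "xs ! K = t"
  proof -
    obtain k where k: "k < length xs" "xs ! k = t" using J(3) xs(2) by (metis in_set_conv_nth)
    then have "t \<le> xs ! K" using sorted_nth_mono[OF xs(1), of k K] len by auto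
    moreover have "xs ! K \<in> J" using xs(2) len nth_mem[of K xs] by simp
    ultimately show ?thesis using J(2) by force
  qed
  define \<tau> where "\<tau> k = (if k \<le> K then xs ! k else t + h)" for k
  define i' where "i' k = (if k \<le> K then i (xs ! k) else j)" for k
  have mono: "\<tau> k \<le> \<tau> (Suc k)" if "k \<le> K" for k
  proof (cases "Suc k \<le> K")
    case True then show ?thesis using sorted_nth_mono[OF xs(1), of k "Suc k"] len by (simp add: \<tau>_def)
  next
    case False then have "k = K" using that by simp
    then show ?thesis using h last by (simp add: \<tau>_def)
  qed
  have \<tau>0: "0 \<le> \<tau> 0" using J(2) xs(2) len nth_mem[of 0 xs] by (auto simp: \<tau>_def)
  have fd: "prob {\<omega> \<in> space M. \<forall>k\<le>N. \<alpha> (\<tau> k) \<omega> = i' k} =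
        prob {\<omega> \<in> space M. \<alpha> (\<tau> 0) \<omega> = i' 0} *
          (\<Prod>k<N. mat_exp ((\<tau> (Suc k) - \<tau> k) *\<^sub>R G) $ i' k $ i' (Suc k))" if "N \<le> Suc K" for N
    using markov \<tau>0 mono that unfolding markov_chain_def by auto
  have c: "{\<omega> \<in> space M. \<forall>k\<le>K. \<alpha> (\<tau> k) \<omega> = i' k} = cylinder J i"
  proof -
    have "(\<forall>k\<le>K. \<alpha> (\<tau> k) \<omega> = i' k) \<longleftrightarrow> (\<forall>s\<in>J. \<alpha> s \<omega> = i s)" for \<omega>
      unfolding xs(2)[symmetric] \<tau>_def i'_def all_set_conv_all_nth len by (auto simp: less_Suc_eq_le)
    then show ?thesis by (simp add: cylinder_def)
  qed
  have "{\<omega> \<in> space M. \<forall>k\<le>Suc K. \<alpha> (\<tau> k) \<omega> = i' k}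
     = {\<omega> \<in> space M. \<forall>k\<le>K. \<alpha> (\<tau> k) \<omega> = i' k} \<inter> {\<omega> \<in> space M. \<alpha> (t + h) \<omega> = j}"
    by (auto simp: le_Suc_eq \<tau>_def i'_def)
  then have "cylinder J i \<inter> {\<omega> \<in> space M. \<alpha> (t + h) \<omega> = j} = {\<omega> \<in> space M. \<forall>k\<le>Suc K. \<alpha> (\<tau> k) \<omega> = i' k}"
    unfolding c ..
  then have "prob (cylinder J i \<inter> {\<omega> \<in> space M. \<alpha> (t + h) \<omega> = j})
     = prob (cylinder J i) * mat_exp ((\<tau> (Suc K) - \<tau> K) *\<^sub>R G) $ i' K $ i' (Suc K)"
    using fd[of "Suc K"] fd[of K] unfolding c[symmetric] by simp
  then show ?thesis by (simp add: \<tau>_def i'_def last)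
qed

text \<open>The Markov property of \<alpha> relative to a past that also contains X(0) and W up to
  t. The indicator of the later mode minus its prediction from the present mode must be orthogonal
  to that past; by independence this reduces to a statement about cylinders of the chain
  alone.\<close>

lemma expectation_mult_transition:
  assumes t: "0 \<le> t" and h: "0 \<le> h"
    and Z: "Z \<in> borel_measurable (augment M (sigma (space M) (\<X> \<union> \<A> {0..t} \<union> \<W> {0..t})))"
    and int: "integrable M Z"
  shows "expectation (\<lambda>\<omega>. Z \<omega> * indicator {\<omega> \<in> space M. \<alpha> (t + h) \<omega> = j} \<omega>)
     = (\<Sum>i\<in>UNIV. mat_exp (h *\<^sub>R G) $ i $ j * expectation (\<lambda>\<omega>. Z \<omega> * indicator {\<omega> \<in> space M. \<alpha> t \<omega> = i} \<omega>))"
proof -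
  let ?E = "\<lambda>t i. {\<omega> \<in> space M. \<alpha> t \<omega> = i}"
  let ?p = "\<lambda>i. mat_exp (h *\<^sub>R G) $ i $ j"
  define I :: "real \<Rightarrow> 'm \<Rightarrow> 'w \<Rightarrow> real" where "I s i = indicator (?E s i)" for s i
  define g where "g \<omega> = I (t + h) j \<omega> - (\<Sum>i\<in>UNIV. ?p i * I t i \<omega>)" for \<omega>
  \<comment> \<open>The empty set is added because cylinders with contradictory prescriptions are
    disjoint.\<close>
  define \<B> where "\<B> = insert {} {cylinder J i | J i. finite J \<and> J \<subseteq> {0..t}}"
  have E[measurable]: "?E s i \<in> events" if "0 \<le> s" for s i using alpha_event that by simp
  have iI: "integrable M (I s i)" if "0 \<le> s" for s i
    unfolding I_def using that by (intro integrable_const_bound[of _ 1]) auto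
  have gi: "integrable M g" unfolding g_def using iI t h by simp
  have iZ: "integrable M (\<lambda>\<omega>. Z \<omega> * I s i \<omega>)" if "0 \<le> s" for s i
    unfolding I_def using integrable_real_mult_indicator[OF E[OF that] int] by (simp add: mult.commute)
  have sub: "{0..t} \<subseteq> {0..}" by auto
  have cyl_gen: "cylinder J i \<in> \<A> {0..t}" if "finite J" "J \<subseteq> {0..t}" for J i
  proof -
    have "cylinder J i = space M \<inter> (\<Inter>s\<in>J. ?E s (i s))" if "J \<noteq> {}"
      unfolding cylinder_def using that by auto
    moreover have "space M \<in> \<A> {0..t}"
      using sets.top[of "generated_by M (count_space UNIV) {0..t} \<alpha>"] by (simp add: space_generated_by)
    moreover have "(\<Inter>s\<in>J. ?E s (i s)) \<in> \<A> {0..t}" if "J \<noteq> {}"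
      using that \<open>finite J\<close> \<open>J \<subseteq> {0..t}\<close> by (intro sets.finite_INT alpha_event_generated) auto
    moreover have "cylinder {} i = space M" by (simp add: cylinder_def)
    ultimately show ?thesis by (cases "J = {}") auto
  qed
  have "expectation (\<lambda>\<omega>. Z \<omega> * g \<omega>) = 0"
  proof (rule expectation_mult_eq_0[OF t sub, where \<B> = \<B>, OF _ _ _ _ gi _ Z])
    have "x \<inter> y \<in> \<B>" if xy: "x \<in> \<B>" "y \<in> \<B>" for x y
    proof (cases "x = {} \<or> y = {}")
      case False
      then obtain J i J' i' where J: "x = cylinder J i" "y = cylinder J' i'" "finite J" "finite J'"
        "J \<subseteq> {0..t}" "J' \<subseteq> {0..t}" using xy unfolding \<B>_def by blast
      show ?thesis
      proof (cases "\<forall>s\<in>J \<inter> J'. i s = i' s")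
        case True
        then have "x \<inter> y = cylinder (J \<union> J') (\<lambda>s. if s \<in> J then i s else i' s)"
          unfolding J cylinder_def by (auto split: if_splits)
        with J show ?thesis unfolding \<B>_def by blast
      next
        case False
        then have "x \<inter> y = {}" unfolding J cylinder_def by auto
        then show ?thesis by (simp add: \<B>_def)
      qed
    qed (auto simp: \<B>_def)
    then show "Int_stable \<B>" by (auto simp: Int_stable_def)
    have "cylinder {} i = space M" for i by (simp add: cylinder_def)
    then show "space M \<in> \<B>" unfolding \<B>_def by blast
    have "\<A> {0..t} \<subseteq> \<A> {0..}" by (rule generated_by_mono) auto
    then show "\<B> \<subseteq> \<A> {0..}" unfolding \<B>_def using cyl_gen by auto
    show "\<A> {0..t} \<subseteq> sigma_sets (space M) \<B>"
      unfolding sets_generated_by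
    proof (rule sigma_sets_mono, safe)
      fix s and E :: "'m set" assume s: "s \<in> {0..t}"
      have "\<alpha> s -` E \<inter> space M = (\<Union>e\<in>E. cylinder {s} (\<lambda>_. e))" unfolding cylinder_def by auto
      also have "\<dots> \<in> sigma_sets (space M) \<B>"
      proof (rule sigma_sets_UNION)
        show "countable ((\<lambda>e. cylinder {s} (\<lambda>_. e)) ` E)" by (intro countable_finite finite_imageI) simp
        fix A assume "A \<in> (\<lambda>e. cylinder {s} (\<lambda>_. e)) ` E"
        then show "A \<in> sigma_sets (space M) \<B>" using s unfolding \<B>_def by (intro sigma_sets.Basic) blast
      qed
      finally show "\<alpha> s -` E \<inter> space M \<in> sigma_sets (space M) \<B>" .
    qed
    show "integrable M (\<lambda>\<omega>. Z \<omega> * g \<omega>)"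
      unfolding g_def right_diff_distrib sum_distrib_left mult.left_commute[of "Z _"] using iZ t h by simp
    fix a e c assume ac: "a \<in> \<X>" "e \<in> \<B>" "c \<in> \<W> {0..t}"
    have cW: "c \<in> \<W> {0..}" using ac(3) generated_by_mono[OF sub] by blast
    have eA: "e \<in> \<A> {0..}" using ac(2) \<open>\<B> \<subseteq> \<A> {0..}\<close> by blast
    have ev: "a \<inter> e \<inter> c \<in> events" "e \<in> events"
      using ac(1) cW eA generated_events(1) generated_events(2)[of "{0..}"] generated_events(3)[of "{0..}"] by auto
    have p: "expectation (\<lambda>\<omega>. indicator (a \<inter> e \<inter> c) \<omega> * I s i \<omega>) = prob a * prob c * prob (e \<inter> ?E s i)"
      if "0 \<le> s" for s i
    proof -
      have "?E s i \<in> \<A> {0..}" using that by (intro alpha_event_generated) auto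
      then have "prob (a \<inter> (e \<inter> ?E s i) \<inter> c) = prob a * prob (e \<inter> ?E s i) * prob c"
        using ac(1) eA cW by (intro prob_Int_independent) auto
      moreover have "expectation (\<lambda>\<omega>. indicator (a \<inter> e \<inter> c) \<omega> * I s i \<omega>) = expectation (indicator (a \<inter> (e \<inter> ?E s i) \<inter> c))"
        unfolding I_def by (intro Bochner_Integration.integral_cong) (auto simp: indicator_def)
      moreover have "a \<inter> (e \<inter> ?E s i) \<inter> c \<in> events"
      proof -
        have "a \<inter> (e \<inter> ?E s i) \<inter> c = (a \<inter> e \<inter> c) \<inter> ?E s i" by blast
        then show ?thesis using ev E[OF that] by simp
      qed
      ultimately show ?thesis by simp
    qed
    have split: "prob (e \<inter> ?E (t + h) j) = (\<Sum>i\<in>UNIV. prob (e \<inter> ?E t i \<inter> ?E (t + h) j))"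
    proof -
      have "prob (\<Union>i\<in>UNIV. e \<inter> ?E t i \<inter> ?E (t + h) j) = (\<Sum>i\<in>UNIV. prob (e \<inter> ?E t i \<inter> ?E (t + h) j))"
        using ev t h by (intro finite_measure_finite_Union) (auto simp: disjoint_family_on_def)
      moreover have "(\<Union>i\<in>UNIV. e \<inter> ?E t i \<inter> ?E (t + h) j) = e \<inter> ?E (t + h) j" by auto
      ultimately show ?thesis by simp
    qed
    \<comment> \<open>Prescribing the mode at t as well makes t the last time of the cylinder, as
      the one-step formula requires. If that contradicts e, both sides are 0.\<close>
    have step: "prob (e \<inter> ?E t i \<inter> ?E (t + h) j) = ?p i * prob (e \<inter> ?E t i)" for i
    proof (cases "e \<inter> ?E t i = {}")
      case False
      then obtain J i' where J: "e = cylinder J i'" "finite J" "J \<subseteq> {0..t}" using ac(2) unfolding \<B>_def by blast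
      have "e \<inter> ?E t i = cylinder (insert t J) (i'(t := i))"
        using False unfolding J(1) cylinder_def by (auto split: if_splits)
      then show ?thesis
        using prob_cylinder_step[of "insert t J" t h "i'(t := i)" j] J t h by (simp add: mult.commute)
    qed simp
    have "expectation (\<lambda>\<omega>. indicator (a \<inter> e \<inter> c) \<omega> * g \<omega>)
       = expectation (\<lambda>\<omega>. indicator (a \<inter> e \<inter> c) \<omega> * I (t + h) j \<omega>
            - (\<Sum>i\<in>UNIV. ?p i * (indicator (a \<inter> e \<inter> c) \<omega> * I t i \<omega>)))"
      unfolding g_def by (simp add: right_diff_distrib sum_distrib_left mult.left_commute)
    also have "\<dots> = prob a * prob c * prob (e \<inter> ?E (t + h) j)
         - (\<Sum>i\<in>UNIV. ?p i * (prob a * prob c * prob (e \<inter> ?E t i)))"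
    proof -
      have i: "integrable M (\<lambda>\<omega>. indicator (a \<inter> e \<inter> c) \<omega> * I s i \<omega>)" if "0 \<le> s" for s i
        using integrable_real_mult_indicator[OF ev(1) iI[OF that, of i]] by (simp add: mult.commute)
      show ?thesis using i t h by (simp add: p)
    qed
    also have "\<dots> = 0" unfolding split step by (simp add: sum_distrib_left mult.left_commute)
    finally show "expectation (\<lambda>\<omega>. indicator (a \<inter> e \<inter> c) \<omega> * g \<omega>) = 0" .
  qed
  then show ?thesis
    unfolding I_def[symmetric] g_def right_diff_distrib sum_distrib_left mult.left_commute[of "Z _"] using iZ t h by simp
qed

end

section \<open>The filter and moment bounds\<close>

lemma borel_measurable_vec_lambda:
  fixes f :: "'i::finite \<Rightarrow> 'a \<Rightarrow> real"
  assumes "\<And>i. f i \<in> borel_measurable N"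
  shows "(\<lambda>\<omega>. \<chi> i. f i \<omega>) \<in> borel_measurable N"
proof -
  have "(\<lambda>\<omega>. \<chi> i. f i \<omega>) = (\<lambda>\<omega>. \<Sum>i\<in>UNIV. f i \<omega> *\<^sub>R axis i (1::real))"
    by (simp add: fun_eq_iff vec_eq_iff axis_def if_distrib[of "\<lambda>x. _ * x"] sum.delta cong: if_cong)
  also have "\<dots> \<in> borel_measurable N" using assms by simp
  finally show ?thesis .
qed

context hidden_switching
begin

lemma Phi_measurable: "0 \<le> t \<Longrightarrow> \<Phi> t \<in> borel_measurable M"
  using filter by (simp add: wonham_filter_def)

lemma observation_subalgebra:
  assumes "0 \<le> t"
  shows "subalgebra M (natural_filtration M X t)" "X t \<in> borel_measurable (natural_filtration M X t)"
proof -
  have "sets (generated_by M borel {0..t} X) \<subseteq> events"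
    using X_measurable by (intro generated_by_events) auto
  then show "subalgebra M (natural_filtration M X t)"
    by (simp add: natural_filtration_def subalgebra_def space_generated_by)
  show "X t \<in> borel_measurable (natural_filtration M X t)"
    unfolding natural_filtration_def using assms by (intro measurable_generated_by) auto
qed

abbreviation "state_indicator t i \<equiv> indicator {\<omega> \<in> space M. \<alpha> t \<omega> = i} :: 'w \<Rightarrow> real"

lemma integrable_state_indicator: "0 \<le> t \<Longrightarrow> integrable M (state_indicator t i)"
  using alpha_event[of t i] by (intro integrable_const_bound[of _ 1]) auto

lemma filter_eq:
  assumes "0 \<le> t"
  shows "AE \<omega> in M. \<Phi> t \<omega> $ i = real_cond_exp M (natural_filtration M X t) (state_indicator t i) \<omega>"
  using filter assms by (simp add: wonham_filter_def)

lemma filter_simplex: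
  assumes t: "0 \<le> t"
  shows "AE \<omega> in M. (\<forall>i. 0 \<le> \<Phi> t \<omega> $ i \<and> \<Phi> t \<omega> $ i \<le> 1) \<and> (\<Sum>i\<in>UNIV. \<Phi> t \<omega> $ i) = 1"
proof -
  interpret F: finite_measure_subalgebra M "natural_filtration M X t"
    by unfold_locales (rule observation_subalgebra[OF t])
  let ?c = "\<lambda>i. real_cond_exp M (natural_filtration M X t) (state_indicator t i)"
  note int = integrable_state_indicator[OF t]
  have sum1: "(\<Sum>i\<in>UNIV. state_indicator t i \<omega>) = 1" if "\<omega> \<in> space M" for \<omega>
  proof -
    have "(\<Sum>i\<in>UNIV. state_indicator t i \<omega>) = (\<Sum>i\<in>UNIV. if \<alpha> t \<omega> = i then 1 else 0)"
      using that by (intro sum.cong) (auto simp: indicator_def)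
    then show ?thesis by simp
  qed
  have "AE \<omega> in M. real_cond_exp M (natural_filtration M X t) (\<lambda>\<omega>. \<Sum>i\<in>UNIV. state_indicator t i \<omega>) \<omega> = (\<Sum>i\<in>UNIV. ?c i \<omega>)"
    by (rule F.real_cond_exp_sum) (rule int)
  moreover have "AE \<omega> in M. real_cond_exp M (natural_filtration M X t) (\<lambda>\<omega>. \<Sum>i\<in>UNIV. state_indicator t i \<omega>) \<omega>
      = real_cond_exp M (natural_filtration M X t) (\<lambda>_. 1) \<omega>"
    by (rule F.real_cond_exp_cong) (use sum1 int in \<open>auto intro!: borel_measurable_sum AE_I2 borel_measurable_integrable\<close>)
  moreover have "AE \<omega> in M. real_cond_exp M (natural_filtration M X t) (\<lambda>_. 1) \<omega> = 1"
    by (rule F.real_cond_exp_F_meas) auto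
  ultimately have s: "AE \<omega> in M. (\<Sum>i\<in>UNIV. ?c i \<omega>) = 1"
    by eventually_elim simp
  have "AE \<omega> in M. 0 \<le> ?c i \<omega>" "AE \<omega> in M. ?c i \<omega> \<le> 1" for i
    using int by (auto intro!: F.real_cond_exp_ge_c F.real_cond_exp_le_c)
  then have "AE \<omega> in M. 0 \<le> ?c i \<omega> \<and> ?c i \<omega> \<le> 1 \<and> \<Phi> t \<omega> $ i = ?c i \<omega>" for i
    using filter_eq[OF t, of i] by auto
  then have "AE \<omega> in M. \<forall>i. 0 \<le> ?c i \<omega> \<and> ?c i \<omega> \<le> 1 \<and> \<Phi> t \<omega> $ i = ?c i \<omega>"
    by (subst AE_all_countable) auto
  with s show ?thesis by eventually_elim simp
qed

text \<open>One null set has to serve all times. The bounds hold almost surely at countably many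
  rational times together and pass to every t by continuity of the filter.\<close>

lemma filter_bounds: "AE \<omega> in M. \<forall>t\<ge>0. \<forall>i. 0 \<le> \<Phi> t \<omega> $ i \<and> \<Phi> t \<omega> $ i \<le> 1"
proof -
  have "AE \<omega> in M. \<forall>k n. \<forall>i. 0 \<le> \<Phi> (real k / real (Suc n)) \<omega> $ i \<and> \<Phi> (real k / real (Suc n)) \<omega> $ i \<le> 1"
    unfolding AE_all_countable
  proof (intro allI)
    show "AE \<omega> in M. 0 \<le> \<Phi> (real k / real (Suc n)) \<omega> $ i \<and> \<Phi> (real k / real (Suc n)) \<omega> $ i \<le> 1" for k n i
      using filter_simplex[of "real k / real (Suc n)"] by auto
  qed
  moreover have "AE \<omega> in M. continuous_on {0..} (\<lambda>t. \<Phi> t \<omega>)"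
    using filter by (simp add: wonham_filter_def continuous_paths_def)
  ultimately show ?thesis
  proof eventually_elim
    case (elim \<omega>)
    show ?case
    proof (intro allI impI)
      fix t :: real and i assume t: "0 \<le> t"
      \<comment> \<open>Rational approximation from above, which stays among nonnegative
        times.\<close>
      define u where "u n = real (nat \<lceil>t * real (Suc n)\<rceil>) / real (Suc n)" for n
      have u0: "0 \<le> u n" for n by (simp add: u_def)
      have u: "t \<le> u n \<and> u n \<le> t + 1 / real (Suc n)" for n
      proof -
        have nn: "0 \<le> t * real (Suc n)" using t by simp
        then have c: "real (nat \<lceil>t * real (Suc n)\<rceil>) = of_int \<lceil>t * real (Suc n)\<rceil>" by (intro of_nat_nat) linarith
        have "t * real (Suc n) \<le> real (nat \<lceil>t * real (Suc n)\<rceil>)"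
          "real (nat \<lceil>t * real (Suc n)\<rceil>) \<le> t * real (Suc n) + 1" unfolding c by linarith+
        then have "t * real (Suc n) / real (Suc n) \<le> u n" "u n \<le> (t * real (Suc n) + 1) / real (Suc n)"
          unfolding u_def by (intro divide_right_mono; simp)+
        then show ?thesis by (simp add: add_divide_distrib del: of_nat_Suc)
      qed
      have "u \<longlonglongrightarrow> t"
      proof (rule tendsto_sandwich[OF _ _ tendsto_const])
        show "(\<lambda>n. t + 1 / real (Suc n)) \<longlonglongrightarrow> t"
          using tendsto_add[OF tendsto_const[of t] LIMSEQ_Suc[OF lim_const_over_n[of 1]]] by simp
      qed (use u in auto)
      then have "(\<lambda>n. \<Phi> (u n) \<omega>) \<longlonglongrightarrow> \<Phi> t \<omega>"
        using u0 t by (intro continuous_on_tendsto_compose[OF elim(2)]) auto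
      then have lim: "(\<lambda>n. \<Phi> (u n) \<omega> $ i) \<longlonglongrightarrow> \<Phi> t \<omega> $ i" by (rule tendsto_vec_nth)
      have "0 \<le> \<Phi> (u n) \<omega> $ i \<and> \<Phi> (u n) \<omega> $ i \<le> 1" for n
        using elim(1) unfolding u_def by blast
      then show "0 \<le> \<Phi> t \<omega> $ i \<and> \<Phi> t \<omega> $ i \<le> 1"
        by (intro conjI LIMSEQ_le_const[OF lim] LIMSEQ_le_const2[OF lim]) auto
    qed
  qed
qed

lemma expectation_mult_filter:
  assumes t: "0 \<le> t" and k[measurable]: "k \<in> borel_measurable (borel \<Otimes>\<^sub>M borel)"
    and int: "integrable M (\<lambda>\<omega>. k (X t \<omega>, \<Phi> t \<omega>))"
  shows "integrable M (\<lambda>\<omega>. k (X t \<omega>, \<Phi> t \<omega>) * state_indicator t i \<omega> :: real)"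
    and "expectation (\<lambda>\<omega>. k (X t \<omega>, \<Phi> t \<omega>) * state_indicator t i \<omega>)
      = expectation (\<lambda>\<omega>. k (X t \<omega>, \<Phi> t \<omega>) * \<Phi> t \<omega> $ i)"
    and "integrable M (\<lambda>\<omega>. k (X t \<omega>, \<Phi> t \<omega>) * \<Phi> t \<omega> $ i)"
proof -
  let ?F = "natural_filtration M X t"
  interpret F: finite_measure_subalgebra M ?F
    by unfold_locales (rule observation_subalgebra[OF t])
  let ?c = "\<lambda>i. real_cond_exp M ?F (state_indicator t i)"
  \<comment> \<open>\<open>\<Phi> t\<close> equals the conditional expectations only almost surely
    and may fail to be measurable for the observations. The vector of their versions is measurable
    and takes its place inside k.\<close>
  define \<phi> where "\<phi> \<omega> = (\<chi> i. ?c i \<omega>)" for \<omega>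
  have [measurable]: "X t \<in> borel_measurable ?F" by (rule observation_subalgebra[OF t])
  have \<phi>F[measurable]: "\<phi> \<in> borel_measurable ?F" unfolding \<phi>_def by (intro borel_measurable_vec_lambda) simp
  have kF[measurable]: "(\<lambda>\<omega>. k (X t \<omega>, \<phi> \<omega>)) \<in> borel_measurable ?F" by measurable
  have kM[measurable]: "(\<lambda>\<omega>. k (X t \<omega>, \<phi> \<omega>)) \<in> borel_measurable M"
    by (rule measurable_from_subalg[OF F.subalg kF])
  have [measurable]: "X t \<in> borel_measurable M" "\<Phi> t \<in> borel_measurable M"
    using X_measurable Phi_measurable t by auto
  have E[measurable]: "{\<omega> \<in> space M. \<alpha> t \<omega> = i} \<in> events" by (rule alpha_event[OF t])
  have "AE \<omega> in M. \<forall>i. \<Phi> t \<omega> $ i = ?c i \<omega>"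
    unfolding AE_all_countable using filter_eq[OF t] by blast
  then have eq: "AE \<omega> in M. \<Phi> t \<omega> = \<phi> \<omega>"
    by eventually_elim (simp add: \<phi>_def vec_eq_iff)
  with filter_eq[OF t, of i] have eqc: "AE \<omega> in M. \<Phi> t \<omega> = \<phi> \<omega> \<and> ?c i \<omega> = \<phi> \<omega> $ i"
    by eventually_elim (auto simp: \<phi>_def)
  then have eqk: "AE \<omega> in M. k (X t \<omega>, \<phi> \<omega>) * ?c i \<omega> = k (X t \<omega>, \<Phi> t \<omega>) * \<Phi> t \<omega> $ i"
    by eventually_elim simp
  show i1: "integrable M (\<lambda>\<omega>. k (X t \<omega>, \<Phi> t \<omega>) * state_indicator t i \<omega>)"
    by (rule Bochner_Integration.integrable_bound[OF int]) (auto simp: indicator_def)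
  have i2: "integrable M (\<lambda>\<omega>. k (X t \<omega>, \<phi> \<omega>) * state_indicator t i \<omega>)"
    by (rule integrable_cong_AE_imp[OF i1]) (use eq in \<open>auto elim: eventually_mono\<close>)
  have "expectation (\<lambda>\<omega>. k (X t \<omega>, \<Phi> t \<omega>) * state_indicator t i \<omega>) = expectation (\<lambda>\<omega>. k (X t \<omega>, \<phi> \<omega>) * state_indicator t i \<omega>)"
    by (rule integral_cong_AE) (use eq in \<open>auto elim: eventually_mono\<close>)
  also have "\<dots> = expectation (\<lambda>\<omega>. k (X t \<omega>, \<phi> \<omega>) * ?c i \<omega>)"
    by (rule F.real_cond_exp_intg(2)[OF i2 kF, symmetric]) simp
  also have "\<dots> = expectation (\<lambda>\<omega>. k (X t \<omega>, \<Phi> t \<omega>) * \<Phi> t \<omega> $ i)"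
    by (rule integral_cong_AE) (use eqk in auto)
  finally show "expectation (\<lambda>\<omega>. k (X t \<omega>, \<Phi> t \<omega>) * state_indicator t i \<omega>)
      = expectation (\<lambda>\<omega>. k (X t \<omega>, \<Phi> t \<omega>) * \<Phi> t \<omega> $ i)" .
  show "integrable M (\<lambda>\<omega>. k (X t \<omega>, \<Phi> t \<omega>) * \<Phi> t \<omega> $ i)"
    by (rule integrable_cong_AE_imp[OF F.real_cond_exp_intg(1)[OF i2 kF]])
       (use eqk in auto)
qed

section \<open>Square integrability of the state\<close>

lemma dynamics_between:
  "AE \<omega> in M. \<forall>s t. 0 \<le> s \<longrightarrow> s \<le> t \<longrightarrow>
     ((\<lambda>r. b (\<alpha> r \<omega>) (X r \<omega>) (\<Phi> r \<omega>)) has_integral (X t \<omega> - X s \<omega> - (W t \<omega> - W s \<omega>))) {s..t}"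
  using dynamics
proof eventually_elim
  case (elim \<omega>)
  show ?case
  proof (intro allI impI)
    fix s t :: real assume st: "0 \<le> s" "s \<le> t"
    let ?b = "\<lambda>r. b (\<alpha> r \<omega>) (X r \<omega>) (\<Phi> r \<omega>)"
    have t: "(?b has_integral (X t \<omega> - X 0 \<omega> - W t \<omega>)) {0..t}" and s: "(?b has_integral (X s \<omega> - X 0 \<omega> - W s \<omega>)) {0..s}"
      using elim st by auto
    have "?b integrable_on {s..t}"
      by (rule integrable_on_subinterval[OF has_integral_integrable[OF t]]) (use st in auto)
    then have i: "(?b has_integral integral {s..t} ?b) {s..t}" by (rule integrable_integral)
    have "X t \<omega> - X 0 \<omega> - W t \<omega> = (X s \<omega> - X 0 \<omega> - W s \<omega>) + integral {s..t} ?b"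
      by (rule has_integral_unique[OF t has_integral_combine[OF st s i]])
    then have "integral {s..t} ?b = X t \<omega> - X s \<omega> - (W t \<omega> - W s \<omega>)" by (simp add: algebra_simps)
    with i show "(?b has_integral (X t \<omega> - X s \<omega> - (W t \<omega> - W s \<omega>))) {s..t}" by simp
  qed
qed

lemma drift_bound:
  "AE \<omega> in M. \<forall>t\<ge>0. norm (b (\<alpha> t \<omega>) (X t \<omega>) (\<Phi> t \<omega>)) \<le> L * norm (X t \<omega>)"
  using filter_bounds by eventually_elim (auto intro!: b_growth)

lemma X_short_interval_bound:
  assumes a: "0 \<le> a" and h: "0 \<le> h" "h \<le> 1" "L * h \<le> 1/2"
    and S: "AE \<omega> in M. \<forall>s\<in>{a..a+1}. norm (W s \<omega> - W a \<omega>) \<le> S \<omega>"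
  shows "AE \<omega> in M. \<forall>t\<in>{a..a+h}. norm (X t \<omega>) \<le> 2 * (norm (X a \<omega>) + S \<omega>)"
proof -
  have "AE \<omega> in M. continuous_on {0..} (\<lambda>t. X t \<omega>)"
    using X_continuous by (simp add: continuous_paths_def)
  with dynamics_between drift_bound S show ?thesis
  proof eventually_elim
    case (elim \<omega>)
    show ?case
    proof
      fix t assume t: "t \<in> {a..a+h}"
      show "norm (X t \<omega>) \<le> 2 * (norm (X a \<omega>) + S \<omega>)"
      proof (rule gronwall_short_interval[where w = "\<lambda>t. W t \<omega>" and x = "\<lambda>t. X t \<omega>" and L = L and h = h and S = "S \<omega>"
            and \<beta> = "\<lambda>r. b (\<alpha> r \<omega>) (X r \<omega>) (\<Phi> r \<omega>)"])
        show "continuous_on {a..a+h} (\<lambda>t. X t \<omega>)"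
          by (rule continuous_on_subset[OF elim(4)]) (use a in auto)
      qed (use elim a h t L_nonneg in auto)
    qed
  qed
qed

text \<open>The bound at least doubles with every step and so says nothing useful about growth. It
  serves finiteness: Z controls the remainders and the limits of the energy estimate on
  [0, T].\<close>

lemma X_dominated:
  assumes "0 \<le> T"
  shows "\<exists>Z. Z \<in> borel_measurable M \<and> (\<forall>\<omega>. 0 \<le> Z \<omega>) \<and> integrable M (\<lambda>\<omega>. (Z \<omega>)^2) \<and>
     (AE \<omega> in M. \<forall>t\<in>{0..T}. norm (X t \<omega>) \<le> Z \<omega>)"
proof -
  \<comment> \<open>Adding 1 to L yields h <= 1 along with L * h <= 1/2 and covers the case L =
    0.\<close>
  define h where "h = 1 / (2 * (L + 1))"
  have h: "0 < h" "h \<le> 1" "L * h \<le> 1/2" using L_nonneg by (auto simp: h_def field_simps)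
  obtain C where C: "\<And>a. 0 \<le> a \<Longrightarrow> \<exists>S. S \<in> borel_measurable M \<and> (\<forall>\<omega>. 0 \<le> S \<omega>) \<and>
     integrable M (\<lambda>\<omega>. (S \<omega>)^2) \<and> expectation (\<lambda>\<omega>. (S \<omega>)^2) \<le> C \<and>
     (AE \<omega> in M. \<forall>s\<in>{a..a+1}. norm (W s \<omega> - W a \<omega>) \<le> S \<omega>)"
    using brownian_unit_interval_bound[OF brownian] by blast
  have ind: "\<exists>Z. Z \<in> borel_measurable M \<and> (\<forall>\<omega>. 0 \<le> Z \<omega>) \<and> integrable M (\<lambda>\<omega>. (Z \<omega>)^2) \<and>
     (AE \<omega> in M. \<forall>t\<in>{0..real k * h}. norm (X t \<omega>) \<le> Z \<omega>)" for k
  proof (induction k)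
    case 0
    show ?case using X0 by (intro exI[of _ "\<lambda>\<omega>. norm (X 0 \<omega>)"]) auto
  next
    case (Suc k)
    then obtain Z where Z[measurable]: "Z \<in> borel_measurable M" and Z0: "\<And>\<omega>. 0 \<le> Z \<omega>" and Z2: "integrable M (\<lambda>\<omega>. (Z \<omega>)^2)"
      and ZX: "AE \<omega> in M. \<forall>t\<in>{0..real k * h}. norm (X t \<omega>) \<le> Z \<omega>" by blast
    have a: "0 \<le> real k * h" using h by simp
    obtain S where S[measurable]: "S \<in> borel_measurable M" and S0: "\<And>\<omega>. 0 \<le> S \<omega>" and S2: "integrable M (\<lambda>\<omega>. (S \<omega>)^2)"
      and SW: "AE \<omega> in M. \<forall>s\<in>{real k * h..real k * h+1}. norm (W s \<omega> - W (real k * h) \<omega>) \<le> S \<omega>"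
      using C[OF a] by blast
    have "AE \<omega> in M. \<forall>t\<in>{real k * h..real k * h + h}. norm (X t \<omega>) \<le> 2 * (norm (X (real k * h) \<omega>) + S \<omega>)"
      using h by (intro X_short_interval_bound[OF a _ _ _ SW]) auto
    with ZX have d: "AE \<omega> in M. \<forall>t\<in>{0..real (Suc k) * h}. norm (X t \<omega>) \<le> 2 * (Z \<omega> + S \<omega>)"
    proof eventually_elim
      case (elim \<omega>)
      show ?case
      proof
        fix t assume t: "t \<in> {0..real (Suc k) * h}"
        show "norm (X t \<omega>) \<le> 2 * (Z \<omega> + S \<omega>)"
        proof (cases "t \<le> real k * h")
          case True
          then have "norm (X t \<omega>) \<le> Z \<omega>" using elim(1) t by auto
          then show ?thesis using Z0[of \<omega>] S0[of \<omega>] unfolding distrib_left by linarith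
        next
          case False
          then have "t \<in> {real k * h..real k * h + h}" using t by (auto simp: algebra_simps)
          then have "norm (X t \<omega>) \<le> 2 * (norm (X (real k * h) \<omega>) + S \<omega>)" using elim(2) by blast
          moreover have "norm (X (real k * h) \<omega>) \<le> Z \<omega>" using elim(1) a by auto
          ultimately show ?thesis unfolding distrib_left by linarith
        qed
      qed
    qed
    have "integrable M (\<lambda>\<omega>. 8 * (Z \<omega>)^2 + 8 * (S \<omega>)^2)" using Z2 S2 by simp
    then have "integrable M (\<lambda>\<omega>. (2 * (Z \<omega> + S \<omega>))^2)"
    proof (rule Bochner_Integration.integrable_bound)
      have "(2 * (x + y))^2 \<le> 8 * x^2 + 8 * y^2" for x y :: real
        using zero_le_power2[of "x - y"] by (simp add: power2_eq_square algebra_simps)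
      then show "AE \<omega> in M. norm ((2 * (Z \<omega> + S \<omega>))\<^sup>2) \<le> norm (8 * (Z \<omega>)\<^sup>2 + 8 * (S \<omega>)\<^sup>2)" by simp
    qed simp
    with d Z0 S0 show ?case by (intro exI[of _ "\<lambda>\<omega>. 2 * (Z \<omega> + S \<omega>)"]) auto
  qed
  obtain k :: nat where k: "T / h \<le> real k" using real_arch_simple by blast
  then have "T \<le> real k * h" using h by (simp add: field_simps)
  then have "{0..T} \<subseteq> {0..real k * h}" by auto
  with ind[of k] show ?thesis by (blast intro: eventually_mono)
qed

lemma integrable_X_square:
  assumes "0 \<le> t"
  shows "integrable M (\<lambda>\<omega>. (norm (X t \<omega>))^2)"
proof -
  obtain Z where "integrable M (\<lambda>\<omega>. (Z \<omega>)^2)" and Z: "AE \<omega> in M. \<forall>s\<in>{0..t}. norm (X s \<omega>) \<le> Z \<omega>"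
    using X_dominated[OF assms] by blast
  then show ?thesis
    by (rule_tac Bochner_Integration.integrable_bound)
      (use X_measurable[OF assms] assms in \<open>auto elim!: eventually_mono intro!: power_mono\<close>)
qed

end

section \<open>The energy\<close>

text \<open>All that is kept of the Riccati equations and of the pair matrices is one inequality,
  valid for every probability vector. Coercivity of the forms is assumed later, where the energy is
  compared with the mean square.\<close>

locale lyapunov_switching = hidden_switching M G b L \<alpha> W X \<Phi>
  for M :: "'w measure" and G :: "real^'m^'m" and b :: "'m::finite \<Rightarrow> real^'n \<Rightarrow> real^'m \<Rightarrow> real^'n"
    and L :: real and \<alpha> :: "real \<Rightarrow> 'w \<Rightarrow> 'm" and W X :: "real \<Rightarrow> 'w \<Rightarrow> real^'n"
    and \<Phi> :: "real \<Rightarrow> 'w \<Rightarrow> real^'m" +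
  fixes P :: "'m \<Rightarrow> real^'n^'n"
  assumes P_symmetric: "symmetric_mat (P i)"
    and dissipative: "\<lbrakk>\<And>i. 0 \<le> \<phi> $ i; (\<Sum>i\<in>UNIV. \<phi> $ i) = 1\<rbrakk> \<Longrightarrow>
      (\<Sum>i\<in>UNIV. \<phi> $ i * (2 * (x \<bullet> (P i *v b i x \<phi>)) + (\<Sum>j\<in>UNIV. G $ i $ j * (x \<bullet> (P j *v x))))) \<le> 0"
begin

abbreviation "q i x \<equiv> x \<bullet> (P i *v x)"

definition "energy t = expectation (\<lambda>\<omega>. q (\<alpha> t \<omega>) (X t \<omega>))"

lemma P_self_adjoint: "x \<bullet> (P i *v y) = (P i *v x) \<bullet> y"
proof -
  have "x \<bullet> (P i *v y) = (transpose (P i) *v x) \<bullet> y"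
    by (simp add: dot_lmul_matrix transpose_matrix_vector)
  then show ?thesis unfolding P_symmetric[of i, unfolded symmetric_mat_def] .
qed

text \<open>Symmetry of \<open>P i\<close> merges the two mixed terms. The expansion is exact, so
  the increment enters only linearly and quadratically.\<close>

lemma q_increment: "q i y = q i x + 2 * (x \<bullet> (P i *v (y - x))) + q i (y - x)"
  using P_self_adjoint[of x i y]
  by (simp add: matrix_vector_mult_diff_distrib inner_diff_left inner_diff_right inner_commute)

lemma measurable_state:
  assumes "0 \<le> t" "\<And>i. h i \<in> measurable M N"
  shows "(\<lambda>\<omega>. h (\<alpha> t \<omega>) \<omega>) \<in> measurable M N"
  by (rule measurable_compose_countable'[OF _ alpha_measurable]) (use assms in \<open>auto intro: countable_finite\<close>)

lemma state_sum:
  fixes h :: "'m \<Rightarrow> real"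
  shows "\<omega> \<in> space M \<Longrightarrow> h (\<alpha> t \<omega>) = (\<Sum>i\<in>UNIV. h i * state_indicator t i \<omega>)"
proof -
  assume "\<omega> \<in> space M"
  then have "(\<Sum>i\<in>UNIV. h i * state_indicator t i \<omega>) = (\<Sum>i\<in>UNIV. if \<alpha> t \<omega> = i then h i else 0)"
    by (intro sum.cong) (auto simp: indicator_def)
  then show ?thesis by simp
qed

lemma borel_measurable_matrix_vector [measurable]: "(\<lambda>x. S *v x) \<in> borel_measurable borel" for S :: "real^'k^'l"
  by (intro borel_measurable_continuous_onI linear_continuous_on matrix_vector_mul_bounded_linear)

definition "P_norm = (SOME c. 0 < c \<and> (\<forall>i x. norm (P i *v x) \<le> c * norm x))"

lemma P_bound: "0 < P_norm" "norm (P i *v x) \<le> P_norm * norm x"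
  using someI_ex[OF matrix_family_bounded[of P]] unfolding P_norm_def by blast+

lemma abs_bilinear_le: "\<bar>x \<bullet> (P i *v y)\<bar> \<le> P_norm * (norm x * norm y)"
proof -
  have "\<bar>x \<bullet> (P i *v y)\<bar> \<le> norm x * norm (P i *v y)" by (rule Cauchy_Schwarz_ineq2)
  also have "\<dots> \<le> norm x * (P_norm * norm y)" by (intro mult_left_mono P_bound) auto
  finally show ?thesis by (simp add: ac_simps)
qed

text \<open>The mode is read at the later time s, so the coefficient of the increment is not
  determined by the past at t. Its mean still vanishes because the increment of W is independent of
  the past enlarged by the whole path of \<alpha>.\<close>

lemma expectation_noise:
  assumes t: "0 \<le> t" "t < s"
  shows "integrable M (\<lambda>\<omega>. X t \<omega> \<bullet> (P (\<alpha> s \<omega>) *v (W s \<omega> - W t \<omega>)))"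
    and "expectation (\<lambda>\<omega>. X t \<omega> \<bullet> (P (\<alpha> s \<omega>) *v (W s \<omega> - W t \<omega>))) = 0"
proof -
  let ?F = "sigma (space M) (\<X> \<union> \<A> {0..} \<union> \<W> {0..t})"
  have s: "0 \<le> s" using t by simp
  have [measurable]: "X t \<in> borel_measurable M" "W t \<in> borel_measurable M" "W s \<in> borel_measurable M"
    using X_measurable W_measurable t s by auto
  note inc = brownian_increment[OF brownian t(1) less_imp_le[OF t(2)]]
  \<comment> \<open>Scalar coefficients, one for each mode and coordinate, so that the orthogonality
    of scalar increments applies.\<close>
  define Z where "Z i l \<omega> = (P i *v X t \<omega>) $ l * state_indicator s i \<omega>" for i l \<omega>
  have dom: "integrable M (\<lambda>\<omega>. P_norm * ((norm (X t \<omega>))^2 + (norm (W s \<omega> - W t \<omega>))^2))"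
    using integrable_X_square[OF t(1)] inc(3) by simp
  have [measurable]: "{\<omega> \<in> space M. \<alpha> s \<omega> = i} \<in> events" for i by (rule alpha_event[OF s])
  have int: "integrable M (\<lambda>\<omega>. Z i l \<omega> * (W s \<omega> - W t \<omega>) $ l)" for i l
  proof (rule Bochner_Integration.integrable_bound[OF dom])
    show "(\<lambda>\<omega>. Z i l \<omega> * (W s \<omega> - W t \<omega>) $ l) \<in> borel_measurable M"
      unfolding Z_def by measurable
    have "\<bar>Z i l \<omega> * (W s \<omega> - W t \<omega>) $ l\<bar> \<le> P_norm * ((norm (X t \<omega>))^2 + (norm (W s \<omega> - W t \<omega>))^2)" for \<omega>
    proof -
      have "\<bar>Z i l \<omega> * (W s \<omega> - W t \<omega>) $ l\<bar> \<le> \<bar>(P i *v X t \<omega>) $ l\<bar> * \<bar>(W s \<omega> - W t \<omega>) $ l\<bar>"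
        unfolding Z_def by (auto simp: abs_mult indicator_def simp del: vector_minus_component)
      also have "\<dots> \<le> (P_norm * norm (X t \<omega>)) * norm (W s \<omega> - W t \<omega>)"
        using P_bound by (intro mult_mono order_trans[OF component_le_norm_cart] component_le_norm_cart) auto
      also have "\<dots> = P_norm * (norm (X t \<omega>) * norm (W s \<omega> - W t \<omega>))" by simp
      also have "\<dots> \<le> P_norm * ((norm (X t \<omega>))^2 + (norm (W s \<omega> - W t \<omega>))^2)"
      proof (intro mult_left_mono)
        show "norm (X t \<omega>) * norm (W s \<omega> - W t \<omega>) \<le> (norm (X t \<omega>))^2 + (norm (W s \<omega> - W t \<omega>))^2"
          using sum_squares_bound[of "norm (X t \<omega>)" "norm (W s \<omega> - W t \<omega>)"]
            mult_nonneg_nonneg[OF norm_ge_zero norm_ge_zero, of "X t \<omega>" "W s \<omega> - W t \<omega>"] by linarith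
      qed (use P_bound in auto)
      finally show ?thesis .
    qed
    then show "AE \<omega> in M. norm (Z i l \<omega> * (W s \<omega> - W t \<omega>) $ l) \<le> norm (P_norm * ((norm (X t \<omega>))^2 + (norm (W s \<omega> - W t \<omega>))^2))"
      using P_bound by simp
  qed
  have zero: "expectation (\<lambda>\<omega>. Z i l \<omega> * (W s \<omega> - W t \<omega>) $ l) = 0" for i l
  proof (rule expectation_mult_increment[OF t _ int inc(1,2)])
    have ev: "sets ?F \<subseteq> events" by (rule past_events(2)) auto
    have "{\<omega> \<in> space M. \<alpha> s \<omega> = i} \<in> \<A> {0..}" using s by (intro alpha_event_generated) auto
    then have "{\<omega> \<in> space M. \<alpha> s \<omega> = i} \<in> sets ?F"
      using past_events(1)[of "{0..}" "{0..t}"] by auto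
    then have [measurable]: "{\<omega> \<in> space M. \<alpha> s \<omega> = i} \<in> sets (augment M ?F)"
      unfolding sets_augment[OF ev] by blast
    have [measurable]: "X t \<in> borel_measurable (augment M ?F)"
      by (rule X_past_measurable) (use t in auto)
    show "Z i l \<in> borel_measurable (augment M ?F)" unfolding Z_def by measurable
  qed
  have eq: "X t \<omega> \<bullet> (P (\<alpha> s \<omega>) *v (W s \<omega> - W t \<omega>)) = (\<Sum>i\<in>UNIV. \<Sum>l\<in>UNIV. Z i l \<omega> * (W s \<omega> - W t \<omega>) $ l)"
    if "\<omega> \<in> space M" for \<omega>
  proof -
    have "X t \<omega> \<bullet> (P (\<alpha> s \<omega>) *v (W s \<omega> - W t \<omega>))
       = (\<Sum>i\<in>UNIV. ((P i *v X t \<omega>) \<bullet> (W s \<omega> - W t \<omega>)) * state_indicator s i \<omega>)"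
      unfolding P_self_adjoint by (rule state_sum[OF that])
    also have "\<dots> = (\<Sum>i\<in>UNIV. \<Sum>l\<in>UNIV. Z i l \<omega> * (W s \<omega> - W t \<omega>) $ l)"
      unfolding Z_def inner_vec_def sum_distrib_right
      by (intro sum.cong refl) (simp only: inner_real_def mult.commute mult.left_commute mult.assoc)
    finally show ?thesis .
  qed
  have i: "integrable M (\<lambda>\<omega>. \<Sum>i\<in>UNIV. \<Sum>l\<in>UNIV. Z i l \<omega> * (W s \<omega> - W t \<omega>) $ l)"
    by (intro Bochner_Integration.integrable_sum int)
  then show "integrable M (\<lambda>\<omega>. X t \<omega> \<bullet> (P (\<alpha> s \<omega>) *v (W s \<omega> - W t \<omega>)))"
    by (subst Bochner_Integration.integrable_cong[OF refl eq])
  have "expectation (\<lambda>\<omega>. X t \<omega> \<bullet> (P (\<alpha> s \<omega>) *v (W s \<omega> - W t \<omega>)))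
      = expectation (\<lambda>\<omega>. \<Sum>i\<in>UNIV. \<Sum>l\<in>UNIV. Z i l \<omega> * (W s \<omega> - W t \<omega>) $ l)"
    by (rule Bochner_Integration.integral_cong[OF refl eq])
  also have "\<dots> = (\<Sum>i\<in>UNIV. \<Sum>l\<in>UNIV. expectation (\<lambda>\<omega>. Z i l \<omega> * (W s \<omega> - W t \<omega>) $ l))"
    using int by (simp only: Bochner_Integration.integral_sum Bochner_Integration.integrable_sum)
  also have "\<dots> = 0" unfolding zero by simp
  finally show "expectation (\<lambda>\<omega>. X t \<omega> \<bullet> (P (\<alpha> s \<omega>) *v (W s \<omega> - W t \<omega>))) = 0" .
qed

lemma integrable_q:
  assumes "0 \<le> t"
  shows "integrable M (\<lambda>\<omega>. q i (X t \<omega>))"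
proof -
  have [measurable]: "X t \<in> borel_measurable M" using X_measurable assms by auto
  have "integrable M (\<lambda>\<omega>. P_norm * (norm (X t \<omega>))^2)" using integrable_X_square[OF assms] by simp
  then show ?thesis
  proof (rule Bochner_Integration.integrable_bound)
    show "AE \<omega> in M. norm (q i (X t \<omega>)) \<le> norm (P_norm * (norm (X t \<omega>))\<^sup>2)"
      using abs_bilinear_le P_bound(1) by (simp add: power2_eq_square)
  qed simp
qed

lemma integrable_q_state:
  assumes "0 \<le> t" "0 \<le> s"
  shows "integrable M (\<lambda>\<omega>. q i (X t \<omega>) * state_indicator s j \<omega>)"
  using integrable_real_mult_indicator[OF alpha_event[OF assms(2)] integrable_q[OF assms(1)]]
  by (simp add: mult.commute)

lemma expectation_q_state:
  assumes "0 \<le> t" "0 \<le> s"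
  shows "integrable M (\<lambda>\<omega>. q (\<alpha> s \<omega>) (X t \<omega>))"
    and "expectation (\<lambda>\<omega>. q (\<alpha> s \<omega>) (X t \<omega>)) = (\<Sum>i\<in>UNIV. expectation (\<lambda>\<omega>. q i (X t \<omega>) * state_indicator s i \<omega>))"
proof -
  have eq: "q (\<alpha> s \<omega>) (X t \<omega>) = (\<Sum>i\<in>UNIV. q i (X t \<omega>) * state_indicator s i \<omega>)" if "\<omega> \<in> space M" for \<omega>
    by (rule state_sum[OF that])
  have "integrable M (\<lambda>\<omega>. \<Sum>i\<in>UNIV. q i (X t \<omega>) * state_indicator s i \<omega>)"
    by (intro Bochner_Integration.integrable_sum integrable_q_state assms)
  then show "integrable M (\<lambda>\<omega>. q (\<alpha> s \<omega>) (X t \<omega>))"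
    by (subst Bochner_Integration.integrable_cong[OF refl eq])
  have "expectation (\<lambda>\<omega>. q (\<alpha> s \<omega>) (X t \<omega>)) = expectation (\<lambda>\<omega>. \<Sum>i\<in>UNIV. q i (X t \<omega>) * state_indicator s i \<omega>)"
    by (rule Bochner_Integration.integral_cong[OF refl eq])
  then show "expectation (\<lambda>\<omega>. q (\<alpha> s \<omega>) (X t \<omega>)) = (\<Sum>i\<in>UNIV. expectation (\<lambda>\<omega>. q i (X t \<omega>) * state_indicator s i \<omega>))"
    using integrable_q_state[OF assms] by (simp only: Bochner_Integration.integral_sum)
qed

text \<open>The mean of the sum over j of G_{\<alpha>(t), j} X'P_jX, that is the chain part of the
  generator of (X, \<alpha>) applied to X'P_\<alpha> X.\<close>

definition "jump_rate t = (\<Sum>i\<in>UNIV. \<Sum>j\<in>UNIV. G $ i $ j * expectation (\<lambda>\<omega>. q j (X t \<omega>) * state_indicator t i \<omega>))"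

text \<open>Only the mode moves here; X is frozen at time t. The terms of order 0 and 1 of
  \<open>mat_exp\<close> produce \<open>energy t\<close> and \<open>d * jump_rate t\<close>, and
  each of the \<open>CARD('m)^2\<close> remainders is quadratic in d.\<close>

lemma expectation_jump:
  fixes t d C :: real
  assumes C: "\<And>d i j. 0 \<le> d \<Longrightarrow> d * C \<le> 1 \<Longrightarrow>
       \<bar>mat_exp (d *\<^sub>R G) $ i $ j - mat 1 $ i $ j - d * G $ i $ j\<bar> \<le> (d * C)^2"
    and t: "0 \<le> t" and d: "0 \<le> d" "d * C \<le> 1"
  shows "expectation (\<lambda>\<omega>. q (\<alpha> (t + d) \<omega>) (X t \<omega>)) - energy t
    \<le> d * jump_rate t + CARD('m)^2 * (d * C)^2 * P_norm * expectation (\<lambda>\<omega>. (norm (X t \<omega>))^2)"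
proof -
  define e where "e i j = expectation (\<lambda>\<omega>. q j (X t \<omega>) * state_indicator t i \<omega>)" for i j
  define r where "r i j = mat_exp (d *\<^sub>R G) $ i $ j - mat 1 $ i $ j - d * G $ i $ j" for i j
  let ?x = "expectation (\<lambda>\<omega>. (norm (X t \<omega>))^2)"
  have [measurable]: "X t \<in> borel_measurable (augment M (sigma (space M) (\<X> \<union> \<A> {0..t} \<union> \<W> {0..t})))"
    by (rule X_past_measurable) (use t in auto)
  have "(\<lambda>\<omega>. q j (X t \<omega>)) \<in> borel_measurable (augment M (sigma (space M) (\<X> \<union> \<A> {0..t} \<union> \<W> {0..t})))" for j
    by measurable
  then have "expectation (\<lambda>\<omega>. q j (X t \<omega>) * state_indicator (t + d) j \<omega>) = (\<Sum>i\<in>UNIV. mat_exp (d *\<^sub>R G) $ i $ j * e i j)" for j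
    unfolding e_def by (rule expectation_mult_transition[OF t d(1) _ integrable_q[OF t]])
  then have "expectation (\<lambda>\<omega>. q (\<alpha> (t + d) \<omega>) (X t \<omega>)) = (\<Sum>j\<in>UNIV. \<Sum>i\<in>UNIV. mat_exp (d *\<^sub>R G) $ i $ j * e i j)"
    using expectation_q_state(2)[OF t, of "t + d"] t d by simp
  moreover have "energy t = (\<Sum>j\<in>UNIV. \<Sum>i\<in>UNIV. mat 1 $ i $ j * e i j)"
  proof -
    have "energy t = (\<Sum>j\<in>UNIV. e j j)" unfolding energy_def e_def by (rule expectation_q_state(2)[OF t t])
    moreover have "(\<Sum>i\<in>UNIV. mat 1 $ i $ j * e i j) = e j j" for j :: 'm
    proof -
      have "(\<Sum>i\<in>UNIV. mat 1 $ i $ j * e i j) = (\<Sum>i\<in>UNIV. if i = j then e i j else 0)"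
        by (intro sum.cong) (auto simp: mat_def)
      then show ?thesis by simp
    qed
    ultimately show ?thesis by simp
  qed
  moreover have "jump_rate t = (\<Sum>j\<in>UNIV. \<Sum>i\<in>UNIV. G $ i $ j * e i j)"
    unfolding jump_rate_def e_def by (rule sum.swap)
  ultimately have "expectation (\<lambda>\<omega>. q (\<alpha> (t + d) \<omega>) (X t \<omega>)) - energy t - d * jump_rate t = (\<Sum>j\<in>UNIV. \<Sum>i\<in>UNIV. r i j * e i j)"
    unfolding r_def by (simp only: sum_subtractf left_diff_distrib sum_distrib_left mult.assoc)
  also have "\<dots> \<le> (\<Sum>j\<in>(UNIV::'m set). \<Sum>i\<in>(UNIV::'m set). (d * C)^2 * (P_norm * ?x))"
  proof (intro sum_mono)
    fix i j :: 'm
    have dom: "integrable M (\<lambda>\<omega>. P_norm * (norm (X t \<omega>))^2)" using integrable_X_square[OF t] by simp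
    have "\<bar>e i j\<bar> \<le> expectation (\<lambda>\<omega>. \<bar>q j (X t \<omega>) * state_indicator t i \<omega>\<bar>)"
      unfolding e_def by (rule integral_abs_bound)
    also have "\<dots> \<le> expectation (\<lambda>\<omega>. P_norm * (norm (X t \<omega>))^2)"
    proof (rule integral_mono[OF integrable_abs[OF integrable_q_state[OF t t]] dom])
      fix \<omega>
      show "\<bar>q j (X t \<omega>) * state_indicator t i \<omega>\<bar> \<le> P_norm * (norm (X t \<omega>))^2"
        using abs_bilinear_le[of "X t \<omega>" j "X t \<omega>"] P_bound(1)
        by (auto simp: abs_mult indicator_def power2_eq_square)
    qed
    finally have "\<bar>e i j\<bar> \<le> P_norm * ?x" by simp
    moreover have "\<bar>r i j\<bar> \<le> (d * C)^2" unfolding r_def by (rule C[OF d])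
    ultimately have "\<bar>r i j\<bar> * \<bar>e i j\<bar> \<le> (d * C)^2 * (P_norm * ?x)" by (intro mult_mono) auto
    then show "r i j * e i j \<le> (d * C)^2 * (P_norm * ?x)" by (simp add: abs_mult[symmetric] abs_le_iff)
  qed
  also have "\<dots> = CARD('m)^2 * (d * C)^2 * P_norm * ?x" by (simp add: power2_eq_square)
  finally show ?thesis by linarith
qed

lemma drift_integrable:
  assumes t: "0 \<le> t"
  shows "integrable M (\<lambda>\<omega>. X t \<omega> \<bullet> (P i *v b i (X t \<omega>) (\<Phi> t \<omega>)))"
    and "(\<lambda>(x, \<phi>). x \<bullet> (P i *v b i x \<phi>)) \<in> borel_measurable (borel \<Otimes>\<^sub>M borel)"
proof -
  have "(\<lambda>(x, \<phi>). b i x \<phi>) \<in> borel_measurable borel"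
    by (rule borel_measurable_continuous_onI) (rule b_continuous)
  then have bm[measurable]: "(\<lambda>(x, \<phi>). b i x \<phi>) \<in> borel_measurable (borel \<Otimes>\<^sub>M borel)" by (simp add: borel_prod)
  have "(\<lambda>z. fst z \<bullet> (P i *v (\<lambda>(x, \<phi>). b i x \<phi>) z)) \<in> borel_measurable (borel \<Otimes>\<^sub>M borel)" by measurable
  then show k[measurable]: "(\<lambda>(x, \<phi>). x \<bullet> (P i *v b i x \<phi>)) \<in> borel_measurable (borel \<Otimes>\<^sub>M borel)"
    by (simp add: case_prod_unfold)
  have [measurable]: "X t \<in> borel_measurable M" "\<Phi> t \<in> borel_measurable M"
    using X_measurable Phi_measurable t by auto
  have m: "(\<lambda>\<omega>. X t \<omega> \<bullet> (P i *v b i (X t \<omega>) (\<Phi> t \<omega>))) \<in> borel_measurable M"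
  proof -
    have "(\<lambda>\<omega>. (\<lambda>(x, \<phi>). x \<bullet> (P i *v b i x \<phi>)) (X t \<omega>, \<Phi> t \<omega>)) \<in> borel_measurable M"
      by (rule measurable_compose[OF _ k]) simp
    then show ?thesis by simp
  qed
  have "integrable M (\<lambda>\<omega>. P_norm * L * (norm (X t \<omega>))^2)" using integrable_X_square[OF t] by simp
  then show "integrable M (\<lambda>\<omega>. X t \<omega> \<bullet> (P i *v b i (X t \<omega>) (\<Phi> t \<omega>)))"
  proof (rule Bochner_Integration.integrable_bound[OF _ m])
    show "AE \<omega> in M. norm (X t \<omega> \<bullet> (P i *v b i (X t \<omega>) (\<Phi> t \<omega>))) \<le> norm (P_norm * L * (norm (X t \<omega>))\<^sup>2)"
      using filter_bounds
    proof eventually_elim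
      case (elim \<omega>)
      have "\<bar>X t \<omega> \<bullet> (P i *v b i (X t \<omega>) (\<Phi> t \<omega>))\<bar> \<le> P_norm * (norm (X t \<omega>) * norm (b i (X t \<omega>) (\<Phi> t \<omega>)))"
        by (rule abs_bilinear_le)
      also have "\<dots> \<le> P_norm * (norm (X t \<omega>) * (L * norm (X t \<omega>)))"
        using elim t P_bound(1) by (intro mult_left_mono b_growth) auto
      finally show ?case using P_bound(1) L_nonneg by (simp add: power2_eq_square ac_simps)
    qed
  qed
qed

text \<open>Conditioning on the observations replaces the indicator of the hidden state by the filter,
  and only then does the dissipation inequality apply.\<close>

lemma drift_plus_jump_nonpos:
  assumes t: "0 \<le> t"
  shows "integrable M (\<lambda>\<omega>. X t \<omega> \<bullet> (P (\<alpha> t \<omega>) *v b (\<alpha> t \<omega>) (X t \<omega>) (\<Phi> t \<omega>)))"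
    and "2 * expectation (\<lambda>\<omega>. X t \<omega> \<bullet> (P (\<alpha> t \<omega>) *v b (\<alpha> t \<omega>) (X t \<omega>) (\<Phi> t \<omega>))) + jump_rate t \<le> 0"
proof -
  define k where "k i \<omega> = X t \<omega> \<bullet> (P i *v b i (X t \<omega>) (\<Phi> t \<omega>))" for i \<omega>
  have kf: "integrable M (\<lambda>\<omega>. k i \<omega> * state_indicator t i \<omega>)"
    "expectation (\<lambda>\<omega>. k i \<omega> * state_indicator t i \<omega>) = expectation (\<lambda>\<omega>. k i \<omega> * \<Phi> t \<omega> $ i)"
    "integrable M (\<lambda>\<omega>. k i \<omega> * \<Phi> t \<omega> $ i)" for i
    using expectation_mult_filter[OF t drift_integrable(2)[OF t, of i], of i] drift_integrable(1)[OF t, of i]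
    unfolding k_def by simp_all
  have qm: "(\<lambda>(x, \<phi>). q j x) \<in> borel_measurable (borel \<Otimes>\<^sub>M (borel :: (real^'m) measure))" for j
  proof -
    have "(\<lambda>z. q j (fst z)) \<in> borel_measurable (borel \<Otimes>\<^sub>M (borel :: (real^'m) measure))" by measurable
    then show ?thesis by (simp add: case_prod_unfold)
  qed
  have qf: "expectation (\<lambda>\<omega>. q j (X t \<omega>) * state_indicator t i \<omega>) = expectation (\<lambda>\<omega>. q j (X t \<omega>) * \<Phi> t \<omega> $ i)"
    "integrable M (\<lambda>\<omega>. q j (X t \<omega>) * \<Phi> t \<omega> $ i)" for i j
    using expectation_mult_filter(2,3)[OF t qm[of j], of i] integrable_q[OF t, of j] by simp_all
  have eq: "X t \<omega> \<bullet> (P (\<alpha> t \<omega>) *v b (\<alpha> t \<omega>) (X t \<omega>) (\<Phi> t \<omega>)) = (\<Sum>i\<in>UNIV. k i \<omega> * state_indicator t i \<omega>)"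
    if "\<omega> \<in> space M" for \<omega>
    unfolding k_def by (rule state_sum[OF that])
  have "integrable M (\<lambda>\<omega>. \<Sum>i\<in>UNIV. k i \<omega> * state_indicator t i \<omega>)"
    by (intro Bochner_Integration.integrable_sum kf)
  then show "integrable M (\<lambda>\<omega>. X t \<omega> \<bullet> (P (\<alpha> t \<omega>) *v b (\<alpha> t \<omega>) (X t \<omega>) (\<Phi> t \<omega>)))"
    by (subst Bochner_Integration.integrable_cong[OF refl eq])
  have "expectation (\<lambda>\<omega>. X t \<omega> \<bullet> (P (\<alpha> t \<omega>) *v b (\<alpha> t \<omega>) (X t \<omega>) (\<Phi> t \<omega>))) = expectation (\<lambda>\<omega>. \<Sum>i\<in>UNIV. k i \<omega> * state_indicator t i \<omega>)"
    by (rule Bochner_Integration.integral_cong[OF refl eq])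
  also have "\<dots> = (\<Sum>i\<in>UNIV. expectation (\<lambda>\<omega>. k i \<omega> * \<Phi> t \<omega> $ i))"
    using kf by (simp only: Bochner_Integration.integral_sum)
  finally have "2 * expectation (\<lambda>\<omega>. X t \<omega> \<bullet> (P (\<alpha> t \<omega>) *v b (\<alpha> t \<omega>) (X t \<omega>) (\<Phi> t \<omega>))) + jump_rate t
     = (\<Sum>i\<in>UNIV. 2 * expectation (\<lambda>\<omega>. k i \<omega> * \<Phi> t \<omega> $ i) + (\<Sum>j\<in>UNIV. G $ i $ j * expectation (\<lambda>\<omega>. q j (X t \<omega>) * \<Phi> t \<omega> $ i)))"
    unfolding jump_rate_def qf(1) by (simp add: sum.distrib sum_distrib_left)
  also have "\<dots> = (\<Sum>i\<in>UNIV. expectation (\<lambda>\<omega>. 2 * (k i \<omega> * \<Phi> t \<omega> $ i) + (\<Sum>j\<in>UNIV. G $ i $ j * (q j (X t \<omega>) * \<Phi> t \<omega> $ i))))"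
    using kf(3) qf(2) by (intro sum.cong refl) (simp add: Bochner_Integration.integral_sum)
  also have "\<dots> = expectation (\<lambda>\<omega>. \<Sum>i\<in>UNIV. 2 * (k i \<omega> * \<Phi> t \<omega> $ i) + (\<Sum>j\<in>UNIV. G $ i $ j * (q j (X t \<omega>) * \<Phi> t \<omega> $ i)))"
    using kf(3) qf(2) by (intro Bochner_Integration.integral_sum[symmetric]) simp
  also have "\<dots> \<le> 0"
  proof -
    have "AE \<omega> in M. (\<Sum>i\<in>UNIV. 2 * (k i \<omega> * \<Phi> t \<omega> $ i) + (\<Sum>j\<in>UNIV. G $ i $ j * (q j (X t \<omega>) * \<Phi> t \<omega> $ i))) \<le> 0"
      using filter_simplex[OF t]
    proof eventually_elim
      case (elim \<omega>)
      have "(\<Sum>i\<in>UNIV. \<Phi> t \<omega> $ i * (2 * k i \<omega> + (\<Sum>j\<in>UNIV. G $ i $ j * q j (X t \<omega>)))) \<le> 0"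
        unfolding k_def using elim by (intro dissipative) auto
      moreover have "2 * (k i \<omega> * \<Phi> t \<omega> $ i) + (\<Sum>j\<in>UNIV. G $ i $ j * (q j (X t \<omega>) * \<Phi> t \<omega> $ i))
         = \<Phi> t \<omega> $ i * (2 * k i \<omega> + (\<Sum>j\<in>UNIV. G $ i $ j * q j (X t \<omega>)))" for i
        by (simp add: distrib_left sum_distrib_left ac_simps)
      ultimately show ?case by simp
    qed
    then have "0 \<le> expectation (\<lambda>\<omega>. - (\<Sum>i\<in>UNIV. 2 * (k i \<omega> * \<Phi> t \<omega> $ i) + (\<Sum>j\<in>UNIV. G $ i $ j * (q j (X t \<omega>) * \<Phi> t \<omega> $ i))))"
      by (intro integral_nonneg_AE) (auto elim: eventually_mono)
    then show ?thesis by (simp only: integral_minus neg_0_le_iff_le)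
  qed
  finally show "2 * expectation (\<lambda>\<omega>. X t \<omega> \<bullet> (P (\<alpha> t \<omega>) *v b (\<alpha> t \<omega>) (X t \<omega>) (\<Phi> t \<omega>))) + jump_rate t \<le> 0" .
qed

end

text \<open>The mode is constant just after t, so the limit from the right is that of the single
  branch \<open>g (a t)\<close>.\<close>

lemma right_continuous_state:
  fixes g :: "'i \<Rightarrow> real \<Rightarrow> 'b::topological_space" and a :: "real \<Rightarrow> 'i"
  assumes "\<exists>e>0. \<forall>s\<in>{t..<t + e}. a s = a t"
    and "\<And>i. continuous (at t within {t..}) (g i)"
  shows "continuous (at t within {t..}) (\<lambda>s. g (a s) s)"
proof -
  obtain e where e: "e > 0" "\<And>s. s \<in> {t..<t + e} \<Longrightarrow> a s = a t" using assms(1) by blast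
  have "eventually (\<lambda>s. s < t + e) (at t within {t..})"
    by (rule order_tendstoD(2)[OF tendsto_ident_at]) (use e(1) in simp)
  moreover have "eventually (\<lambda>s. s \<in> {t..}) (at t within {t..})"
    unfolding eventually_at_filter by (rule always_eventually) blast
  ultimately have "eventually (\<lambda>s. g (a t) s = g (a s) s) (at t within {t..})"
  proof eventually_elim
    case (elim s)
    then have "a s = a t" by (intro e(2)) simp
    then show ?case by simp
  qed
  moreover have "((\<lambda>s. g (a t) s) \<longlongrightarrow> g (a t) t) (at t within {t..})"
    using assms(2) by (simp add: continuous_within)
  ultimately show ?thesis unfolding continuous_within by (rule Lim_transform_eventually[rotated])
qed

lemma grid_bounds:
  fixes T :: real
  assumes "0 < T" "k < N"
  shows "0 \<le> T / real N * real k" "T / real N * (real k + 1) = T / real N * real k + T / real N"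
    "T / real N * (real k + 1) \<le> T" "0 < T / real N"
proof -
  have "T / real N * (real k + 1) \<le> T / real N * real N" using assms by (intro mult_left_mono) auto
  also have "\<dots> = T" using assms by simp
  finally show "T / real N * (real k + 1) \<le> T" .
qed (use assms in \<open>auto simp: distrib_left add_divide_distrib\<close>)

section \<open>The energy along a time grid\<close>

context lyapunov_switching
begin

abbreviation "drift t \<omega> \<equiv> b (\<alpha> t \<omega>) (X t \<omega>) (\<Phi> t \<omega>)"
text \<open>By the dynamics this is the integral of the drift from t to s. Written through X and W
  it is visibly a random variable.\<close>

abbreviation "drift_increment t s \<omega> \<equiv> X s \<omega> - X t \<omega> - (W s \<omega> - W t \<omega>)"
abbreviation "drift_work t s \<omega> \<equiv> X t \<omega> \<bullet> (P (\<alpha> s \<omega>) *v drift_increment t s \<omega>)"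
abbreviation "drift_power t \<omega> \<equiv> X t \<omega> \<bullet> (P (\<alpha> t \<omega>) *v drift t \<omega>)"

lemma drift_increment_bound:
  assumes Z: "AE \<omega> in M. \<forall>s\<in>{0..T}. norm (X s \<omega>) \<le> Z \<omega>" and ts: "0 \<le> t" "t \<le> s" "s \<le> T"
  shows "AE \<omega> in M. norm (drift_increment t s \<omega>) \<le> (s - t) * (L * Z \<omega>)"
  using dynamics_between drift_bound Z
proof eventually_elim
  case (elim \<omega>)
  have i: "((\<lambda>r. drift r \<omega>) has_integral drift_increment t s \<omega>) {t..s}"
    using elim(1) ts by auto
  have "0 \<le> Z \<omega>" using elim(3) ts norm_ge_zero order_trans by (metis atLeastAtMost_iff order_trans)
  then have "norm (drift_increment t s \<omega>) \<le> (L * Z \<omega>) * Henstock_Kurzweil_Integration.content {t..s}"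
  proof (intro has_integral_bound_real[OF _ finite.emptyI i])
    fix r assume r: "r \<in> {t..s} - {}"
    then have "norm (drift r \<omega>) \<le> L * norm (X r \<omega>)" using elim(2) ts by auto
    also have "\<dots> \<le> L * Z \<omega>" using elim(3) r ts L_nonneg by (intro mult_left_mono) auto
    finally show "norm (drift r \<omega>) \<le> L * Z \<omega>" .
  qed (use L_nonneg in auto)
  then show ?case using ts by (simp add: mult.commute)
qed

lemma integrable_drift_increment:
  assumes Z: "AE \<omega> in M. \<forall>s\<in>{0..T}. norm (X s \<omega>) \<le> Z \<omega>" "integrable M (\<lambda>\<omega>. (Z \<omega>)^2)"
    and ts: "0 \<le> t" "t \<le> s" "s \<le> T"
  shows "integrable M (\<lambda>\<omega>. drift_work t s \<omega>)"
    and "AE \<omega> in M. \<bar>drift_work t s \<omega>\<bar> \<le> (s - t) * (P_norm * L * (Z \<omega>)^2)"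
proof -
  have s0: "0 \<le> s" using ts by simp
  have [measurable]: "X t \<in> borel_measurable M" "X s \<in> borel_measurable M" "W t \<in> borel_measurable M" "W s \<in> borel_measurable M"
    by (intro X_measurable W_measurable ts(1) s0)+
  have m: "(\<lambda>\<omega>. drift_work t s \<omega>) \<in> borel_measurable M"
    by (rule measurable_state[OF s0, where h = "\<lambda>i \<omega>. X t \<omega> \<bullet> (P i *v drift_increment t s \<omega>)"]) measurable
  show b: "AE \<omega> in M. \<bar>drift_work t s \<omega>\<bar> \<le> (s - t) * (P_norm * L * (Z \<omega>)^2)"
    using drift_increment_bound[OF Z(1) ts] Z(1)
  proof eventually_elim
    case (elim \<omega>)
    have X: "norm (X t \<omega>) \<le> Z \<omega>" using elim(2) ts by auto
    then have "0 \<le> Z \<omega>" using norm_ge_zero order_trans by blast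
    have "\<bar>drift_work t s \<omega>\<bar> \<le> P_norm * (norm (X t \<omega>) * norm (drift_increment t s \<omega>))"
      by (rule abs_bilinear_le)
    also have "\<dots> \<le> P_norm * (Z \<omega> * ((s - t) * (L * Z \<omega>)))"
      using X elim(1) \<open>0 \<le> Z \<omega>\<close> P_bound(1) by (intro mult_left_mono mult_mono) auto
    finally show ?case by (simp add: power2_eq_square ac_simps)
  qed
  have "integrable M (\<lambda>\<omega>. (s - t) * (P_norm * L * (Z \<omega>)^2))" using Z(2) by simp
  then show "integrable M (\<lambda>\<omega>. drift_work t s \<omega>)"
    by (rule Bochner_Integration.integrable_bound[OF _ m]) (use b in \<open>auto elim!: eventually_mono\<close>)
qed

text \<open>The change of energy splits into the move of the chain with X frozen, the cross term of
  X(t) with its increment in the new mode, and the quadratic form of that increment. The noise half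
  of the cross term has mean 0; the quadratic form costs order d from the noise and order d^2 from
  the drift. \<open>drift_work\<close> stays as it is, because it is compared with the drift at an
  instant only after summation over a grid.\<close>

lemma energy_step:
  fixes t d C :: real
  assumes C: "\<And>d i j. 0 \<le> d \<Longrightarrow> d * C \<le> 1 \<Longrightarrow>
       \<bar>mat_exp (d *\<^sub>R G) $ i $ j - mat 1 $ i $ j - d * G $ i $ j\<bar> \<le> (d * C)^2"
    and Z: "AE \<omega> in M. \<forall>s\<in>{0..T}. norm (X s \<omega>) \<le> Z \<omega>" "integrable M (\<lambda>\<omega>. (Z \<omega>)^2)"
    and t: "0 \<le> t" and d: "0 < d" "d * C \<le> 1" "t + d \<le> T"
  shows "energy (t + d) - energy t \<le>
     2 * expectation (\<lambda>\<omega>. drift_work t (t + d) \<omega>)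
      + d * jump_rate t + d * (2 * P_norm * CARD('n))
      + d^2 * ((2 * P_norm * L^2 + CARD('m)^2 * C^2 * P_norm) * expectation (\<lambda>\<omega>. (Z \<omega>)^2))"
proof -
  let ?s = "t + d"
  let ?I = "\<lambda>\<omega>. drift_work t ?s \<omega>"
  let ?N = "\<lambda>\<omega>. X t \<omega> \<bullet> (P (\<alpha> ?s \<omega>) *v (W ?s \<omega> - W t \<omega>))"
  let ?w = "\<lambda>\<omega>. (norm (W ?s \<omega> - W t \<omega>))^2"
  \<comment> \<open>The last summand bounds the quadratic form of the increment by means of |D +
    dW|^2 <= 2 |D|^2 + 2 |dW|^2, which separates drift from noise.\<close>
  let ?R = "\<lambda>\<omega>. q (\<alpha> ?s \<omega>) (X t \<omega>) + 2 * ?I \<omega> + 2 * ?N \<omega> + 2 * P_norm * (d^2 * L^2 * (Z \<omega>)^2 + ?w \<omega>)"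
  have ts: "0 \<le> t" "t \<le> ?s" "?s \<le> T" "0 \<le> ?s" "t < ?s" using t d by auto
  note noise = expectation_noise[OF t ts(5)]
  note inc = brownian_increment(3,4)[OF brownian t ts(2)]
  note I = integrable_drift_increment(1)[OF Z ts(1-3)]
  have le: "AE \<omega> in M. q (\<alpha> ?s \<omega>) (X ?s \<omega>) \<le> ?R \<omega>"
    using drift_increment_bound[OF Z(1) ts(1-3)]
  proof eventually_elim
    case (elim \<omega>)
    define D dW where D: "D = drift_increment t ?s \<omega>" and dW: "dW = W ?s \<omega> - W t \<omega>"
    have X: "X ?s \<omega> - X t \<omega> = D + dW" by (simp add: D dW)
    have "q (\<alpha> ?s \<omega>) (X ?s \<omega> - X t \<omega>) \<le> P_norm * (norm (D + dW))^2"
      using abs_bilinear_le[of "D + dW" "\<alpha> ?s \<omega>" "D + dW"] unfolding X power2_eq_square by (rule order_trans[OF abs_ge_self])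
    also have "\<dots> \<le> P_norm * (2 * (norm D)^2 + 2 * (norm dW)^2)"
    proof (intro mult_left_mono)
      have "(norm (D + dW))^2 \<le> (norm D + norm dW)^2" by (intro power_mono norm_triangle_ineq) auto
      also have "\<dots> \<le> 2 * (norm D)^2 + 2 * (norm dW)^2"
        using sum_squares_bound[of "norm D" "norm dW"] by (simp add: power2_sum)
      finally show "(norm (D + dW))^2 \<le> 2 * (norm D)^2 + 2 * (norm dW)^2" .
    qed (use P_bound in auto)
    also have "\<dots> \<le> P_norm * (2 * (d * (L * Z \<omega>))^2 + 2 * (norm dW)^2)"
      using elim[folded D] P_bound(1) by (intro mult_left_mono add_mono power_mono) auto
    finally have "q (\<alpha> ?s \<omega>) (X ?s \<omega> - X t \<omega>) \<le> 2 * P_norm * (d^2 * L^2 * (Z \<omega>)^2 + ?w \<omega>)"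
      unfolding dW by (simp add: power_mult_distrib algebra_simps)
    moreover have "X t \<omega> \<bullet> (P (\<alpha> ?s \<omega>) *v (X ?s \<omega> - X t \<omega>)) = ?I \<omega> + ?N \<omega>"
    proof -
      have "X t \<omega> \<bullet> (P (\<alpha> ?s \<omega>) *v (X ?s \<omega> - X t \<omega>)) = X t \<omega> \<bullet> (P (\<alpha> ?s \<omega>) *v D) + X t \<omega> \<bullet> (P (\<alpha> ?s \<omega>) *v dW)"
        unfolding X by (simp only: matrix_vector_right_distrib inner_add_right)
      then show ?thesis by (simp only: D dW)
    qed
    ultimately show ?case
      using q_increment[where i = "\<alpha> ?s \<omega>" and y = "X ?s \<omega>" and x = "X t \<omega>"] by linarith
  qed
  have "energy ?s \<le> expectation ?R"
    unfolding energy_def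
    by (rule integral_mono_AE[OF expectation_q_state(1)[OF ts(4) ts(4)] _ le])
      (use expectation_q_state(1)[OF t ts(4)] I noise(1) inc(1) Z(2) in simp)
  also have "\<dots> = expectation (\<lambda>\<omega>. q (\<alpha> ?s \<omega>) (X t \<omega>)) + 2 * expectation ?I
      + 2 * P_norm * (d^2 * L^2 * expectation (\<lambda>\<omega>. (Z \<omega>)^2) + CARD('n) * d)"
    using expectation_q_state(1)[OF t ts(4)] I noise inc Z(2) by simp
  finally have 1: "energy ?s \<le> expectation (\<lambda>\<omega>. q (\<alpha> ?s \<omega>) (X t \<omega>)) + 2 * expectation ?I
      + 2 * P_norm * (d^2 * L^2 * expectation (\<lambda>\<omega>. (Z \<omega>)^2) + CARD('n) * d)" .
  have 2: "expectation (\<lambda>\<omega>. q (\<alpha> ?s \<omega>) (X t \<omega>)) - energy t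
    \<le> d * jump_rate t + CARD('m)^2 * (d * C)^2 * P_norm * expectation (\<lambda>\<omega>. (norm (X t \<omega>))^2)"
    by (rule expectation_jump[OF C t less_imp_le[OF d(1)] d(2)])
  have "expectation (\<lambda>\<omega>. (norm (X t \<omega>))^2) \<le> expectation (\<lambda>\<omega>. (Z \<omega>)^2)"
  proof (rule integral_mono_AE[OF integrable_X_square[OF t] Z(2)])
    show "AE \<omega> in M. (norm (X t \<omega>))\<^sup>2 \<le> (Z \<omega>)\<^sup>2"
      using Z(1) by eventually_elim (use ts in \<open>auto intro!: power_mono\<close>)
  qed
  then have "CARD('m)^2 * (d * C)^2 * P_norm * expectation (\<lambda>\<omega>. (norm (X t \<omega>))^2)
     \<le> CARD('m)^2 * (d * C)^2 * P_norm * expectation (\<lambda>\<omega>. (Z \<omega>)^2)"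
    using P_bound(1) by (intro mult_left_mono) auto
  with 1 2 have "energy ?s - energy t \<le> 2 * expectation ?I + d * jump_rate t
     + (2 * P_norm * (d^2 * L^2 * expectation (\<lambda>\<omega>. (Z \<omega>)^2) + CARD('n) * d)
     + CARD('m)^2 * (d * C)^2 * P_norm * expectation (\<lambda>\<omega>. (Z \<omega>)^2))"
    by linarith
  also have "2 * P_norm * (d^2 * L^2 * expectation (\<lambda>\<omega>. (Z \<omega>)^2) + CARD('n) * d)
     + CARD('m)^2 * (d * C)^2 * P_norm * expectation (\<lambda>\<omega>. (Z \<omega>)^2)
    = d * (2 * P_norm * CARD('n))
      + d^2 * ((2 * P_norm * L^2 + CARD('m)^2 * C^2 * P_norm) * expectation (\<lambda>\<omega>. (Z \<omega>)^2))"
    by (simp add: power_mult_distrib algebra_simps)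
  finally show ?thesis by simp
qed

text \<open>The power is sampled at the right end of each cell, where \<open>drift_work\<close> also
  reads the mode: the right ends of the cells around a fixed time decrease towards it in the sense
  that right-continuity of \<alpha> can use.\<close>

definition "riemann_error T N \<omega> = (\<Sum>k<N.
    drift_work (T / real N * real k) (T / real N * (real k + 1)) \<omega>
  - T / real N * (drift_power (T / real N * (real k + 1)) \<omega>))"

lemma riemann_error_tendsto:
  assumes T: "0 < T"
  shows "AE \<omega> in M. (\<lambda>N. riemann_error T N \<omega>) \<longlonglongrightarrow> 0"
proof -
  obtain Z where Z: "AE \<omega> in M. \<forall>s\<in>{0..T}. norm (X s \<omega>) \<le> Z \<omega>" using X_dominated[of T] T by auto
  have Xc: "AE \<omega> in M. continuous_on {0..} (\<lambda>t. X t \<omega>)" using X_continuous by (simp add: continuous_paths_def)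
  have Pc: "AE \<omega> in M. continuous_on {0..} (\<lambda>t. \<Phi> t \<omega>)" using filter by (simp add: wonham_filter_def continuous_paths_def)
  have ac: "AE \<omega> in M. \<forall>t\<ge>0. \<exists>e>0. \<forall>s\<in>{t..<t + e}. \<alpha> s \<omega> = \<alpha> t \<omega>" using markov by (simp add: markov_chain_def)
  show ?thesis
    using Z Xc Pc ac dynamics_between drift_bound
  proof eventually_elim
    case (elim \<omega>)
    let ?x = "\<lambda>t. X t \<omega>" and ?p = "\<lambda>t. P (\<alpha> t \<omega>)" and ?\<beta> = "\<lambda>t. drift t \<omega>"
    have "(\<lambda>N. \<Sum>k<N. ?x (T / real N * real k) \<bullet>
              (?p (T / real N * (real k + 1)) *v integral {T / real N * real k..T / real N * (real k + 1)} ?\<beta>)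
            - T / real N * (?x (T / real N * (real k + 1)) \<bullet>
              (?p (T / real N * (real k + 1)) *v ?\<beta> (T / real N * (real k + 1))))) \<longlonglongrightarrow> 0"
    proof (rule tendsto_sum_right_endpoint[OF T, where z = "Z \<omega>" and c = P_norm and l = "L * Z \<omega>"])
      show "continuous_on {0..T} ?x" by (rule continuous_on_subset[OF elim(2)]) auto
      show "continuous (at s within {s..}) ?p" if "s \<in> {0..T}" for s
        by (rule right_continuous_state[where g = "\<lambda>i s. P i"]) (use elim(4) that in auto)
      show "continuous (at s within {s..}) ?\<beta>" if s: "s \<in> {0..T}" for s
      proof (rule right_continuous_state[where g = "\<lambda>i s. b i (X s \<omega>) (\<Phi> s \<omega>)"])
        show "\<exists>e>0. \<forall>s'\<in>{s..<s + e}. \<alpha> s' \<omega> = \<alpha> s \<omega>" using elim(4) s by auto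
        fix i
        have "continuous_on {0..} (\<lambda>s. (X s \<omega>, \<Phi> s \<omega>))" using elim(2,3) by (rule continuous_on_Pair)
        then have "continuous_on {0..} (\<lambda>s. (\<lambda>(x, \<phi>). b i x \<phi>) (X s \<omega>, \<Phi> s \<omega>))"
          by (rule continuous_on_compose2[OF b_continuous]) auto
        then have "continuous_on {0..} (\<lambda>s. b i (X s \<omega>) (\<Phi> s \<omega>))" by simp
        then have "continuous_on {s..} (\<lambda>s. b i (X s \<omega>) (\<Phi> s \<omega>))"
          by (rule continuous_on_subset) (use s in auto)
        then show "continuous (at s within {s..}) (\<lambda>s. b i (X s \<omega>) (\<Phi> s \<omega>))"
          by (simp add: continuous_on_eq_continuous_within)
      qed
      show "?\<beta> integrable_on {0..T}" using elim(5)[rule_format, of 0 T] T by (auto intro: has_integral_integrable)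
      show "norm (?x s) \<le> Z \<omega>" if "s \<in> {0..T}" for s using elim(1) that by auto
      show "norm (?\<beta> s) \<le> L * Z \<omega>" if s: "s \<in> {0..T}" for s
      proof -
        have "norm (?\<beta> s) \<le> L * norm (X s \<omega>)" using elim(6) s by auto
        also have "\<dots> \<le> L * Z \<omega>" using elim(1) s L_nonneg by (intro mult_left_mono) auto
        finally show ?thesis .
      qed
    qed (use P_bound in auto)
    moreover have "integral {T / real N * real k..T / real N * (real k + 1)} ?\<beta>
        = drift_increment (T / real N * real k) (T / real N * (real k + 1)) \<omega>" for N k
    proof (rule integral_unique)
      have "0 \<le> T / real N" using T by simp
      then have "0 \<le> T / real N * real k" "T / real N * real k \<le> T / real N * (real k + 1)"
        by (intro mult_nonneg_nonneg mult_left_mono; simp)+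
      then show "(?\<beta> has_integral drift_increment (T / real N * real k) (T / real N * (real k + 1)) \<omega>)
          {T / real N * real k..T / real N * (real k + 1)}"
        using elim(5) by blast
    qed
    ultimately show ?case unfolding riemann_error_def by simp
  qed
qed

lemma expectation_riemann_error:
  assumes T: "0 < T"
  shows "(\<lambda>N. expectation (riemann_error T N)) \<longlonglongrightarrow> 0"
    and "expectation (riemann_error T N) = (\<Sum>k<N.
       expectation (\<lambda>\<omega>. drift_work (T / real N * real k) (T / real N * (real k + 1)) \<omega>)
  - T / real N * expectation (\<lambda>\<omega>. drift_power (T / real N * (real k + 1)) \<omega>))"
proof -
  obtain Z where Z: "AE \<omega> in M. \<forall>s\<in>{0..T}. norm (X s \<omega>) \<le> Z \<omega>" "integrable M (\<lambda>\<omega>. (Z \<omega>)^2)" using X_dominated[of T] T by auto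
  have i1: "integrable M (\<lambda>\<omega>. drift_work (T / real N * real k) (T / real N * (real k + 1)) \<omega>)"
    and b1: "AE \<omega> in M. \<bar>drift_work (T / real N * real k) (T / real N * (real k + 1)) \<omega>\<bar>
       \<le> T / real N * (P_norm * L * (Z \<omega>)^2)" if k: "k < N" for N k
    using integrable_drift_increment[OF Z, of "T / real N * real k" "T / real N * (real k + 1)"] grid_bounds[OF T k] by auto
  have i2: "integrable M (\<lambda>\<omega>. drift_power (T / real N * (real k + 1)) \<omega>)"
    if k: "k < N" for N k
    using grid_bounds[OF T k] by (intro drift_plus_jump_nonpos(1)) linarith
  have i: "integrable M (riemann_error T N)" for N
    unfolding riemann_error_def using i1 i2 by (intro Bochner_Integration.integrable_sum) simp
  show "expectation (riemann_error T N) = (\<Sum>k<N.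
       expectation (\<lambda>\<omega>. drift_work (T / real N * real k) (T / real N * (real k + 1)) \<omega>)
  - T / real N * expectation (\<lambda>\<omega>. drift_power (T / real N * (real k + 1)) \<omega>))"
    unfolding riemann_error_def using i1 i2
    by (subst Bochner_Integration.integral_sum) (auto intro!: sum.cong)
  \<comment> \<open>The cells have total length T, and work and power each cost at most
    \<open>P_norm * L * (Z \<omega>)^2\<close> per unit of time. This gives the factor 2 * T,
    uniformly in N.\<close>
  have bd: "AE \<omega> in M. \<bar>riemann_error T N \<omega>\<bar> \<le> 2 * T * (P_norm * L * (Z \<omega>)^2)" for N
  proof (cases "N = 0")
    case True
    then show ?thesis using T P_bound(1) L_nonneg by (auto simp: riemann_error_def)
  next
    case N: False
    have "AE \<omega> in M. \<forall>k\<in>{..<N}. \<bar>drift_work (T / real N * real k) (T / real N * (real k + 1)) \<omega>\<bar>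
       \<le> T / real N * (P_norm * L * (Z \<omega>)^2)"
      by (rule AE_finite_allI) (use b1 in auto)
    with Z(1) drift_bound show ?thesis
    proof eventually_elim
      case (elim \<omega>)
      let ?z = "P_norm * L * (Z \<omega>)^2"
      have t2: "T / real N * \<bar>drift_power s \<omega>\<bar> \<le> T / real N * ?z" if s: "0 \<le> s" "s \<le> T" for s
      proof (rule mult_left_mono)
        have X: "norm (X s \<omega>) \<le> Z \<omega>" using elim(1) s by auto
        have "\<bar>drift_power s \<omega>\<bar> \<le> P_norm * (norm (X s \<omega>) * norm (drift s \<omega>))" by (rule abs_bilinear_le)
        also have "\<dots> \<le> P_norm * (Z \<omega> * (L * Z \<omega>))"
        proof -
          have "norm (drift s \<omega>) \<le> L * norm (X s \<omega>)" using elim(2) s by auto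
          also have "\<dots> \<le> L * Z \<omega>" using X L_nonneg by (rule mult_left_mono)
          finally have "norm (drift s \<omega>) \<le> L * Z \<omega>" .
          moreover have "0 \<le> Z \<omega>" using X norm_ge_zero order_trans by blast
          ultimately show ?thesis using X P_bound(1) by (intro mult_left_mono mult_mono) auto
        qed
        finally show "\<bar>drift_power s \<omega>\<bar> \<le> ?z" by (simp add: power2_eq_square ac_simps)
      qed (use T in auto)
      have "\<bar>riemann_error T N \<omega>\<bar> \<le> (\<Sum>k<N. T / real N * ?z + T / real N * ?z)"
        unfolding riemann_error_def
      proof (rule order_trans[OF sum_abs sum_mono])
        fix k assume "k \<in> {..<N}"
        then have k: "k < N" by simp
        have ge: "0 \<le> T / real N * (real k + 1)" using grid_bounds[OF T k] by linarith
        have TN: "\<bar>T / real N\<bar> = T / real N" using T by simp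
        show "\<bar>drift_work (T / real N * real k) (T / real N * (real k + 1)) \<omega>
          - T / real N * (drift_power (T / real N * (real k + 1)) \<omega>)\<bar>
          \<le> T / real N * ?z + T / real N * ?z"
          by (rule order_trans[OF abs_triangle_ineq4 add_mono])
            (use elim(3) k t2[OF ge grid_bounds(3)[OF T k]] in \<open>auto simp only: abs_mult TN lessThan_iff Ball_def\<close>)
      qed
      also have "\<dots> = 2 * T * ?z" using N by simp
      finally show ?case .
    qed
  qed
  have "(\<lambda>N. expectation (riemann_error T N)) \<longlonglongrightarrow> expectation (\<lambda>_. 0)"
  proof (rule integral_dominated_convergence)
    show "integrable M (\<lambda>\<omega>. 2 * T * (P_norm * L * (Z \<omega>)^2))" using Z(2) by simp
    show "AE \<omega> in M. (\<lambda>N. riemann_error T N \<omega>) \<longlonglongrightarrow> 0" by (rule riemann_error_tendsto[OF T])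
    show "AE \<omega> in M. norm (riemann_error T N \<omega>) \<le> 2 * T * (P_norm * L * (Z \<omega>)^2)" for N using bd[of N] by simp
  qed (use i in auto)
  then show "(\<lambda>N. expectation (riemann_error T N)) \<longlonglongrightarrow> 0" by simp
qed

text \<open>Of all contributions only the one of the noise survives refinement of the grid. The
  Riemann error, the quadratic remainders and the shift between jump rates at neighbouring grid
  points vanish as N grows.\<close>

lemma energy_growth:
  assumes T: "0 < T"
  shows "energy T \<le> energy 0 + T * (2 * P_norm * CARD('n))"
proof -
  obtain Z where Z: "AE \<omega> in M. \<forall>s\<in>{0..T}. norm (X s \<omega>) \<le> Z \<omega>" "integrable M (\<lambda>\<omega>. (Z \<omega>)^2)" using X_dominated[of T] T by auto
  obtain C where C: "C \<ge> 0" "\<And>d i j. 0 \<le> d \<Longrightarrow> d * C \<le> 1 \<Longrightarrow>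
       \<bar>mat_exp (d *\<^sub>R G) $ i $ j - mat 1 $ i $ j - d * G $ i $ j\<bar> \<le> (d * C)^2"
    using mat_exp_first_order[of G] by blast
  define K where "K = (2 * P_norm * L^2 + CARD('m)^2 * C^2 * P_norm) * expectation (\<lambda>\<omega>. (Z \<omega>)^2)"
  \<comment> \<open>The jump rates inside telescope to their values at 0 and T, and the mesh in
    front sends them to 0; continuity of \<open>jump_rate\<close> in time is never at issue.\<close>
  define err where "err N = 2 * expectation (riemann_error T N) + (jump_rate 0 - jump_rate T + T * K) * (T / real N)" for N
  \<comment> \<open>For d = T / N the condition yields d * C <= 1, the range of the first-order
    estimate for \<open>mat_exp\<close>. The summand 1 makes N positive.\<close>
  have bound: "energy T - energy 0 - T * (2 * P_norm * CARD('n)) \<le> err N" if N: "T * C + 1 \<le> real N" for N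
  proof -
    let ?d = "T / real N"
    have N0: "0 < N" using N T C(1) by (metis add_nonneg_pos less_le_trans mult_nonneg_nonneg less_imp_le of_nat_0_less_iff zero_less_one)
    have d0: "0 < ?d" using T N0 by simp
    have dC: "?d * C \<le> 1" using N N0 by (simp add: field_simps)
    \<comment> \<open>The jump rate arises at the left end and the power at the right end. Adding
      and subtracting the jump rate at the right end lets the dissipation inequality act
      there.\<close>
    have step: "energy (?d * (real k + 1)) - energy (?d * real k) \<le>
       2 * (expectation (\<lambda>\<omega>. drift_work (?d * real k) (?d * (real k + 1)) \<omega>)
       - ?d * expectation (\<lambda>\<omega>. drift_power (?d * (real k + 1)) \<omega>))
       + ?d * (jump_rate (?d * real k) - jump_rate (?d * (real k + 1))) + (?d * (2 * P_norm * CARD('n)) + ?d^2 * K)"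
      if k: "k < N" for k
    proof -
      note gb = grid_bounds[OF T k]
      have s0: "0 \<le> ?d * (real k + 1)" using gb by linarith
      have "energy (?d * real k + ?d) - energy (?d * real k) \<le>
         2 * expectation (\<lambda>\<omega>. X (?d * real k) \<omega> \<bullet> (P (\<alpha> (?d * real k + ?d) \<omega>) *v drift_increment (?d * real k) (?d * real k + ?d) \<omega>))
          + ?d * jump_rate (?d * real k) + ?d * (2 * P_norm * CARD('n)) + ?d^2 * K"
        unfolding K_def using gb by (intro energy_step[OF C(2) Z _ d0 dC]) auto
      moreover have "?d * (2 * expectation (\<lambda>\<omega>. drift_power (?d * (real k + 1)) \<omega>)
          + jump_rate (?d * (real k + 1))) \<le> 0"
        using drift_plus_jump_nonpos(2)[OF s0] d0 by (intro mult_nonneg_nonpos) auto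
      ultimately show ?thesis unfolding gb(2)[symmetric] by (simp only: right_diff_distrib distrib_left mult.left_commute[of _ 2])
    qed
    have "energy T - energy 0 = (\<Sum>k<N. energy (?d * (real k + 1)) - energy (?d * real k))"
      using sum_lessThan_telescope[of "\<lambda>k. energy (?d * real k)" N] N0 by (simp add: add.commute)
    also have "\<dots> \<le> (\<Sum>k<N. 2 * (expectation (\<lambda>\<omega>. drift_work (?d * real k) (?d * (real k + 1)) \<omega>)
       - ?d * expectation (\<lambda>\<omega>. drift_power (?d * (real k + 1)) \<omega>))
       + ?d * (jump_rate (?d * real k) - jump_rate (?d * (real k + 1))) + (?d * (2 * P_norm * CARD('n)) + ?d^2 * K))"
      by (intro sum_mono step) simp
    also have "\<dots> = 2 * expectation (riemann_error T N) + ?d * (\<Sum>k<N. jump_rate (?d * real k) - jump_rate (?d * (real k + 1)))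
        + real N * (?d * (2 * P_norm * CARD('n)) + ?d^2 * K)"
    proof -
      have "(\<Sum>k<N. 2 * f k + d * g k + r) = 2 * (\<Sum>k<N. f k) + d * (\<Sum>k<N. g k) + real N * r" for f g d and r :: real
        by (simp add: sum.distrib sum_distrib_left)
      then show ?thesis unfolding expectation_riemann_error(2)[OF T] .
    qed
    also have "(\<Sum>k<N. jump_rate (?d * real k) - jump_rate (?d * (real k + 1))) = jump_rate 0 - jump_rate T"
      using sum_lessThan_telescope'[of "\<lambda>k. jump_rate (?d * real k)" N] N0 by (simp add: add.commute)
    also have "real N * (?d * (2 * P_norm * CARD('n)) + ?d^2 * K) = T * (2 * P_norm * CARD('n)) + T * K * ?d"
    proof -
      have "n * (d * r + d^2 * K) = (n * d) * r + (n * d) * K * d" for n d r :: real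
        by (simp add: power2_eq_square algebra_simps)
      moreover have "real N * ?d = T" using N0 by simp
      ultimately show ?thesis by metis
    qed
    finally have "energy T - energy 0 \<le> 2 * expectation (riemann_error T N) + ?d * (jump_rate 0 - jump_rate T)
      + (T * (2 * P_norm * CARD('n)) + T * K * ?d)" .
    moreover have "err N = 2 * expectation (riemann_error T N) + ?d * (jump_rate 0 - jump_rate T) + T * K * ?d"
      unfolding err_def distrib_right by simp
    ultimately show ?thesis by linarith
  qed
  have "(\<lambda>N. T / real N) \<longlonglongrightarrow> 0" by (rule lim_const_over_n)
  then have "err \<longlonglongrightarrow> 2 * 0 + (jump_rate 0 - jump_rate T + T * K) * 0"
    unfolding err_def by (intro tendsto_intros expectation_riemann_error(1)[OF T])
  moreover obtain N0 :: nat where N0: "T * C + 1 \<le> real N0" using real_arch_simple by blast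
  have "\<exists>N. \<forall>n\<ge>N. energy T - energy 0 - T * (2 * P_norm * CARD('n)) \<le> err n"
  proof (intro exI allI impI bound)
    fix n assume "N0 \<le> n"
    then show "T * C + 1 \<le> real n" using N0 by linarith
  qed
  ultimately have "energy T - energy 0 - T * (2 * P_norm * CARD('n)) \<le> 2 * 0 + (jump_rate 0 - jump_rate T + T * K) * 0"
    by (rule LIMSEQ_le_const)
  then show ?thesis by simp
qed

end

section \<open>Almost sure growth\<close>

lemma growth_rate_nonpos:
  fixes x :: "real \<Rightarrow> real^'n"
  assumes "\<And>\<epsilon>. 0 < \<epsilon> \<Longrightarrow> \<exists>B. \<forall>t\<ge>0. (norm (x t))^2 \<le> B * exp (\<epsilon> * t)"
  shows "growth_rate x \<le> 0"
proof (rule ereal_le_epsilon2)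
  fix \<epsilon> :: real assume \<epsilon>: "0 < \<epsilon>"
  obtain B where B: "\<And>t. 0 \<le> t \<Longrightarrow> (norm (x t))^2 \<le> B * exp (\<epsilon> * t)" using assms[OF \<epsilon>] by blast
  have "eventually (\<lambda>t. (if x t = 0 then - \<infinity> else ereal (1 / t * ln (norm (x t)))) \<le> ereal \<epsilon>) at_top"
    \<comment> \<open>From this time on ln B <= \<epsilon> * t, so the constant is absorbed by one
      half of 2 * \<epsilon> * t. The lower bound 1 makes t positive for the division.\<close>
    using eventually_ge_at_top[of "max 1 (ln B / \<epsilon>)"]
  proof eventually_elim
    case (elim t)
    then have t: "1 \<le> t" "ln B / \<epsilon> \<le> t" by auto
    show ?case
    proof (cases "x t = 0")
      case False
      then have pos: "0 < norm (x t)" by simp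
      then have "0 < B * exp (\<epsilon> * t)" using B[of t] t by (smt (verit) zero_less_power)
      then have "0 < B" by (simp add: zero_less_mult_iff)
      have "2 * ln (norm (x t)) = ln ((norm (x t))^2)" using pos by (simp add: ln_realpow)
      also have "\<dots> \<le> ln (B * exp (\<epsilon> * t))" using B[of t] t pos \<open>0 < B\<close> by (intro ln_mono) auto
      also have "\<dots> = ln B + \<epsilon> * t" using \<open>0 < B\<close> by (simp add: ln_mult)
      also have "\<dots> \<le> 2 * (\<epsilon> * t)" using t \<epsilon> by (simp add: field_simps)
      finally have "ln (norm (x t)) \<le> \<epsilon> * t" by simp
      then have "1 / t * ln (norm (x t)) \<le> \<epsilon>" using t by (simp add: field_simps)
      then show ?thesis using False by simp
    qed simp
  qed
  then have "growth_rate x \<le> ereal \<epsilon>" unfolding growth_rate_def by (rule Limsup_bounded)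
  then show "growth_rate x \<le> 0 + ereal \<epsilon>" by simp
qed

text \<open>The weighted sum of all squares has finite mean because (k + 1) r^k is summable. It is
  therefore finite almost surely, and it dominates each of its terms.\<close>

lemma (in prob_space) AE_geometric_bound:
  fixes Z :: "nat \<Rightarrow> 'a \<Rightarrow> real"
  assumes Z: "\<And>k. Z k \<in> borel_measurable M" and int: "\<And>k. integrable M (\<lambda>\<omega>. (Z k \<omega>)^2)"
    and bound: "\<And>k. expectation (\<lambda>\<omega>. (Z k \<omega>)^2) \<le> D * real (Suc k)" and r: "0 < r" "r < 1"
  shows "AE \<omega> in M. \<exists>y. \<forall>k. r^k * (Z k \<omega>)^2 \<le> y"
proof -
  note Z[measurable]
  define Y where "Y \<omega> = (\<Sum>k. ennreal (r^k * (Z k \<omega>)^2))" for \<omega>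
  have [measurable]: "Y \<in> borel_measurable M" unfolding Y_def by measurable
  have D: "0 \<le> D"
  proof -
    have "0 \<le> expectation (\<lambda>\<omega>. (Z 0 \<omega>)^2)" by (intro integral_nonneg_AE) auto
    also have "\<dots> \<le> D" using bound[of 0] by simp
    finally show ?thesis .
  qed
  have s: "(\<lambda>k. D * (real (Suc k) * r^k)) sums (D * (1 / (1 - r)^2))"
    using r by (intro sums_mult geometric_deriv_sums) auto
  have "(\<integral>\<^sup>+\<omega>. Y \<omega> \<partial>M) = (\<Sum>k. \<integral>\<^sup>+\<omega>. ennreal (r^k * (Z k \<omega>)^2) \<partial>M)"
    unfolding Y_def by (rule nn_integral_suminf) simp
  also have "\<dots> \<le> (\<Sum>k. ennreal (D * (real (Suc k) * r^k)))"
  proof (rule suminf_le)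
    fix k
    have "(\<integral>\<^sup>+\<omega>. ennreal (r^k * (Z k \<omega>)^2) \<partial>M) = ennreal (expectation (\<lambda>\<omega>. r^k * (Z k \<omega>)^2))"
      using int r by (intro nn_integral_eq_integral) auto
    also have "\<dots> \<le> ennreal (D * (real (Suc k) * r^k))"
      using mult_left_mono[OF bound[of k], of "r^k"] r by (intro ennreal_leI) (simp add: ac_simps)
    finally show "(\<integral>\<^sup>+\<omega>. ennreal (r^k * (Z k \<omega>)^2) \<partial>M) \<le> ennreal (D * (real (Suc k) * r^k))" .
  qed auto
  also have "\<dots> = ennreal (D * (1 / (1 - r)^2))"
    using D r sums_unique[OF s] by (subst suminf_ennreal2[OF _ sums_summable[OF s]]) auto
  finally have "(\<integral>\<^sup>+\<omega>. Y \<omega> \<partial>M) \<noteq> \<infinity>" by (auto simp: top_unique)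
  then have "AE \<omega> in M. Y \<omega> \<noteq> \<infinity>" by (intro nn_integral_PInf_AE) auto
  then show ?thesis
  proof eventually_elim
    case (elim \<omega>)
    have "r^k * (Z k \<omega>)^2 \<le> enn2real (Y \<omega>)" for k
    proof -
      have "ennreal (r^k * (Z k \<omega>)^2) \<le> Y \<omega>"
        unfolding Y_def using sum_le_suminf[of "\<lambda>k. ennreal (r^k * (Z k \<omega>)^2)" "{k}"] by simp
      also have "Y \<omega> = ennreal (enn2real (Y \<omega>))" using elim by (simp add: ennreal_enn2real_if)
      finally show ?thesis by (simp add: ennreal_le_iff)
    qed
    then show ?case by blast
  qed
qed

context lyapunov_switching
begin

lemma mean_square_growth:
  assumes c: "0 < c" "\<And>i x. c * (norm x)^2 \<le> q i x"
  shows "\<exists>D. \<forall>t\<ge>0. expectation (\<lambda>\<omega>. (norm (X t \<omega>))^2) \<le> D * (1 + t)"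
proof -
  define K where "K = 2 * P_norm * CARD('n)"
  have K: "0 \<le> K" unfolding K_def using P_bound(1) by simp
  have "expectation (\<lambda>\<omega>. (norm (X t \<omega>))^2) \<le> (\<bar>energy 0\<bar> + K) / c * (1 + t)" if t: "0 \<le> t" for t
  proof -
    have "c * expectation (\<lambda>\<omega>. (norm (X t \<omega>))^2) = expectation (\<lambda>\<omega>. c * (norm (X t \<omega>))^2)" by simp
    also have "\<dots> \<le> energy t"
      unfolding energy_def
      by (rule integral_mono[OF _ expectation_q_state(1)[OF t t]]) (use integrable_X_square[OF t] c in auto)
    also have "energy t \<le> energy 0 + t * K"
      using energy_growth[of t] t unfolding K_def by (cases "t = 0") auto
    also have "\<dots> \<le> \<bar>energy 0\<bar> * 1 + K * t" by (simp add: mult.commute)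
    also have "\<dots> \<le> (\<bar>energy 0\<bar> + K) * (1 + t)"
      using K t mult_nonneg_nonneg[of "\<bar>energy 0\<bar>" t] by (simp add: algebra_simps)
    finally show ?thesis using c(1) by (simp add: field_simps)
  qed
  then show ?thesis by blast
qed

text \<open>The interval estimate starts afresh at every grid time k * h from the mean square there,
  which grows linearly. Iterating the pathwise bound instead would double it at each step and
  produce a positive exponential rate.\<close>

lemma growth_rate_nonpos_AE:
  assumes c: "0 < c" "\<And>i x. c * (norm x)^2 \<le> q i x"
  shows "AE \<omega> in M. growth_rate (\<lambda>t. X t \<omega>) \<le> 0"
proof -
  define h where "h = 1 / (2 * (L + 1))"
  have h: "0 < h" "h \<le> 1" "L * h \<le> 1/2" using L_nonneg by (auto simp: h_def field_simps)
  obtain D where D: "\<And>t. 0 \<le> t \<Longrightarrow> expectation (\<lambda>\<omega>. (norm (X t \<omega>))^2) \<le> D * (1 + t)"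
    using mean_square_growth[OF c] by blast
  have "0 \<le> expectation (\<lambda>\<omega>. (norm (X 0 \<omega>))^2)" by (intro integral_nonneg_AE) auto
  also have "\<dots> \<le> D" using D[of 0] by simp
  finally have D0: "0 \<le> D" .
  have kh: "0 \<le> real k * h" for k using h by simp
  obtain C where C: "0 \<le> C" "\<And>a. 0 \<le> a \<Longrightarrow> \<exists>S. S \<in> borel_measurable M \<and> (\<forall>\<omega>. 0 \<le> S \<omega>) \<and>
     integrable M (\<lambda>\<omega>. (S \<omega>)^2) \<and> expectation (\<lambda>\<omega>. (S \<omega>)^2) \<le> C \<and>
     (AE \<omega> in M. \<forall>s\<in>{a..a+1}. norm (W s \<omega> - W a \<omega>) \<le> S \<omega>)"
    using brownian_unit_interval_bound[OF brownian] by blast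
  have "\<forall>k. \<exists>S. S \<in> borel_measurable M \<and> (\<forall>\<omega>. 0 \<le> S \<omega>) \<and>
     integrable M (\<lambda>\<omega>. (S \<omega>)^2) \<and> expectation (\<lambda>\<omega>. (S \<omega>)^2) \<le> C \<and>
     (AE \<omega> in M. \<forall>s\<in>{real k * h..real k * h+1}. norm (W s \<omega> - W (real k * h) \<omega>) \<le> S \<omega>)"
    using C(2)[OF kh] by blast
  then obtain S where S: "\<forall>k. S k \<in> borel_measurable M \<and> (\<forall>\<omega>. 0 \<le> S k \<omega>) \<and>
     integrable M (\<lambda>\<omega>. (S k \<omega>)^2) \<and> expectation (\<lambda>\<omega>. (S k \<omega>)^2) \<le> C \<and>
     (AE \<omega> in M. \<forall>s\<in>{real k * h..real k * h+1}. norm (W s \<omega> - W (real k * h) \<omega>) \<le> S k \<omega>)"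
    by (rule choice[THEN exE])
  define Z where "Z k \<omega> = 2 * (norm (X (real k * h) \<omega>) + S k \<omega>)" for k \<omega>
  have [measurable]: "S k \<in> borel_measurable M" "X (real k * h) \<in> borel_measurable M" for k
    using S X_measurable[OF kh[of k]] by auto
  have Zm: "Z k \<in> borel_measurable M" for k unfolding Z_def by measurable
  have Zle: "(Z k \<omega>)^2 \<le> 8 * (norm (X (real k * h) \<omega>))^2 + 8 * (S k \<omega>)^2" for k \<omega>
    using sum_squares_bound[of "norm (X (real k * h) \<omega>)" "S k \<omega>"]
    unfolding Z_def by (simp add: power2_sum power_mult_distrib)
  have dom: "integrable M (\<lambda>\<omega>. 8 * (norm (X (real k * h) \<omega>))^2 + 8 * (S k \<omega>)^2)" for k
    using S integrable_X_square[OF kh] by simp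
  have Zi: "integrable M (\<lambda>\<omega>. (Z k \<omega>)^2)" for k
    by (rule Bochner_Integration.integrable_bound[OF dom[of k]]) (use Zle Zm in auto)
  have Ze: "expectation (\<lambda>\<omega>. (Z k \<omega>)^2) \<le> (8 * D + 8 * C) * real (Suc k)" for k
  proof -
    have "expectation (\<lambda>\<omega>. (Z k \<omega>)^2) \<le> expectation (\<lambda>\<omega>. 8 * (norm (X (real k * h) \<omega>))^2 + 8 * (S k \<omega>)^2)"
      by (rule integral_mono[OF Zi dom Zle])
    also have "\<dots> = 8 * expectation (\<lambda>\<omega>. (norm (X (real k * h) \<omega>))^2) + 8 * expectation (\<lambda>\<omega>. (S k \<omega>)^2)"
      using S integrable_X_square[OF kh[of k]] by simp
    also have "\<dots> \<le> 8 * (D * real (Suc k)) + 8 * (C * real (Suc k))"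
    proof (intro add_mono mult_left_mono)
      have "D * (1 + real k * h) \<le> D * real (Suc k)"
        using D0 mult_left_mono[OF h(2), of "real k"] by (intro mult_left_mono) auto
      then show "expectation (\<lambda>\<omega>. (norm (X (real k * h) \<omega>))^2) \<le> D * real (Suc k)"
        using D[OF kh[of k]] by linarith
      have "C * 1 \<le> C * real (Suc k)" using C(1) by (intro mult_left_mono) auto
      then show "expectation (\<lambda>\<omega>. (S k \<omega>)^2) \<le> C * real (Suc k)" using S by (auto intro: order_trans)
    qed auto
    finally show ?thesis by (simp only: distrib_right mult.assoc)
  qed
  have path: "AE \<omega> in M. \<forall>k. \<forall>t\<in>{real k * h..real k * h + h}. norm (X t \<omega>) \<le> Z k \<omega>"
    unfolding AE_all_countable Z_def
    using S h by (intro allI X_short_interval_bound[OF kh]) auto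
  \<comment> \<open>The weight at step k is exp(-k h / (n + 1)). Countably many rates 1 / (n + 1)
    share one null set and undercut every positive \<epsilon>.\<close>
  have "AE \<omega> in M. \<forall>n::nat. \<exists>y. \<forall>k. (exp (- (h / real (Suc n))))^k * (Z k \<omega>)^2 \<le> y"
    unfolding AE_all_countable using h by (intro allI AE_geometric_bound[OF Zm Zi Ze]) auto
  with path show ?thesis
  proof eventually_elim
    case (elim \<omega>)
    show ?case
    proof (rule growth_rate_nonpos)
      fix \<epsilon> :: real assume "0 < \<epsilon>"
      then obtain n :: nat where n: "1 / real (Suc n) < \<epsilon>" using nat_approx_posE by blast
      obtain y where y: "\<And>k. (exp (- (h / real (Suc n))))^k * (Z k \<omega>)^2 \<le> y" using elim(2) by blast
      have y0: "0 \<le> y" by (rule order_trans[OF _ y[of 0]]) simp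
      have "(norm (X t \<omega>))^2 \<le> y * exp (\<epsilon> * t)" if t: "0 \<le> t" for t
      proof -
        define k where "k = nat \<lfloor>t / h\<rfloor>"
        have "0 \<le> t / h" using t h by simp
        then have "real k = of_int \<lfloor>t / h\<rfloor>" unfolding k_def by simp
        then have "real k \<le> t / h" "t / h \<le> real k + 1" by linarith+
        then have k: "real k * h \<le> t" "t \<le> real k * h + h" using h(1) by (simp_all add: field_simps)
        then have "norm (X t \<omega>) \<le> Z k \<omega>" using elim(1) by auto
        then have "(norm (X t \<omega>))^2 \<le> (Z k \<omega>)^2" by (intro power_mono) auto
        also have "\<dots> = (exp (- (h / real (Suc n))))^k * (Z k \<omega>)^2 * exp (real k * h / real (Suc n))"
          by (simp add: exp_of_nat_mult[symmetric] exp_minus field_simps del: of_nat_Suc)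
        also have "\<dots> \<le> y * exp (\<epsilon> * t)"
        proof (intro mult_mono y)
          have "real k * h / real (Suc n) = (1 / real (Suc n)) * (real k * h)" by simp
          also have "\<dots> \<le> \<epsilon> * t" using n k kh[of k] \<open>0 < \<epsilon>\<close> by (intro mult_mono) auto
          finally show "exp (real k * h / real (Suc n)) \<le> exp (\<epsilon> * t)" by simp
        qed (use y0 in auto)
        finally show ?thesis .
      qed
      then show "\<exists>B. \<forall>t\<ge>0. (norm (X t \<omega>))^2 \<le> B * exp (\<epsilon> * t)" by blast
    qed
  qed
qed

end

section \<open>The feedback drift and the conclusion\<close>

lemma feedback_drift_continuous:
  fixes A P :: "'m::finite \<Rightarrow> real^'n^'n" and B :: "'m \<Rightarrow> real^'d^'n" and R :: "real^'d^'d"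
  shows "continuous_on UNIV (\<lambda>(x, \<phi>). A i *v x + B i *v feedback_law R B P x \<phi>)"
proof -
  have mv: "continuous_on UNIV (\<lambda>z. S *v g z)" if "continuous_on UNIV g"
    for S :: "real^'k^'l" and g :: "(real^'n) \<times> (real^'m) \<Rightarrow> real^'k"
    using bounded_linear.continuous_on[OF matrix_vector_mul_bounded_linear that] .
  show ?thesis
    unfolding feedback_law_def case_prod_unfold by (intro continuous_intros mv)
qed

text \<open>The feedback is linear in x and in \<phi> separately, and \<phi> stays in the unit cube,
  so L can be chosen independently of \<phi>. The factor \<open>CARD('m)\<close> counts the
  summands, each of weight at most 1.\<close>

lemma feedback_drift_linear_growth:
  fixes A P :: "'m::finite \<Rightarrow> real^'n^'n" and B :: "'m \<Rightarrow> real^'d^'n" and R :: "real^'d^'d"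
  shows "\<exists>L\<ge>0. \<forall>i x \<phi>. (\<forall>j. 0 \<le> \<phi> $ j) \<longrightarrow> (\<forall>j. \<phi> $ j \<le> 1) \<longrightarrow>
     norm (A i *v x + B i *v feedback_law R B P x \<phi>) \<le> L * norm x"
proof -
  obtain a where a: "a > 0" "\<forall>i x. norm (A i *v x) \<le> a * norm x" using matrix_family_bounded[of A] by (elim exE conjE)
  obtain \<beta> where \<beta>: "\<beta> > 0" "\<forall>i x. norm (B i *v x) \<le> \<beta> * norm x" using matrix_family_bounded[of B] by (elim exE conjE)
  obtain p where p: "p > 0" "\<forall>i x. norm ((transpose (B i) ** P i) *v x) \<le> p * norm x"
    using matrix_family_bounded[of "\<lambda>i. transpose (B i) ** P i"] by (elim exE conjE)
  \<comment> \<open>A single matrix is treated as a family over the one-point index type.\<close>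
  obtain \<rho> where \<rho>: "\<rho> > 0" "\<forall>(i::unit) x. norm (matrix_inv R *v x) \<le> \<rho> * norm x"
    using matrix_family_bounded[of "\<lambda>i::unit. matrix_inv R"] by (elim exE conjE)
  define L where "L = a + \<beta> * (\<rho> * (CARD('m) * p))"
  have "norm (A i *v x + B i *v feedback_law R B P x \<phi>) \<le> L * norm x"
    if \<phi>: "\<forall>j. 0 \<le> \<phi> $ j" "\<forall>j. \<phi> $ j \<le> 1" for i x \<phi>
  proof -
    let ?s = "\<Sum>i\<in>UNIV. \<phi> $ i *\<^sub>R (transpose (B i) *v (P i *v x))"
    have "norm ?s \<le> (\<Sum>i\<in>(UNIV::'m set). p * norm x)"
    proof (rule order_trans[OF norm_sum sum_mono])
      fix j
      have "norm (\<phi> $ j *\<^sub>R (transpose (B j) *v (P j *v x))) = \<phi> $ j * norm ((transpose (B j) ** P j) *v x)"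
        using \<phi> by (simp add: matrix_vector_mul_assoc)
      also have "\<dots> \<le> 1 * (p * norm x)" using \<phi> p by (intro mult_mono) auto
      finally show "norm (\<phi> $ j *\<^sub>R (transpose (B j) *v (P j *v x))) \<le> p * norm x" by simp
    qed
    then have s: "norm ?s \<le> CARD('m) * p * norm x" by simp
    have "norm (feedback_law R B P x \<phi>) = norm (matrix_inv R *v ?s)" unfolding feedback_law_def by simp
    also have "\<dots> \<le> \<rho> * norm ?s" using \<rho>(2) by blast
    also have "\<dots> \<le> \<rho> * (CARD('m) * p * norm x)" using s \<rho>(1) by (intro mult_left_mono) auto
    finally have u: "norm (feedback_law R B P x \<phi>) \<le> \<rho> * (CARD('m) * p * norm x)" .
    have "norm (A i *v x + B i *v feedback_law R B P x \<phi>) \<le> norm (A i *v x) + norm (B i *v feedback_law R B P x \<phi>)"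
      by (rule norm_triangle_ineq)
    also have "\<dots> \<le> a * norm x + \<beta> * (\<rho> * (CARD('m) * p * norm x))"
    proof (rule add_mono)
      show "norm (A i *v x) \<le> a * norm x" using a(2) by blast
      have "norm (B i *v feedback_law R B P x \<phi>) \<le> \<beta> * norm (feedback_law R B P x \<phi>)" using \<beta>(2) by blast
      also have "\<dots> \<le> \<beta> * (\<rho> * (CARD('m) * p * norm x))" using u \<beta>(1) by (intro mult_left_mono) auto
      finally show "norm (B i *v feedback_law R B P x \<phi>) \<le> \<beta> * (\<rho> * (CARD('m) * p * norm x))" .
    qed
    also have "\<dots> = L * norm x" by (simp add: L_def algebra_simps)
    finally show ?thesis .
  qed
  moreover have "0 \<le> L" unfolding L_def using a \<beta> \<rho> p by simp
  ultimately show ?thesis by blast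
qed

lemma pos_def_imp_pos_semidef:
  assumes "pos_def S"
  shows "pos_semidef S"
proof -
  have "0 \<le> v \<bullet> (S *v v)" for v
    using assms by (cases "v = 0") (auto simp: pos_def_def intro: less_imp_le)
  then show ?thesis using assms by (simp add: pos_semidef_def pos_def_def)
qed

theorem theorem4p8:
  fixes M :: "'w measure"
    and G :: "real ^ 'm ^ 'm"
    and A :: "'m::finite \<Rightarrow> real ^ 'n ^ 'n"
    and B :: "'m \<Rightarrow> real ^ 'd ^ 'n"
    and Q :: "real ^ 'n ^ 'n"
    and R :: "real ^ 'd ^ 'd"
    and P :: "'m \<Rightarrow> real ^ 'n ^ 'n"
    and \<alpha> :: "real \<Rightarrow> 'w \<Rightarrow> 'm"
    and W V X :: "real \<Rightarrow> 'w \<Rightarrow> real ^ 'n"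
    and \<Phi> :: "real \<Rightarrow> 'w \<Rightarrow> real ^ 'm"
  assumes "prob_space M"
    and "markov_chain M G \<alpha>"
    and "brownian_motion M (natural_filtration M W) W"
    and "pos_semidef Q"
    and "pos_def R"
    and "\<exists>Pbar. \<forall>i. neg_semidef (riccati G A B Q R Pbar i)"
    and "\<forall>i. pos_def (P i)"
    and "\<forall>i. riccati G A B Q R P i = 0"
    and "\<forall>i j. pos_def (Q - (1 / 2) *\<^sub>R ((P i ** B i - P j ** B j) ** matrix_inv R
                              ** transpose (P i ** B i - P j ** B j)))"
    and "switching_system M A B (feedback_law R B P) \<alpha> W X \<Phi>"
    and "wonham_filter M \<alpha> X \<Phi>"
    and "filter_system M (\<lambda>t. augment M (natural_filtration M X t)) G A B
           (feedback_law R B P) V X \<Phi>"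
  shows "AE \<omega> in M. growth_rate (\<lambda>t. X t \<omega>) \<le> 0"
proof -
  obtain L where L: "0 \<le> L" "\<forall>i x \<phi>. (\<forall>j. 0 \<le> \<phi> $ j) \<longrightarrow> (\<forall>j. \<phi> $ j \<le> 1) \<longrightarrow>
     norm (A i *v x + B i *v feedback_law R B P x \<phi>) \<le> L * norm x"
    using feedback_drift_linear_growth[of A B R P] by (elim exE conjE)
  obtain c where c: "0 < c" "\<forall>i x. c * (norm x)^2 \<le> x \<bullet> (P i *v x)"
    using pos_def_uniformly_bounded_below[of P, OF assms(7)[rule_format]] by (elim exE conjE)
  interpret prob_space M by fact
  \<comment> \<open>The same matrices P serve as gains inside the drift and as Lyapunov forms; this
    is what makes the dissipation inequality available.\<close>
  interpret lyapunov_switching M G "\<lambda>i x \<phi>. A i *v x + B i *v feedback_law R B P x \<phi>" L \<alpha> W X \<Phi> P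
  proof
    show "symmetric_mat (P i)" for i using assms(7) by (simp add: pos_def_def)
    then show "(\<Sum>i\<in>UNIV. \<phi> $ i * (2 * (x \<bullet> (P i *v (A i *v x + B i *v feedback_law R B P x \<phi>)))
        + (\<Sum>j\<in>UNIV. G $ i $ j * (x \<bullet> (P j *v x))))) \<le> 0"
      if "\<And>i. 0 \<le> \<phi> $ i" "(\<Sum>i\<in>UNIV. \<phi> $ i) = 1" for x \<phi>
      using assms(5,8,9) that by (intro riccati_feedback_dissipative[where Q = Q] pos_def_imp_pos_semidef) auto
    show "continuous_on UNIV (\<lambda>(x, \<phi>). A i *v x + B i *v feedback_law R B P x \<phi>)" for i
      by (rule feedback_drift_continuous)
    show "norm (A i *v x + B i *v feedback_law R B P x \<phi>) \<le> L * norm x"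
      if "\<And>j. 0 \<le> \<phi> $ j" "\<And>j. \<phi> $ j \<le> 1" for i x \<phi>
      using L(2) that by blast
  qed (use assms(2,3,10,11) L(1) in \<open>simp_all add: switching_system_def\<close>)
  show ?thesis by (rule growth_rate_nonpos_AE[OF c(1)]) (use c(2) in blast)
qed

end
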